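(* Let $X$ be a smooth complete toric variety of dimension $n$, let $T=(S^1)^n$ be the compact torus inside the big torus of $X$, and let $D_1,\dots,D_\ell$ be the $T$-invariant divisors corresponding to the one-dimensional cones of the fan of $X$. Suppose $K_X+\sum_i\delta_iD_i=0$ (as divisor classes) for integers $\delta_i\neq1$. Then the $T$-equivariant index of $$\mathcal{ELL}\Big(\sum_i\delta_iD_i\Big)=\bigotimes_{i=1}^{\ell}\theta'(0)\bigotimes_{m=1}^{\infty}\Lambda_{-y^{-\delta_i+1}q^{m-1}}\mathcal O(-D_i)\otimes\Lambda_{-y^{\delta_i-1}q^{m}}\mathcal O(D_i)\otimes S_{q^m}\mathcal O(-D_i)\otimes S_{q^m}\mathcal O(D_i)$$ is identically zero.
   Context: Here $\Lambda_sE=\sum_{k\ge0}s^k\Lambda^kE$ and $S_sE=\sum_{k\ge0}s^kS^kE$ are the total exterior and symmetric powers; $y=e^{2\pi iz}$, $q=e^{2\pi i\tau}$ with $z\in\mathbb C$, $\mathrm{Im}\,\tau>0$. The Jacobi theta function is $\theta(t,\tau)=q^{1/8}\,2\sin(\pi t)\prod_{l\ge1}(1-q^l)(1-q^le^{2\pi it})(1-q^le^{-2\pi it})$, and the scalar $\theta'(0)=\partial_t\theta(t,\tau)|_{t=0}$ is only a normalizing factor. The line bundles $\mathcal O(\pm D_i)$ carry their natural $T$-linearizations. The equivariant index of $\mathcal{ELL}$ is its $T$-equivariant holomorphic Euler characteristic (the character of the virtual $T$-module $\sum_k(-1)^kH^k(X,\mathcal{ELL})$, i.e. the equivariant index of the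 Dolbeault operator twisted by $\mathcal{ELL}$, taken coefficientwise in $q$). Equivalently, for a generic one-parameter subgroup $S^1\subset T$ with isolated fixed points, acting with exponent $m_i$ on $\mathcal O(D_i)$ at fixed points in $D_i$, it is, up to a normalization factor independent of $t$ and of the fixed points, $$\sum_{p}\prod_{i\in I_p}\frac{\theta(m_it-(-\delta_i+1)z,\tau)}{\theta(m_it,\tau)}\prod_{j\notin I_p}\theta(-(-\delta_j+1)z,\tau),$$ the sum over fixed points $p=\bigcap_{i\in I_p}D_i$ ($m_i=m_i(p)$ being the exponent of the action on $\mathcal O(D_i)|_p$, for $i\in I_p$). *)

theory Defs
  imports
    "HOL-Analysis.Analysis"
    "HOL-Library.Poly_Mapping"
    "HOL-Library.Function_Algebras"
    "HOL-Computational_Algebra.Formal_Power_Series"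
begin

section \<open>Fans\<close>

text \<open>
  The lattice of one-parameter subgroups \<open>N\<close> and the character lattice \<open>M\<close> are both \<open>\<int>\<^sup>n\<close>, with
  \<open>n = CARD('n)\<close>, dual to each other under \<open>pairing\<close>. A toric variety is given by its fan \<open>\<Delta>\<close> in
  \<open>N \<otimes> \<real> = \<real>\<^sup>n\<close>.
\<close>

type_synonym 'n lattice = "int ^ 'n"
type_synonym 'n cone = "(real ^ 'n) set"

definition real_vec :: "'n lattice \<Rightarrow> real ^ 'n" where
  "real_vec v = (\<chi> i. real_of_int (v $ i))"

definition pairing :: "'n::finite lattice \<Rightarrow> 'n lattice \<Rightarrow> int" where
  "pairing m u = (\<Sum>i\<in>UNIV. m $ i * u $ i)"

definition rational_cone :: "'n::finite cone \<Rightarrow> bool" where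
  "rational_cone \<sigma> \<longleftrightarrow> (\<exists>S. finite S \<and> \<sigma> = convex_cone hull (real_vec ` S))"

definition strongly_convex :: "'n::finite cone \<Rightarrow> bool" where
  "strongly_convex \<sigma> \<longleftrightarrow> \<sigma> \<inter> uminus ` \<sigma> = {0}"

text \<open>The library counts the empty set as a face; it is not a face in the sense of cones.\<close>

definition fan :: "'n::finite cone set \<Rightarrow> bool" where
  "fan \<Delta> \<longleftrightarrow> finite \<Delta> \<and> \<Delta> \<noteq> {} \<and>
     (\<forall>\<sigma>\<in>\<Delta>. rational_cone \<sigma> \<and> strongly_convex \<sigma>) \<and>
     (\<forall>\<sigma>\<in>\<Delta>. \<forall>\<tau>. \<tau> face_of \<sigma> \<and> \<tau> \<noteq> {} \<longrightarrow> \<tau> \<in> \<Delta>) \<and>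
     (\<forall>\<sigma>\<in>\<Delta>. \<forall>\<tau>\<in>\<Delta>. (\<sigma> \<inter> \<tau>) face_of \<sigma> \<and> (\<sigma> \<inter> \<tau>) face_of \<tau>)"

definition complete_fan :: "'n::finite cone set \<Rightarrow> bool" where
  "complete_fan \<Delta> \<longleftrightarrow> \<Union>\<Delta> = UNIV"

definition lattice_basis :: "'n::finite lattice set \<Rightarrow> bool" where
  "lattice_basis B \<longleftrightarrow> finite B \<and>
     (\<forall>v. \<exists>!c :: 'n lattice \<Rightarrow> int. (\<forall>b. b \<notin> B \<longrightarrow> c b = 0) \<and> v = (\<Sum>b\<in>B. c b *s b))"

definition smooth_fan :: "'n::finite cone set \<Rightarrow> bool" where
  "smooth_fan \<Delta> \<longleftrightarrow>
     (\<forall>\<sigma>\<in>\<Delta>. \<exists>B S. lattice_basis B \<and> S \<subseteq> B \<and> \<sigma> = convex_cone hull (real_vec ` S))"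

definition rays :: "'n::finite cone set \<Rightarrow> 'n cone set" where
  "rays \<Delta> = {\<rho> \<in> \<Delta>. dim \<rho> = 1}"

text \<open>The primitive generator of a ray \<open>\<rho>\<close>, i.e. the generator of the monoid \<open>\<rho> \<inter> N\<close>.\<close>

definition ray_gen :: "'n::finite cone \<Rightarrow> 'n lattice" where
  "ray_gen \<rho> = (THE u. {v. real_vec v \<in> \<rho>} = (\<lambda>k::nat. int k *s u) ` UNIV)"

definition maximal_cones :: "'n::finite cone set \<Rightarrow> 'n cone set" where
  "maximal_cones \<Delta> = {\<sigma> \<in> \<Delta>. \<forall>\<tau>\<in>\<Delta>. \<sigma> \<subseteq> \<tau> \<longrightarrow> \<tau> = \<sigma>}"


section \<open>Invariant divisors and the sheaves \<open>\<O>(D)\<close>\<close>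

text \<open>
  \<open>\<complex>[M]\<close> is the coordinate ring of the big torus; the character \<open>\<chi>\<^sup>m\<close> is \<open>Poly_Mapping.single m 1\<close>.
  A \<open>T\<close>-invariant divisor \<open>\<Sum> a\<^sub>\<rho> D\<^sub>\<rho>\<close> is an element of the free abelian group on the rays.
\<close>

type_synonym 'n laurent = "'n lattice \<Rightarrow>\<^sub>0 complex"
type_synonym 'n tdiv = "'n cone \<Rightarrow>\<^sub>0 int"

abbreviation prime_div :: "'n::finite cone \<Rightarrow> 'n tdiv" where
  "prime_div \<rho> \<equiv> Poly_Mapping.single \<rho> 1"

text \<open>
  The order of vanishing of \<open>f \<noteq> 0\<close> along \<open>D\<^sub>\<rho>\<close>: completing the primitive generator \<open>u\<close> of \<open>\<rho>\<close> to
  a lattice basis identifies the chart \<open>U\<^sub>\<rho>\<close> with \<open>\<complex> \<times> (\<complex>\<^sup>*)\<^bsup>n-1\<^esup>\<close> and \<open>D\<^sub>\<rho>\<close> with \<open>{x = 0}\<close>, where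
  \<open>x\<close> is the first coordinate, and \<open>pairing m u\<close> is the exponent of \<open>x\<close> in \<open>\<chi>\<^sup>m\<close>.
\<close>

definition ord_along :: "'n::finite cone \<Rightarrow> 'n laurent \<Rightarrow> int" where
  "ord_along \<rho> f = Min ((\<lambda>m. pairing m (ray_gen \<rho>)) ` Poly_Mapping.keys f)"

text \<open>
  Rational functions whose divisor is supported on the boundary have neither zeros nor poles on the
  big torus: they are the units of \<open>\<complex>[M]\<close>.
\<close>

definition linearly_equivalent :: "'n::finite cone set \<Rightarrow> 'n tdiv \<Rightarrow> 'n tdiv \<Rightarrow> bool" where
  "linearly_equivalent \<Delta> D E \<longleftrightarrow>
     (\<exists>f :: 'n laurent. f dvd 1 \<and>
        (\<forall>\<rho>\<in>rays \<Delta>. ord_along \<rho> f = Poly_Mapping.lookup (D - E) \<rho>))"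

text \<open>The divisor of the invariant rational form \<open>dt\<^sub>1/t\<^sub>1 \<and> \<dots> \<and> dt\<^sub>n/t\<^sub>n\<close>.\<close>

definition canonical_div :: "'n::finite cone set \<Rightarrow> 'n tdiv" where
  "canonical_div \<Delta> = - (\<Sum>\<rho>\<in>rays \<Delta>. prime_div \<rho>)"

text \<open>
  \<open>\<Gamma>(U\<^sub>\<sigma>, \<O>(D)) = {f. f = 0 or div f + D \<ge> 0 on U\<^sub>\<sigma>}\<close>. As \<open>D\<close> has no component meeting the big
  torus, such an \<open>f\<close> is regular there, so it suffices to consider \<open>f\<close> in \<open>\<complex>[M]\<close>. The divisors
  \<open>D\<^sub>\<rho>\<close> meeting \<open>U\<^sub>\<sigma>\<close> are those with \<open>\<rho> \<subseteq> \<sigma>\<close>. For \<open>D = 0\<close> this is the coordinate ring of \<open>U\<^sub>\<sigma>\<close>.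
\<close>

definition sections :: "'n::finite cone set \<Rightarrow> 'n tdiv \<Rightarrow> 'n cone \<Rightarrow> 'n laurent set" where
  "sections \<Delta> D \<sigma> =
     {f. f \<noteq> 0 \<longrightarrow> (\<forall>\<rho>\<in>rays \<Delta>. \<rho> \<subseteq> \<sigma> \<longrightarrow> ord_along \<rho> f + Poly_Mapping.lookup D \<rho> \<ge> 0)}"


section \<open>Cohomology\<close>

text \<open>
  The ordered Cech complex of the cover of \<open>X\<close> by the affine charts of the maximal cones: a
  \<open>p\<close>-cochain assigns to every set \<open>S\<close> of \<open>p + 1\<close> maximal cones a section over
  \<open>\<Inter>\<^bsub>\<sigma>\<in>S\<^esub> U\<^sub>\<sigma> = U\<^bsub>\<Inter>S\<^esub>\<close>. The order of the charts is an arbitrary enumeration of them. All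
  restriction maps are inclusions inside \<open>\<complex>[M]\<close>.
\<close>

type_synonym 'n cochain = "'n cone set \<Rightarrow> 'n laurent"

definition cochains :: "'n::finite cone set \<Rightarrow> 'n tdiv \<Rightarrow> nat \<Rightarrow> 'n cochain set" where
  "cochains \<Delta> D p =
     {c. \<forall>S. if S \<subseteq> maximal_cones \<Delta> \<and> card S = p + 1 then c S \<in> sections \<Delta> D (\<Inter>S) else c S = 0}"

definition cech_diff :: "'n::finite cone set \<Rightarrow> nat \<Rightarrow> 'n cochain \<Rightarrow> 'n cochain" where
  "cech_diff \<Delta> p c = (\<lambda>S.
     if S \<subseteq> maximal_cones \<Delta> \<and> card S = p + 2
     then \<Sum>\<sigma>\<in>S. (-1) ^ card {\<tau>\<in>S. to_nat_on (maximal_cones \<Delta>) \<tau> < to_nat_on (maximal_cones \<Delta>) \<sigma>}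
                   * c (S - {\<sigma>})
     else 0)"

definition cocycles :: "'n::finite cone set \<Rightarrow> 'n tdiv \<Rightarrow> nat \<Rightarrow> 'n cochain set" where
  "cocycles \<Delta> D p = {c \<in> cochains \<Delta> D p. cech_diff \<Delta> p c = 0}"

definition coboundaries :: "'n::finite cone set \<Rightarrow> 'n tdiv \<Rightarrow> nat \<Rightarrow> 'n cochain set" where
  "coboundaries \<Delta> D p = (case p of 0 \<Rightarrow> {0} | Suc q \<Rightarrow> cech_diff \<Delta> q ` cochains \<Delta> D q)"

definition scale_cochain :: "complex \<Rightarrow> 'n::finite cochain \<Rightarrow> 'n cochain" where
  "scale_cochain a c = (\<lambda>S. Poly_Mapping.map ((*) a) (c S))"

text \<open>For subspaces \<open>W \<subseteq> V\<close>: the dimension of \<open>V / W\<close>, as the least size of a generating set.\<close>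

definition quotient_dim :: "'n::finite cochain set \<Rightarrow> 'n cochain set \<Rightarrow> nat" where
  "quotient_dim V W =
     (LEAST d. \<exists>S. finite S \<and> card S = d \<and> S \<subseteq> V \<and> V \<subseteq> module.span scale_cochain (S \<union> W))"

definition compact_torus :: "(complex ^ 'n) set" where
  "compact_torus = {t. \<forall>i. cmod (t $ i) = 1}"

definition torus_char :: "'n::finite lattice \<Rightarrow> complex ^ 'n \<Rightarrow> complex" where
  "torus_char m t = (\<Prod>i\<in>UNIV. (t $ i) powi (m $ i))"

text \<open>
  \<open>T\<close> acts on functions by \<open>(t \<cdot> f)(x) = f(t\<^sup>-\<^sup>1 x)\<close>, so \<open>t \<cdot> \<chi>\<^sup>m = \<chi>\<^sup>m(t\<^sup>-\<^sup>1) \<chi>\<^sup>m\<close>. Restricted to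
  \<open>\<O>(D)\<close> as a sheaf of rational functions, this is its natural linearization, for which the
  canonical rational section \<open>1\<close> is invariant.
\<close>

definition act :: "complex ^ 'n \<Rightarrow> 'n::finite laurent \<Rightarrow> 'n laurent" where
  "act t f = Poly_Mapping.mapp (\<lambda>m a. torus_char (- m) t * a) f"

text \<open>
  The multiplicity of the weight \<open>w\<close> in \<open>H\<^sup>k(X, \<O>(D))\<close>, i.e. the dimension of the space of classes
  \<open>[c]\<close> with \<open>t \<cdot> [c] = \<chi>\<^sup>w(t) [c]\<close> for all \<open>t\<close> in \<open>T\<close>.
\<close>

definition weight_mult :: "'n::finite cone set \<Rightarrow> 'n tdiv \<Rightarrow> nat \<Rightarrow> 'n lattice \<Rightarrow> nat" where
  "weight_mult \<Delta> D k w = quotient_dim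
     {c \<in> cocycles \<Delta> D k. \<forall>t\<in>compact_torus.
        (\<lambda>S. act t (c S)) - scale_cochain (torus_char w t) c \<in> coboundaries \<Delta> D k}
     (coboundaries \<Delta> D k)"

text \<open>
  The character of a virtual \<open>T\<close>-module is encoded as the function sending a weight to its
  multiplicity. There are no nonzero \<open>k\<close>-cochains for \<open>k \<ge> card (maximal_cones \<Delta>)\<close>.
\<close>

definition euler_char :: "'n::finite cone set \<Rightarrow> 'n tdiv \<Rightarrow> 'n lattice \<Rightarrow> int" where
  "euler_char \<Delta> D w = (\<Sum>k<card (maximal_cones \<Delta>). (-1) ^ k * int (weight_mult \<Delta> D k w))"


section \<open>The elliptic bundle\<close>

text \<open>
  Finite complex combinations of the \<open>T\<close>-linearized line bundles \<open>\<O>(D)\<close>. Addition is direct sum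
  and, since \<open>\<O>(D) \<otimes> \<O>(E) = \<O>(D + E)\<close>, the group ring multiplication is the tensor product.
\<close>

type_synonym 'n vbundle = "'n tdiv \<Rightarrow>\<^sub>0 complex"

abbreviation scalar :: "complex \<Rightarrow> 'n::finite vbundle" where
  "scalar a \<equiv> Poly_Mapping.single 0 a"

definition line_bundle :: "'n::finite tdiv \<Rightarrow> 'n vbundle" where
  "line_bundle D = Poly_Mapping.single D 1"

definition equivariant_index :: "'n::finite cone set \<Rightarrow> 'n vbundle \<Rightarrow> 'n lattice \<Rightarrow> complex" where
  "equivariant_index \<Delta> E w =
     (\<Sum>D\<in>Poly_Mapping.keys E. Poly_Mapping.lookup E D * of_int (euler_char \<Delta> D w))"

text \<open>
  Total exterior and symmetric powers of a line bundle \<open>L\<close>, as power series in \<open>q\<close> (written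
  \<open>fps_X\<close>). The exterior powers \<open>\<Lambda>\<^sup>k L\<close> vanish for \<open>k \<ge> 2\<close>, and \<open>S\<^sup>k L = L\<^sup>k\<close>; the series of
  symmetric powers converges in the \<open>q\<close>-adic topology if \<open>s\<close> has no constant term.
\<close>

definition ext_total :: "'n::finite vbundle fps \<Rightarrow> 'n vbundle \<Rightarrow> 'n vbundle fps" where
  "ext_total s L = 1 + s * fps_const L"

definition sym_total :: "'n::finite vbundle fps \<Rightarrow> 'n vbundle \<Rightarrow> 'n vbundle fps" where
  "sym_total s L = suminf (\<lambda>k. s ^ k * fps_const (L ^ k))"

definition theta :: "complex \<Rightarrow> complex \<Rightarrow> complex" where
  "theta t \<tau> = (let q = exp (2 * of_real pi * \<i> * \<tau>); x = exp (2 * of_real pi * \<i> * t) in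
     exp (2 * of_real pi * \<i> * \<tau> / 8) * 2 * sin (of_real pi * t) *
     prodinf (\<lambda>l. (1 - q ^ Suc l) * (1 - q ^ Suc l * x) * (1 - q ^ Suc l * inverse x)))"

definition theta_prime_0 :: "complex \<Rightarrow> complex" where
  "theta_prime_0 \<tau> = deriv (\<lambda>t. theta t \<tau>) 0"

text \<open>
  The power series in \<open>q\<close> that represents the elliptic bundle twisted by \<open>\<Sum> \<delta>\<^sub>i D\<^sub>i\<close>, with
  \<open>y = e\<^bsup>2\<pi>iz\<^esup>\<close>. The factor \<open>theta_prime_0 \<tau>\<close> is a scalar and is not expanded in \<open>q\<close>. In the
  infinite tensor product, which converges \<open>q\<close>-adically, the index \<open>m\<close> starts at \<open>0\<close>.
\<close>

definition ELL ::
  "'n::finite cone set \<Rightarrow> ('n cone \<Rightarrow> int) \<Rightarrow> complex \<Rightarrow> complex \<Rightarrow> 'n vbundle fps" where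
  "ELL \<Delta> \<delta> z \<tau> = (let y = exp (2 * of_real pi * \<i> * z) in
     \<Prod>\<rho>\<in>rays \<Delta>. fps_const (scalar (theta_prime_0 \<tau>)) *
       prodinf (\<lambda>m. ext_total (fps_const (scalar (- (y powi (- \<delta> \<rho> + 1)))) * fps_X ^ m)
                (line_bundle (- prime_div \<rho>))
            * ext_total (fps_const (scalar (- (y powi (\<delta> \<rho> - 1)))) * fps_X ^ Suc m)
                (line_bundle (prime_div \<rho>))
            * sym_total (fps_X ^ Suc m) (line_bundle (- prime_div \<rho>))
            * sym_total (fps_X ^ Suc m) (line_bundle (prime_div \<rho>))))"

end

theory Submission
  imports Defs "HOL-Computational_Algebra.Formal_Laurent_Series"
begin

text \<open>
  Linear equivalence to \<open>0\<close> provides a character \<open>m\<close> with \<open>\<langle>m, u\<^sub>\<rho>\<rangle> = \<delta>\<^sub>\<rho> - 1\<close> for the primitive generators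
  \<open>u\<^sub>\<rho>\<close>. In a fixed weight, the Cech complex expresses the Euler characteristic of a divisor as an
  alternating sum over nonempty sets \<open>S\<close> of maximal cones of the condition \<open>\<langle>-w, u\<^sub>\<rho>\<rangle> + d\<^sub>\<rho> \<ge> 0\<close> for the
  rays \<open>\<rho>\<close> of \<open>\<Inter>S\<close>. Summed over the expansion of the elliptic bundle, this condition factors over
  the rays, and by Kronecker's expansion of a quotient of theta functions the factor of a ray \<open>\<rho>\<close> of
  \<open>\<Inter>S\<close> is \<open>A\<^sub>\<rho> / (1 - \<psi>(u\<^sub>\<rho>))\<close>, where \<open>\<psi>(u) = y\<^bsup>-\<langle>m,u\<rangle>\<^esup> q\<^bsup>\<langle>-w,u\<rangle>\<^esup>\<close>, and that of any other ray is
  \<open>A\<^sub>\<rho>\<close>. So the index is a multiple of \<open>\<Sum>\<^sub>S (-1)\<^bsup>|S|-1\<^esup> \<Prod>\<^sub>\<rho> 1 / (1 - \<psi>(u\<^sub>\<rho>))\<close>, the value at \<open>\<psi>\<close> of the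
  generating function of the lattice points of all of \<open>N\<close>, which is \<open>0\<close>. The denominators do not
  vanish if \<open>|y| \<noteq> 1\<close>, and the remaining \<open>z\<close> follow by continuity.
\<close>

section \<open>Euler characteristics of line bundles\<close>

text \<open>The index is defined by cohomology, one weight and one power of \<open>q\<close> at a
  time, so the argument does not localize at fixed points. What replaces localization is that in a
  fixed weight the Cech condition is a system of inequalities, one for each ray, each involving a
  single coefficient of the divisor. The condition on the divisor class makes the numbers
  \<open>y powi (1 - \<delta> \<rho>)\<close> values of one homomorphism on the lattice at the ray
  generators. Only then are all denominators of the form \<open>1 - \<psi> u\<close> for a single
  \<open>\<psi>\<close>, as the character identity demands. The power of \<open>q\<close> in
  \<open>\<psi> u\<close> may be negative, so denominators are inverted in formal Laurent series,
  although every cut-off sum is itself a power series in \<open>q\<close>. Since \<open>y\<close> is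
  a number, a denominator in which \<open>q\<close> has exponent 0 is a constant and can vanish;
  \<open>\<delta> \<rho> \<noteq> 1\<close> prevents this when \<open>y\<close> is off the unit
  circle. Continuity can then reach the other \<open>z\<close> because the cut-off sums are defined
  without these denominators.\<close>

context vector_space begin

section \<open>Dimensions of subspaces of a finite span\<close>

lemma finite_basis_extend:
  assumes "finite E" "V \<subseteq> span E" "A \<subseteq> V" "independent A"
  obtains B where "finite B" "A \<subseteq> B" "B \<subseteq> V" "independent B" "V \<subseteq> span B" "card B = dim V"
proof -
  obtain B where B: "A \<subseteq> B" "B \<subseteq> V" "independent B" "V \<subseteq> span B"
    using maximal_independent_subset_extend[OF assms(3,4)] by metis
  moreover have "finite B"
    using independent_span_bound[OF assms(1) B(3)] B(2) assms(2) by blast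
  ultimately show ?thesis using that basis_card_eq_dim by blast
qed

lemma finite_basis_exists:
  assumes "finite E" "V \<subseteq> span E"
  obtains B where "finite B" "B \<subseteq> V" "independent B" "V \<subseteq> span B" "card B = dim V"
  by (rule finite_basis_extend[OF assms empty_subsetI independent_empty]) (rule that)

text \<open>Spaces of cochains are infinite-dimensional in general, so only \<open>C\<close> is
  assumed to lie in a finite span. If a basis \<open>A\<close> of the kernel is extended to a basis
  \<open>B\<close> of \<open>C\<close>, the images of \<open>B - A\<close> span the image;
  conversely \<open>A\<close> and lifts \<open>G\<close> of a basis of the image span
  \<open>C\<close>.\<close>

lemma rank_nullity:
  assumes f: "module_hom scale scale f" and E: "finite E" "C \<subseteq> span E" and C: "subspace C"
  shows "dim C = dim {x\<in>C. f x = 0} + dim (f ` C)"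
proof -
  interpret f: module_hom scale scale f by fact
  let ?K = "{x\<in>C. f x = 0}"
  obtain A where A: "finite A" "A \<subseteq> ?K" "independent A" "?K \<subseteq> span A" "card A = dim ?K"
    using finite_basis_exists[OF E(1), of ?K] E(2) by blast
  obtain B where B: "finite B" "A \<subseteq> B" "B \<subseteq> C" "C \<subseteq> span B" "card B = dim C"
    by (rule finite_basis_extend[OF E _ A(3)]) (use A(2) in blast)+
  have "f ` C \<subseteq> span (f ` B)"
    using B(4) f.span_image by blast
  also have "\<dots> \<subseteq> span (insert 0 (f ` (B - A)))"
    using A(2) by (intro span_mono) auto
  also have "\<dots> = span (f ` (B - A))" by simp
  finally have "dim (f ` C) \<le> card (f ` (B - A))"
    using B(1) by (intro dim_le_card) auto
  also have "\<dots> \<le> card (B - A)" by (rule card_image_le) (use B(1) in auto)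
  also have "\<dots> = card B - card A" using A(1) B(2) by (rule card_Diff_subset)
  finally have le: "dim (f ` C) + dim ?K \<le> dim C"
    using A(5) B(5) card_mono[OF B(1,2)] by linarith
  have "f ` C \<subseteq> span (f ` E)" using E(2) f.span_image by blast
  then obtain D where D: "finite D" "D \<subseteq> f ` C" "f ` C \<subseteq> span D" "card D = dim (f ` C)"
    by (rule finite_basis_exists[rotated]) (use E(1) in blast)+
  obtain G where "G \<subseteq> C" "inj_on f G" "D = f ` G"
    using D(2) unfolding subset_image_inj by blast
  then have G: "G \<subseteq> C" "finite G" "f ` G = D" "card G = card D"
    using D(1) by (auto simp: card_image finite_image_iff)
  have "C \<subseteq> span (A \<union> G)"
  proof
    fix x assume x: "x \<in> C"
    then have "f x \<in> f ` span G" using D(3) G(3) f.span_image by blast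
    then obtain y where y: "y \<in> span G" "f x = f y" by blast
    have "y \<in> C" using y(1) G(1) C span_minimal by blast
    then have "x - y \<in> ?K" using x y(2) C by (simp add: subspace_diff f.diff)
    then have "x - y \<in> span A" using A(4) by blast
    then have "(x - y) + y \<in> span (A \<union> G)"
      by (intro span_add) (use y(1) span_mono[of A "A \<union> G"] span_mono[of G "A \<union> G"] in auto)
    then show "x \<in> span (A \<union> G)" by simp
  qed
  then have "dim C \<le> card (A \<union> G)" using A(1) G(2) by (intro dim_le_card) auto
  also have "\<dots> \<le> card A + card G" by (rule card_Un_le)
  finally show ?thesis using le A(5) D(4) G(4) by linarith
qed

text \<open>
  \<open>\<pi>\<close> projects \<open>V\<close> onto the finite-dimensional \<open>Z\<close> modulo \<open>W\<close>, so that \<open>V / W\<close> is \<open>Z / W'\<close>.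
\<close>

lemma Least_generators_mod:
  assumes \<pi>: "module_hom scale scale \<pi>" and W: "subspace W"
    and Z: "finite E" "Z \<subseteq> span E" "Z \<subseteq> V" "\<And>z. z \<in> Z \<Longrightarrow> \<pi> z = z"
    and W': "W' \<subseteq> W" "W' \<subseteq> Z" "\<pi> ` W \<subseteq> W'"
    and V: "\<And>c. c \<in> V \<Longrightarrow> c - \<pi> c \<in> W" "\<And>c. c \<in> V \<Longrightarrow> \<pi> c \<in> Z"
  shows "(LEAST d. \<exists>S. finite S \<and> card S = d \<and> S \<subseteq> V \<and> V \<subseteq> span (S \<union> W)) + dim W' = dim Z"
proof -
  interpret \<pi>: module_hom scale scale \<pi> by fact
  obtain A where A: "finite A" "A \<subseteq> W'" "independent A" "W' \<subseteq> span A" "card A = dim W'"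
    using finite_basis_exists[OF Z(1), of W'] W'(2) Z(2) by blast
  obtain B where B: "finite B" "A \<subseteq> B" "B \<subseteq> Z" "independent B" "Z \<subseteq> span B" "card B = dim Z"
    using finite_basis_extend[OF Z(1,2), of A] A(2,3) W'(2) by blast
  have "(LEAST d. \<exists>S. finite S \<and> card S = d \<and> S \<subseteq> V \<and> V \<subseteq> span (S \<union> W)) = card (B - A)"
  proof (rule Least_equality)
    have "V \<subseteq> span ((B - A) \<union> W)"
    proof
      fix c assume c: "c \<in> V"
      have "c - \<pi> c \<in> span ((B - A) \<union> W)" using V(1)[OF c] by (simp add: span_base)
      moreover have "\<pi> c \<in> span ((B - A) \<union> W)"
      proof -
        have "\<pi> c \<in> span B" using V(2)[OF c] B(5) by blast
        moreover have "B \<subseteq> (B - A) \<union> W" using A(2) W'(1) by blast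
        ultimately show ?thesis using span_mono by blast
      qed
      ultimately have "(c - \<pi> c) + \<pi> c \<in> span ((B - A) \<union> W)" by (rule span_add)
      then show "c \<in> span ((B - A) \<union> W)" by simp
    qed
    then show "\<exists>S. finite S \<and> card S = card (B - A) \<and> S \<subseteq> V \<and> V \<subseteq> span (S \<union> W)"
      using B(1,3) Z(3) by (intro exI[of _ "B - A"]) auto
  next
    fix d assume "\<exists>S. finite S \<and> card S = d \<and> S \<subseteq> V \<and> V \<subseteq> span (S \<union> W)"
    then obtain S where S: "finite S" "card S = d" "V \<subseteq> span (S \<union> W)" by blast
    \<comment> \<open>Projected by \<open>\<pi>\<close>, generators of \<open>V\<close> modulo
      \<open>W\<close> become generators of \<open>Z\<close> modulo \<open>W'\<close>, and
      \<open>W'\<close> is spanned by \<open>A\<close>. This bounds \<open>d\<close> from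
      below.\<close>
    have "Z \<subseteq> span (\<pi> ` S \<union> A)"
    proof
      fix z assume z: "z \<in> Z"
      then have "z \<in> \<pi> ` span (S \<union> W)" using Z(3,4) S(3) by (metis image_eqI subsetD)
      then have "z \<in> span (\<pi> ` S \<union> \<pi> ` W)" by (metis \<pi>.span_image image_Un)
      moreover have "\<pi> ` S \<union> \<pi> ` W \<subseteq> span (\<pi> ` S \<union> A)"
        using W'(3) A(4) span_mono[of A "\<pi> ` S \<union> A"] by (auto intro: span_base)
      ultimately show "z \<in> span (\<pi> ` S \<union> A)" using span_minimal subspace_span by blast
    qed
    then have "dim Z \<le> card (\<pi> ` S \<union> A)" using S(1) A(1) by (intro dim_le_card) auto
    also have "\<dots> \<le> card (\<pi> ` S) + card A" by (rule card_Un_le)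
    also have "\<dots> \<le> d + card A" using card_image_le[OF S(1)] S(2) by simp
    finally show "card (B - A) \<le> d" using B(2,6) A(1) by (simp add: card_Diff_subset)
  qed
  moreover have "card A \<le> card B" using B(1,2) by (rule card_mono)
  ultimately show ?thesis using A(1,5) B(2,6) by (simp add: card_Diff_subset)
qed

end

section \<open>Cochains as a complex vector space, and the Cech complex split by exponents\<close>

lemma lookup_scale_cochain [simp]:
  "Poly_Mapping.lookup (scale_cochain a c S) m = a * Poly_Mapping.lookup (c S) m"
  by (simp add: scale_cochain_def Poly_Mapping.map.rep_eq when_def)

lemma lookup_act [simp]:
  "Poly_Mapping.lookup (act t f) m = torus_char (- m) t * Poly_Mapping.lookup f m"
  by (simp add: act_def Poly_Mapping.mapp.rep_eq in_keys_iff)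

lemma sum_apply: "(\<Sum>a\<in>A. f a) x = (\<Sum>a\<in>A. f a x)"
  by (induction A rule: infinite_finite_induct) auto

lemma cochain_eqI:
  fixes c d :: "'n::finite cochain"
  assumes "\<And>S m. Poly_Mapping.lookup (c S) m = Poly_Mapping.lookup (d S) m"
  shows "c = d"
  by (intro ext poly_mapping_eqI assms)

global_interpretation cochain: vector_space "scale_cochain :: complex \<Rightarrow> 'n::finite cochain \<Rightarrow> 'n cochain"
  by unfold_locales (rule cochain_eqI; simp add: lookup_add algebra_simps)+

lemma cochain_module_homI:
  fixes f :: "'n::finite cochain \<Rightarrow> 'n cochain"
  assumes "\<And>c d. f (c + d) = f c + f d" "\<And>a c. f (scale_cochain a c) = scale_cochain a (f c)"
  shows "module_hom scale_cochain scale_cochain f"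
  unfolding module_hom_iff using assms cochain.module_axioms by blast

lemma lookup_minus_one_power_mult:
  "Poly_Mapping.lookup ((-1) ^ k * f) m = (-1) ^ k * Poly_Mapping.lookup (f :: 'n::finite laurent) m"
  by (cases "even k") auto

text \<open>Expresses that the character with exponent \<open>m\<close> is a section of
  \<open>O(D)\<close> over the chart of \<open>\<Inter>S\<close>. For fixed \<open>m\<close>, the
  sets satisfying it index a basis of the part of the Cech complex with exponent
  \<open>m\<close>.\<close>

definition admissible :: "'n::finite cone set \<Rightarrow> 'n tdiv \<Rightarrow> 'n lattice \<Rightarrow> 'n cone set \<Rightarrow> bool" where
  "admissible \<Delta> D m S \<longleftrightarrow>
     (\<forall>\<rho>\<in>rays \<Delta>. \<rho> \<subseteq> \<Inter>S \<longrightarrow> 0 \<le> pairing m (ray_gen \<rho>) + Poly_Mapping.lookup D \<rho>)"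

lemma admissible_mono: "admissible \<Delta> D m S \<Longrightarrow> S \<subseteq> S' \<Longrightarrow> admissible \<Delta> D m S'"
  unfolding admissible_def by (meson Inter_anti_mono order_trans)

text \<open>The order along a divisor is a minimum over exponents, so a lower bound for it is a
  condition on each exponent separately. Hence sections are spanned by characters and the complex
  splits by exponents.\<close>

lemma mem_sections_iff:
  "f \<in> sections \<Delta> D (\<Inter>S) \<longleftrightarrow> (\<forall>m. Poly_Mapping.lookup f m \<noteq> 0 \<longrightarrow> admissible \<Delta> D m S)"
proof (cases "f = 0")
  case False
  then have "Poly_Mapping.keys f \<noteq> {}" by simp
  have *: "0 \<le> ord_along \<rho> f + a \<longleftrightarrow> (\<forall>m\<in>Poly_Mapping.keys f. 0 \<le> pairing m (ray_gen \<rho>) + a)" for \<rho> a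
  proof -
    have "0 \<le> ord_along \<rho> f + a \<longleftrightarrow> - a \<le> ord_along \<rho> f" by linarith
    also have "\<dots> \<longleftrightarrow> (\<forall>m\<in>Poly_Mapping.keys f. - a \<le> pairing m (ray_gen \<rho>))"
      unfolding ord_along_def using \<open>Poly_Mapping.keys f \<noteq> {}\<close> by (subst Min_ge_iff) auto
    finally show ?thesis by (smt (verit))
  qed
  have "f \<in> sections \<Delta> D (\<Inter>S) \<longleftrightarrow> (\<forall>\<rho>\<in>rays \<Delta>. \<rho> \<subseteq> \<Inter>S \<longrightarrow>
      (\<forall>m\<in>Poly_Mapping.keys f. 0 \<le> pairing m (ray_gen \<rho>) + Poly_Mapping.lookup D \<rho>))"
    using False by (simp add: sections_def *)
  also have "\<dots> \<longleftrightarrow> (\<forall>m. Poly_Mapping.lookup f m \<noteq> 0 \<longrightarrow> admissible \<Delta> D m S)"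
    unfolding admissible_def Ball_def in_keys_iff by meson
  finally show ?thesis .
qed (simp add: sections_def)

lemma mem_cochains_iff:
  "c \<in> cochains \<Delta> D p \<longleftrightarrow> (\<forall>S m. Poly_Mapping.lookup (c S) m \<noteq> 0 \<longrightarrow>
     S \<subseteq> maximal_cones \<Delta> \<and> card S = p + 1 \<and> admissible \<Delta> D m S)"
proof -
  have "c S = 0 \<longleftrightarrow> (\<forall>m. Poly_Mapping.lookup (c S) m = 0)" for S
    by (metis lookup_zero poly_mapping_eqI)
  then show ?thesis unfolding cochains_def mem_sections_iff by auto
qed

definition cech_sign :: "'n::finite cone set \<Rightarrow> 'n cone set \<Rightarrow> 'n cone \<Rightarrow> complex" where
  "cech_sign \<Delta> S \<sigma> =
     (-1) ^ card {\<tau>\<in>S. to_nat_on (maximal_cones \<Delta>) \<tau> < to_nat_on (maximal_cones \<Delta>) \<sigma>}"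

lemma lookup_cech_diff:
  "Poly_Mapping.lookup (cech_diff \<Delta> p c S) m =
     (if S \<subseteq> maximal_cones \<Delta> \<and> card S = p + 2
      then \<Sum>\<sigma>\<in>S. cech_sign \<Delta> S \<sigma> * Poly_Mapping.lookup (c (S - {\<sigma>})) m else 0)"
  by (simp add: cech_diff_def cech_sign_def lookup_sum lookup_minus_one_power_mult)

definition weight_part :: "'n::finite lattice \<Rightarrow> 'n cochain \<Rightarrow> 'n cochain" where
  "weight_part m c = (\<lambda>S. Poly_Mapping.single m (Poly_Mapping.lookup (c S) m))"

lemma lookup_weight_part [simp]:
  "Poly_Mapping.lookup (weight_part m c S) m' = (if m = m' then Poly_Mapping.lookup (c S) m else 0)"
  by (simp add: weight_part_def lookup_single when_def)

lemma module_hom_cech_diff: "module_hom scale_cochain scale_cochain (cech_diff \<Delta> p)"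
  by (rule cochain_module_homI; rule cochain_eqI)
    (simp_all add: lookup_cech_diff lookup_add sum.distrib sum_distrib_left algebra_simps)

lemma module_hom_weight_part: "module_hom scale_cochain scale_cochain (weight_part m)"
  by (rule cochain_module_homI; rule cochain_eqI) (simp_all add: lookup_add)

lemma cech_diff_weight_part: "cech_diff \<Delta> p (weight_part m c) = weight_part m (cech_diff \<Delta> p c)"
  by (rule cochain_eqI) (simp add: lookup_cech_diff)

lemma weight_part_cochains: "c \<in> cochains \<Delta> D p \<Longrightarrow> weight_part m c \<in> cochains \<Delta> D p"
  by (auto simp: mem_cochains_iff split: if_splits)

lemma subspace_cochains: "cochain.subspace (cochains \<Delta> D p)"
  unfolding cochain.subspace_def
proof (intro conjI ballI allI)
  fix c d assume "c \<in> cochains \<Delta> D p" "d \<in> cochains \<Delta> D p"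
  moreover have "Poly_Mapping.lookup (c S) m \<noteq> 0 \<or> Poly_Mapping.lookup (d S) m \<noteq> 0"
    if "Poly_Mapping.lookup ((c + d) S) m \<noteq> 0" for S m
    using that by (auto simp: lookup_add)
  ultimately show "c + d \<in> cochains \<Delta> D p" unfolding mem_cochains_iff by meson
qed (auto simp: mem_cochains_iff)

lemma cech_diff_cochains:
  assumes "c \<in> cochains \<Delta> D p"
  shows "cech_diff \<Delta> p c \<in> cochains \<Delta> D (Suc p)"
  unfolding mem_cochains_iff
proof (intro allI impI)
  fix S m assume *: "Poly_Mapping.lookup (cech_diff \<Delta> p c S) m \<noteq> 0"
  then have S: "S \<subseteq> maximal_cones \<Delta>" "card S = p + 2"
    and "(\<Sum>\<sigma>\<in>S. cech_sign \<Delta> S \<sigma> * Poly_Mapping.lookup (c (S - {\<sigma>})) m) \<noteq> 0"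
    by (auto simp: lookup_cech_diff split: if_splits)
  then obtain \<sigma> where "Poly_Mapping.lookup (c (S - {\<sigma>})) m \<noteq> 0"
    by (metis (mono_tags, lifting) mult_zero_right sum.neutral)
  then have "admissible \<Delta> D m (S - {\<sigma>})" using assms by (auto simp: mem_cochains_iff)
  then have "admissible \<Delta> D m S" by (rule admissible_mono) auto
  then show "S \<subseteq> maximal_cones \<Delta> \<and> card S = Suc p + 1 \<and> admissible \<Delta> D m S"
    using S by simp
qed

lemma cech_diff_cech_diff:
  assumes fin: "finite (maximal_cones \<Delta>)"
  shows "cech_diff \<Delta> (Suc p) (cech_diff \<Delta> p c) = 0"
proof (rule cochain_eqI)
  fix S m
  show "Poly_Mapping.lookup (cech_diff \<Delta> (Suc p) (cech_diff \<Delta> p c) S) m = Poly_Mapping.lookup (0 S) m"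
  proof (cases "S \<subseteq> maximal_cones \<Delta> \<and> card S = Suc p + 2")
    case True
    let ?r = "to_nat_on (maximal_cones \<Delta>)"
    have finS: "finite S" using True fin finite_subset by blast
    define F where "F \<sigma> \<tau> = cech_sign \<Delta> S \<sigma> * cech_sign \<Delta> (S - {\<sigma>}) \<tau> *
      Poly_Mapping.lookup (c (S - {\<sigma>} - {\<tau>})) m" for \<sigma> \<tau>
    \<comment> \<open>Deleting \<open>\<sigma>\<close> does not change the position of the earlier
      \<open>\<tau>\<close>, but deleting \<open>\<tau>\<close> lowers that of
      \<open>\<sigma>\<close> by one, so the two orders of deletion carry opposite signs.\<close>
    have anti: "F \<tau> \<sigma> = - F \<sigma> \<tau>" if "\<sigma> \<in> S" "\<tau> \<in> S" "?r \<tau> < ?r \<sigma>" for \<sigma> \<tau>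
    proof -
      have "{\<kappa>\<in>S - {\<sigma>}. ?r \<kappa> < ?r \<tau>} = {\<kappa>\<in>S. ?r \<kappa> < ?r \<tau>}" using that by auto
      then have 1: "cech_sign \<Delta> (S - {\<sigma>}) \<tau> = cech_sign \<Delta> S \<tau>" by (simp add: cech_sign_def)
      have "{\<kappa>\<in>S. ?r \<kappa> < ?r \<sigma>} = insert \<tau> {\<kappa>\<in>S - {\<tau>}. ?r \<kappa> < ?r \<sigma>}" using that by auto
      then have "card {\<kappa>\<in>S. ?r \<kappa> < ?r \<sigma>} = Suc (card {\<kappa>\<in>S - {\<tau>}. ?r \<kappa> < ?r \<sigma>})"
        using finS by (simp add: card_insert_if)
      then have 2: "cech_sign \<Delta> S \<sigma> = - cech_sign \<Delta> (S - {\<tau>}) \<sigma>" by (simp add: cech_sign_def)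
      have "S - {\<tau>} - {\<sigma>} = S - {\<sigma>} - {\<tau>}" by blast
      then show ?thesis unfolding F_def 1 2 by simp
    qed
    have r: "?r \<sigma> = ?r \<tau> \<longleftrightarrow> \<sigma> = \<tau>" if "\<sigma> \<in> S" "\<tau> \<in> S" for \<sigma> \<tau>
      using inj_on_to_nat_on[OF countable_finite[OF fin]] that True by (meson inj_onD subsetD)
    have "Poly_Mapping.lookup (cech_diff \<Delta> (Suc p) (cech_diff \<Delta> p c) S) m =
        (\<Sum>\<sigma>\<in>S. \<Sum>\<tau>\<in>S - {\<sigma>}. F \<sigma> \<tau>)"
      unfolding F_def using True finS
      by (auto simp: lookup_cech_diff sum_distrib_left mult.assoc intro!: sum.cong)
    also have "\<dots> = (\<Sum>\<sigma>\<in>S. \<Sum>\<tau>\<in>S. if \<tau> = \<sigma> then 0 else F \<sigma> \<tau>)"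
      using finS by (intro sum.cong refl sum.mono_neutral_cong_left) auto
    finally have eq: "Poly_Mapping.lookup (cech_diff \<Delta> (Suc p) (cech_diff \<Delta> p c) S) m =
        (\<Sum>\<sigma>\<in>S. \<Sum>\<tau>\<in>S. if \<tau> = \<sigma> then 0 else F \<sigma> \<tau>)" (is "_ = ?s") .
    have "?s = (\<Sum>\<sigma>\<in>S. \<Sum>\<tau>\<in>S. if \<tau> = \<sigma> then 0 else F \<tau> \<sigma>)"
      by (subst sum.swap) (intro sum.cong, auto)
    also have "\<dots> = (\<Sum>\<sigma>\<in>S. \<Sum>\<tau>\<in>S. - (if \<tau> = \<sigma> then 0 else F \<sigma> \<tau>))"
    proof (intro sum.cong refl)
      fix \<sigma> \<tau> assume "\<sigma> \<in> S" "\<tau> \<in> S"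
      then consider "\<sigma> = \<tau>" | "?r \<tau> < ?r \<sigma>" | "?r \<sigma> < ?r \<tau>" using r by (meson linorder_less_linear)
      then show "(if \<tau> = \<sigma> then 0 else F \<tau> \<sigma>) = - (if \<tau> = \<sigma> then 0 else F \<sigma> \<tau>)"
      proof cases
        case 2 then show ?thesis using anti[of \<sigma> \<tau>] \<open>\<sigma> \<in> S\<close> \<open>\<tau> \<in> S\<close> by simp
      next
        case 3 then show ?thesis using anti[of \<tau> \<sigma>] \<open>\<sigma> \<in> S\<close> \<open>\<tau> \<in> S\<close> by simp
      qed simp
    qed
    also have "\<dots> = - ?s" by (simp add: sum_negf)
    finally show ?thesis using eq by simp
  qed (simp only: lookup_cech_diff if_False, simp)
qed

lemma subspace_cocycles: "cochain.subspace (cocycles \<Delta> D p)"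
proof -
  interpret d: module_hom scale_cochain scale_cochain "cech_diff \<Delta> p" by (rule module_hom_cech_diff)
  show ?thesis using subspace_cochains[of \<Delta> D p]
    by (auto simp: cocycles_def cochain.subspace_def d.add d.scale)
qed

lemma subspace_coboundaries: "cochain.subspace (coboundaries \<Delta> D p)"
proof (cases p)
  case (Suc q)
  interpret d: module_hom scale_cochain scale_cochain "cech_diff \<Delta> q" by (rule module_hom_cech_diff)
  show ?thesis using d.subspace_image[OF subspace_cochains] by (simp add: Suc coboundaries_def)
qed (simp add: coboundaries_def)

lemma coboundaries_subset_cocycles:
  assumes "finite (maximal_cones \<Delta>)"
  shows "coboundaries \<Delta> D p \<subseteq> cocycles \<Delta> D p"
proof (cases p)
  case 0
  then show ?thesis using subspace_cocycles[of \<Delta> D 0] by (simp add: coboundaries_def cochain.subspace_0)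
next
  case (Suc q)
  then show ?thesis
    using cech_diff_cochains cech_diff_cech_diff[OF assms] by (auto simp: coboundaries_def cocycles_def)
qed

lemma weight_part_coboundaries: "c \<in> coboundaries \<Delta> D p \<Longrightarrow> weight_part m c \<in> coboundaries \<Delta> D p"
proof (cases p)
  case 0
  assume "c \<in> coboundaries \<Delta> D p"
  then show ?thesis using 0 by (simp add: coboundaries_def) (rule cochain_eqI, simp)
next
  case (Suc q)
  assume "c \<in> coboundaries \<Delta> D p"
  then show ?thesis using Suc
    by (auto simp: coboundaries_def weight_part_cochains simp flip: cech_diff_weight_part)
qed

lemma weight_part_cocycles: "c \<in> cocycles \<Delta> D p \<Longrightarrow> weight_part m c \<in> cocycles \<Delta> D p"
  by (auto simp: cocycles_def weight_part_cochains cech_diff_weight_part) (rule cochain_eqI, simp)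

lemma weight_part_idem [simp]: "weight_part m (weight_part m c) = weight_part m c"
  by (rule cochain_eqI) simp

section \<open>Torus weights and the alternating sum of dimensions\<close>

lemma torus_char_separates:
  assumes "m \<noteq> (m' :: 'n::finite lattice)"
  obtains t where "t \<in> compact_torus" "torus_char m t \<noteq> torus_char m' t"
proof -
  obtain i where i: "m $ i \<noteq> m' $ i" using assms by (metis vec_eq_iff)
  \<comment> \<open>Chosen so that the character of \<open>m - m'\<close> takes the value -1 at
    \<open>t\<close>.\<close>
  define t :: "complex ^ 'n" where "t = (\<chi> j. if j = i then cis (pi / of_int (m $ i - m' $ i)) else 1)"
  have *: "torus_char k t = cis (of_int (k $ i) * (pi / of_int (m $ i - m' $ i)))" for k
  proof -
    have "torus_char k t = (\<Prod>j\<in>UNIV. if j = i then cis (pi / of_int (m $ i - m' $ i)) powi (k $ i) else 1)"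
      unfolding torus_char_def t_def by (intro prod.cong) auto
    then show ?thesis by (simp add: cis_power_int)
  qed
  have "torus_char m t = torus_char m' t * cis pi"
    unfolding * cis_mult using i by (intro arg_cong[of _ _ cis]) (simp add: field_simps)
  then have "torus_char m t \<noteq> torus_char m' t"
    unfolding * by auto
  moreover have "t \<in> compact_torus" by (simp add: compact_torus_def t_def)
  ultimately show ?thesis using that by blast
qed

definition weight_space :: "'n::finite lattice \<Rightarrow> 'n cochain set" where
  "weight_space m = {c. weight_part m c = c}"

definition unit_cochain :: "'n::finite lattice \<Rightarrow> 'n cone set \<Rightarrow> 'n cochain" where
  "unit_cochain m S = (\<lambda>S'. if S' = S then Poly_Mapping.single m 1 else 0)"

lemma lookup_unit_cochain [simp]:
  "Poly_Mapping.lookup (unit_cochain m S S') m' = (if S' = S \<and> m' = m then 1 else 0)"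
  by (auto simp: unit_cochain_def lookup_single when_def)

lemma cochain_expand:
  assumes "finite A" "\<And>S. S \<notin> A \<Longrightarrow> Poly_Mapping.lookup (c S) m = 0" "c \<in> weight_space m"
  shows "c = (\<Sum>S\<in>A. scale_cochain (Poly_Mapping.lookup (c S) m) (unit_cochain m S))"
proof (rule cochain_eqI)
  fix S m'
  have "Poly_Mapping.lookup (c S) m' = Poly_Mapping.lookup (weight_part m c S) m'"
    using assms(3) by (simp add: weight_space_def)
  then show "Poly_Mapping.lookup (c S) m' =
      Poly_Mapping.lookup ((\<Sum>S\<in>A. scale_cochain (Poly_Mapping.lookup (c S) m) (unit_cochain m S)) S) m'"
    using assms(1,2)
    by (cases "m' = m") (auto simp: lookup_sum sum_apply if_distrib cong: if_cong split: if_splits)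
qed

lemma weight_space_cochains_span:
  assumes "finite (maximal_cones \<Delta>)"
  shows "cochains \<Delta> D p \<inter> weight_space m \<subseteq>
    cochain.span (unit_cochain m ` {S. S \<subseteq> maximal_cones \<Delta> \<and> card S = p + 1 \<and> admissible \<Delta> D m S})"
    (is "_ \<subseteq> cochain.span (_ ` ?A)")
proof
  fix c assume c: "c \<in> cochains \<Delta> D p \<inter> weight_space m"
  have "c = (\<Sum>S\<in>?A. scale_cochain (Poly_Mapping.lookup (c S) m) (unit_cochain m S))"
    using c assms by (intro cochain_expand) (auto simp: mem_cochains_iff)
  also have "\<dots> \<in> cochain.span (unit_cochain m ` ?A)"
    by (intro cochain.span_sum cochain.span_scale cochain.span_base) auto
  finally show "c \<in> cochain.span (unit_cochain m ` ?A)" .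
qed

lemma dim_weight_space_cochains:
  assumes fin: "finite (maximal_cones \<Delta>)"
  shows "cochain.dim (cochains \<Delta> D p \<inter> weight_space m) =
    card {S. S \<subseteq> maximal_cones \<Delta> \<and> card S = p + 1 \<and> admissible \<Delta> D m S}" (is "_ = card ?A")
proof (rule cochain.dim_unique)
  have inj: "inj (unit_cochain m)"
  proof (rule injI)
    fix S S' assume "unit_cochain m S = unit_cochain m S'"
    then have "Poly_Mapping.lookup (unit_cochain m S S) m = Poly_Mapping.lookup (unit_cochain m S' S) m"
      by simp
    then show "S = S'" by (simp split: if_splits)
  qed
  show "unit_cochain m ` ?A \<subseteq> cochains \<Delta> D p \<inter> weight_space m"
    by (auto simp: mem_cochains_iff weight_space_def split: if_splits intro!: cochain_eqI)
  show "cochains \<Delta> D p \<inter> weight_space m \<subseteq> cochain.span (unit_cochain m ` ?A)"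
    by (rule weight_space_cochains_span[OF fin])
  show "card (unit_cochain m ` ?A) = card ?A"
    using inj by (intro card_image) (auto intro: inj_on_subset)
  show "cochain.independent (unit_cochain m ` ?A)"
  proof (rule cochain.independent_if_scalars_zero)
    show "finite (unit_cochain m ` ?A)" using fin by simp
    fix f x assume 0: "(\<Sum>x\<in>unit_cochain m ` ?A. scale_cochain (f x) x) = 0" and "x \<in> unit_cochain m ` ?A"
    then obtain S where S: "S \<in> ?A" "x = unit_cochain m S" by blast
    have finA: "finite ?A" using fin by simp
    have "(\<Sum>S\<in>?A. scale_cochain (f (unit_cochain m S)) (unit_cochain m S)) = 0"
      using 0 inj by (subst (asm) sum.reindex) (auto intro: inj_on_subset)
    then have "Poly_Mapping.lookup ((\<Sum>S\<in>?A. scale_cochain (f (unit_cochain m S)) (unit_cochain m S)) S) m = 0"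
      by simp
    then show "f x = 0" using S finA
      by (simp add: sum_apply lookup_sum if_distrib cong: if_cong)
  qed
qed

lemma subspace_weight_space: "cochain.subspace (weight_space m)"
proof -
  interpret p: module_hom scale_cochain scale_cochain "weight_part m" by (rule module_hom_weight_part)
  show ?thesis by (auto simp: cochain.subspace_def weight_space_def p.add p.scale)
qed

lemma dim_cochains_eq:
  assumes fin: "finite (maximal_cones \<Delta>)"
  shows "cochain.dim (cochains \<Delta> D p \<inter> weight_space m) =
    cochain.dim (cocycles \<Delta> D p \<inter> weight_space m) +
    cochain.dim (coboundaries \<Delta> D (Suc p) \<inter> weight_space m)"
proof -
  have image: "cech_diff \<Delta> p ` (cochains \<Delta> D p \<inter> weight_space m) = coboundaries \<Delta> D (Suc p) \<inter> weight_space m"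
  proof (intro equalityI subsetI)
    fix c assume "c \<in> coboundaries \<Delta> D (Suc p) \<inter> weight_space m"
    then obtain b where b: "b \<in> cochains \<Delta> D p" "c = cech_diff \<Delta> p b" "weight_part m c = c"
      by (auto simp: coboundaries_def weight_space_def)
    \<comment> \<open>As \<open>c\<close> has the single exponent \<open>m\<close>, the preimage may
      be replaced by its part with exponent \<open>m\<close>.\<close>
    then have "c = cech_diff \<Delta> p (weight_part m b)" by (simp add: cech_diff_weight_part)
    then show "c \<in> cech_diff \<Delta> p ` (cochains \<Delta> D p \<inter> weight_space m)"
      using b(1) by (auto simp: weight_space_def intro: weight_part_cochains)
  qed (auto simp: coboundaries_def weight_space_def simp flip: cech_diff_weight_part)
  have kernel: "{c \<in> cochains \<Delta> D p \<inter> weight_space m. cech_diff \<Delta> p c = 0} =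
      cocycles \<Delta> D p \<inter> weight_space m"
    by (auto simp: cocycles_def)
  have finE: "finite (unit_cochain m ` {S. S \<subseteq> maximal_cones \<Delta> \<and> card S = p + 1 \<and> admissible \<Delta> D m S})"
    using fin by simp
  have "cochain.dim (cochains \<Delta> D p \<inter> weight_space m) =
      cochain.dim {c \<in> cochains \<Delta> D p \<inter> weight_space m. cech_diff \<Delta> p c = 0} +
      cochain.dim (cech_diff \<Delta> p ` (cochains \<Delta> D p \<inter> weight_space m))"
    by (rule cochain.rank_nullity[OF module_hom_cech_diff finE weight_space_cochains_span[OF fin]
          cochain.subspace_inter[OF subspace_cochains subspace_weight_space]])
  then show ?thesis unfolding image kernel .
qed

text \<open>A character with exponent \<open>m\<close> has weight \<open>- m\<close> under
  \<open>act\<close>, which explains \<open>- w\<close>. Classes are eigenvectors only modulo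
  coboundaries. At a torus element separating two characters, a nonzero multiple of the part with
  the wrong exponent is a coboundary, so only the exponent \<open>- w\<close> survives in the
  quotient.\<close>

lemma weight_mult_eq:
  assumes fin: "finite (maximal_cones \<Delta>)"
  shows "weight_mult \<Delta> D k w + cochain.dim (coboundaries \<Delta> D k \<inter> weight_space (- w)) =
    cochain.dim (cocycles \<Delta> D k \<inter> weight_space (- w))"
  unfolding weight_mult_def quotient_dim_def
proof (rule cochain.Least_generators_mod)
  let ?V = "{c \<in> cocycles \<Delta> D k. \<forall>t\<in>compact_torus.
        (\<lambda>S. act t (c S)) - scale_cochain (torus_char w t) c \<in> coboundaries \<Delta> D k}"
  show "module_hom scale_cochain scale_cochain (weight_part (- w))" by (rule module_hom_weight_part)
  show "cochain.subspace (coboundaries \<Delta> D k)" by (rule subspace_coboundaries)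
  show "finite (unit_cochain (- w) ` {S. S \<subseteq> maximal_cones \<Delta> \<and> card S = k + 1 \<and> admissible \<Delta> D (- w) S})"
    using fin by simp
  show "cocycles \<Delta> D k \<inter> weight_space (- w) \<subseteq>
      cochain.span (unit_cochain (- w) ` {S. S \<subseteq> maximal_cones \<Delta> \<and> card S = k + 1 \<and> admissible \<Delta> D (- w) S})"
    using weight_space_cochains_span[OF fin, of D k "- w"] by (auto simp: cocycles_def)
  show "coboundaries \<Delta> D k \<inter> weight_space (- w) \<subseteq> cocycles \<Delta> D k \<inter> weight_space (- w)"
    using coboundaries_subset_cocycles[OF fin] by blast
  show "weight_part (- w) ` coboundaries \<Delta> D k \<subseteq> coboundaries \<Delta> D k \<inter> weight_space (- w)"
    by (auto simp: weight_part_coboundaries weight_space_def)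
  show "weight_part (- w) z = z" if "z \<in> cocycles \<Delta> D k \<inter> weight_space (- w)" for z
    using that by (simp add: weight_space_def)
  show "weight_part (- w) c \<in> cocycles \<Delta> D k \<inter> weight_space (- w)" if "c \<in> ?V" for c
    using that by (auto simp: weight_part_cocycles weight_space_def)
  show "cocycles \<Delta> D k \<inter> weight_space (- w) \<subseteq> ?V"
  proof
    fix c assume c: "c \<in> cocycles \<Delta> D k \<inter> weight_space (- w)"
    have "(\<lambda>S. act t (c S)) - scale_cochain (torus_char w t) c = 0" for t
    proof (rule cochain_eqI)
      fix S m
      have *: "Poly_Mapping.lookup (c S) m = Poly_Mapping.lookup (weight_part (- w) c S) m"
        using c by (simp add: weight_space_def)
      have "m = - w \<or> Poly_Mapping.lookup (c S) m = 0"
        by (subst *) simp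
      then show "Poly_Mapping.lookup (((\<lambda>S. act t (c S)) - scale_cochain (torus_char w t) c) S) m =
          Poly_Mapping.lookup (0 S) m"
        by (elim disjE) (simp_all add: lookup_minus)
    qed
    moreover have "0 \<in> coboundaries \<Delta> D k" by (rule cochain.subspace_0[OF subspace_coboundaries])
    ultimately show "c \<in> ?V" using c by simp
  qed
  show "c - weight_part (- w) c \<in> coboundaries \<Delta> D k" if c: "c \<in> ?V" for c
  proof -
    have B: "weight_part m c \<in> coboundaries \<Delta> D k" if "m \<noteq> - w" for m
    proof -
      have "w \<noteq> - m" using that by auto
      then obtain t where t: "t \<in> compact_torus" "torus_char w t \<noteq> torus_char (- m) t"
        by (rule torus_char_separates)
      let ?a = "torus_char (- m) t - torus_char w t"
      have "weight_part m ((\<lambda>S. act t (c S)) - scale_cochain (torus_char w t) c) = scale_cochain ?a (weight_part m c)"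
        by (rule cochain_eqI) (simp add: lookup_minus algebra_simps)
      then have "scale_cochain ?a (weight_part m c) \<in> coboundaries \<Delta> D k"
        using c t(1) weight_part_coboundaries[of _ \<Delta> D k m] by force
      then have "scale_cochain (inverse ?a) (scale_cochain ?a (weight_part m c)) \<in> coboundaries \<Delta> D k"
        by (rule cochain.subspace_scale[OF subspace_coboundaries])
      then show ?thesis using t(2) by simp
    qed
    \<comment> \<open>A cochain is nonzero on finitely many sets of cones, with finitely many
      exponents on each, so the parts to be removed form a finite sum.\<close>
    define F where "F = (\<Union>S\<in>Pow (maximal_cones \<Delta>). Poly_Mapping.keys (c S)) - {- w}"
    have finF: "finite F" using fin by (simp add: F_def)
    have "c - weight_part (- w) c = (\<Sum>m\<in>F. weight_part m c)"
    proof (rule cochain_eqI)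
      fix S m
      have "Poly_Mapping.lookup (c S) m = 0" if "m \<notin> F" "m \<noteq> - w"
      proof (rule ccontr)
        assume *: "Poly_Mapping.lookup (c S) m \<noteq> 0"
        then have "S \<subseteq> maximal_cones \<Delta>" using c by (auto simp: cocycles_def mem_cochains_iff)
        then have "m \<in> F" using * that(2) by (auto simp: F_def in_keys_iff)
        then show False using that by simp
      qed
      moreover have "- w \<notin> F" by (simp add: F_def)
      ultimately show "Poly_Mapping.lookup ((c - weight_part (- w) c) S) m =
          Poly_Mapping.lookup ((\<Sum>m\<in>F. weight_part m c) S) m"
        using finF by (auto simp: lookup_minus sum_apply lookup_sum)
    qed
    also have "\<dots> \<in> coboundaries \<Delta> D k"
      by (intro cochain.subspace_sum[OF subspace_coboundaries] B) (simp add: F_def)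
    finally show ?thesis .
  qed
qed auto

text \<open>The Euler-Poincare principle: passing from cohomology to cochains does not change the
  alternating sum of dimensions, and the cochains of one exponent are counted by admissible sets.
  The exponent of -1 is the Cech degree of \<open>S\<close>.\<close>

lemma euler_char_eq:
  assumes fin: "finite (maximal_cones \<Delta>)"
  shows "euler_char \<Delta> D w =
    (\<Sum>S\<in>Pow (maximal_cones \<Delta>) - {{}}. (-1) ^ (card S - 1) * of_bool (admissible \<Delta> D (- w) S))"
proof -
  let ?M = "maximal_cones \<Delta>"
  let ?C = "\<lambda>k. int (cochain.dim (cochains \<Delta> D k \<inter> weight_space (- w)))"
  let ?B = "\<lambda>k. int (cochain.dim (coboundaries \<Delta> D k \<inter> weight_space (- w)))"
  have pos: "0 < card S" if "S \<subseteq> ?M" "S \<noteq> {}" for S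
    using that finite_subset[OF _ fin] by (simp add: card_gt_0_iff)
  have B0: "?B 0 = 0"
    using cochain.dim_le_card[of "coboundaries \<Delta> D 0 \<inter> weight_space (- w)" "{}"]
    by (auto simp: coboundaries_def)
  have BM: "?B (card ?M) = 0"
  proof -
    have "c = 0" if "c \<in> cochains \<Delta> D (card ?M)" for c
    proof (rule cochain_eqI)
      fix S m show "Poly_Mapping.lookup (c S) m = Poly_Mapping.lookup (0 S) m"
        using that card_mono[OF fin, of S] by (fastforce simp: mem_cochains_iff)
    qed
    then have "coboundaries \<Delta> D (card ?M) \<subseteq> {0}"
      using coboundaries_subset_cocycles[OF fin, of D "card ?M"] by (auto simp: cocycles_def)
    then show ?thesis
      using cochain.dim_le_card[of "coboundaries \<Delta> D (card ?M) \<inter> weight_space (- w)" "{}"] by auto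
  qed
  \<comment> \<open>Stopping before degree \<open>n\<close> leaves the coboundaries of degree
    \<open>n\<close> uncancelled. For \<open>n = card ?M\<close> they vanish, since that degree has
    no nonzero cochains.\<close>
  have "(\<Sum>k<n. (-1) ^ k * int (weight_mult \<Delta> D k w)) = (\<Sum>k<n. (-1) ^ k * ?C k) + (-1) ^ n * ?B n" for n
  proof (induction n)
    case (Suc n)
    have eq: "int (weight_mult \<Delta> D n w) = ?C n - ?B (Suc n) - ?B n"
      using weight_mult_eq[OF fin, of D n w] dim_cochains_eq[OF fin, of D n "- w"] by linarith
    show ?case unfolding sum.lessThan_Suc Suc eq by (simp add: algebra_simps)
  qed (simp add: B0)
  then have "euler_char \<Delta> D w = (\<Sum>k<card ?M. (-1) ^ k * ?C k)"
    unfolding euler_char_def using BM by simp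
  also have "\<dots> = (\<Sum>k<card ?M. \<Sum>S\<in>{S\<in>Pow ?M - {{}}. card S - 1 = k}.
      (-1) ^ (card S - 1) * of_bool (admissible \<Delta> D (- w) S))"
  proof (intro sum.cong refl)
    fix k
    have eq: "{S. S \<subseteq> ?M \<and> card S = k + 1 \<and> admissible \<Delta> D (- w) S} =
        {S\<in>Pow ?M - {{}}. card S - 1 = k} \<inter> {S. admissible \<Delta> D (- w) S}"
    proof -
      have "card S = k + 1 \<longleftrightarrow> S \<noteq> {} \<and> card S - 1 = k" if "S \<subseteq> ?M" for S
        using pos[OF that] by (cases "S = {}") auto
      then show ?thesis by blast
    qed
    have "?C k = (\<Sum>S\<in>{S\<in>Pow ?M - {{}}. card S - 1 = k}. of_bool (admissible \<Delta> D (- w) S))"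
      unfolding dim_weight_space_cochains[OF fin] eq using fin by (subst sum_of_bool_eq) auto
    then show "(-1) ^ k * ?C k = (\<Sum>S\<in>{S\<in>Pow ?M - {{}}. card S - 1 = k}.
        (-1) ^ (card S - 1) * of_bool (admissible \<Delta> D (- w) S))"
      by (simp add: sum_distrib_left)
  qed
  also have "\<dots> = (\<Sum>S\<in>Pow ?M - {{}}. (-1) ^ (card S - 1) * of_bool (admissible \<Delta> D (- w) S))"
  proof (rule sum.group[where g = "\<lambda>S. card S - 1"])
    show "(\<lambda>S. card S - 1) ` (Pow ?M - {{}}) \<subseteq> {..<card ?M}"
    proof (rule image_subsetI)
      fix S assume "S \<in> Pow ?M - {{}}"
      then have "0 < card S" "card S \<le> card ?M" using pos card_mono[OF fin] by auto
      then show "card S - 1 \<in> {..<card ?M}" by simp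
    qed
  qed (use fin in auto)
  finally show ?thesis .
qed


section \<open>The character identity of a complete smooth fan\<close>

lemma real_vec_add: "real_vec (u + v) = real_vec u + real_vec v"
  and real_vec_0 [simp]: "real_vec 0 = 0"
  and real_vec_smult: "real_vec (k *s v) = of_int k *\<^sub>R real_vec v"
  by (simp_all add: real_vec_def vec_eq_iff)

lemma real_vec_sum: "real_vec (\<Sum>i\<in>A. f i) = (\<Sum>i\<in>A. real_vec (f i))"
  by (induction A rule: infinite_finite_induct) (simp_all add: real_vec_add)

lemma real_vec_eq_iff [simp]: "real_vec u = real_vec v \<longleftrightarrow> u = v"
  by (simp add: real_vec_def vec_eq_iff)

lemma lattice_expand: "v = (\<Sum>i\<in>UNIV. v $ i *s axis i 1)" for v :: "'n::finite lattice"
  by (simp add: vec_eq_iff axis_def if_distrib cong: if_cong)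

lemma lattice_basis_coordinates:
  assumes "lattice_basis (B :: 'n::finite lattice set)"
  obtains c where "\<And>v. v = (\<Sum>b\<in>B. c b v *s b)" "\<And>b u v. c b (u + v) = c b u + c b v"
    "\<And>b k v. c b (k *s v) = k * c b v"
    "\<And>b b'. b \<in> B \<Longrightarrow> b' \<in> B \<Longrightarrow> c b b' = of_bool (b = b')"
proof -
  let ?P = "\<lambda>v c. (\<forall>b. b \<notin> B \<longrightarrow> c b = 0) \<and> v = (\<Sum>b\<in>B. c b *s b)"
  have fin: "finite B" and ex1: "\<exists>!c. ?P v c" for v
    using assms by (auto simp: lattice_basis_def)
  define c where "c b v = (THE c. ?P v c) b" for b v
  have c: "?P v (\<lambda>b. c b v)" for v
    unfolding c_def by (rule theI'[OF ex1])
  have c_unique: "f = (\<lambda>b. c b v)" if "?P v f" for f v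
    unfolding c_def using the1_equality[where P = "?P v", OF ex1 that] by simp
  show ?thesis
  proof
    show "v = (\<Sum>b\<in>B. c b v *s b)" for v using c by blast
    show "c b (u + v) = c b u + c b v" for b u v
    proof -
      have "(\<Sum>b\<in>B. (c b u + c b v) *s b) = (\<Sum>b\<in>B. c b u *s b) + (\<Sum>b\<in>B. c b v *s b)"
        by (simp add: vec_eq_iff sum.distrib distrib_right)
      then have "?P (u + v) (\<lambda>b. c b u + c b v)"
        using c[of u] c[of v] by simp
      from c_unique[OF this] show ?thesis by (metis (full_types))
    qed
    show "c b (k *s v) = k * c b v" for b k v
    proof -
      have "(\<Sum>b\<in>B. (k * c b v) *s b) = k *s (\<Sum>b\<in>B. c b v *s b)"
        by (simp add: vec_eq_iff sum_distrib_left mult.assoc)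
      then have "?P (k *s v) (\<lambda>b. k * c b v)"
        using c[of v] by simp
      from c_unique[OF this] show ?thesis by (metis (full_types))
    qed
    show "c b b' = of_bool (b = b')" if "b \<in> B" "b' \<in> B" for b b'
    proof -
      have "?P b' (\<lambda>b. of_bool (b = b'))"
      proof -
        have "(\<Sum>b\<in>B. of_bool (b = b') *s b) = (\<Sum>b\<in>B. if b = b' then b' else 0)"
          by (intro sum.cong) auto
        then show ?thesis using that(2) fin by auto
      qed
      from c_unique[OF this] show ?thesis by (metis (full_types))
    qed
  qed
qed

text \<open>The integer coordinates extend to real functionals by their values on the standard
  basis. Integrality on lattice vectors is kept for two purposes: to compare a cone with its shift
  by a generator, and to identify the lattice points of a ray.\<close>

lemma lattice_basis_dual:
  assumes "lattice_basis (B :: 'n::finite lattice set)"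
  obtains L where "\<And>b. linear (L b)" "\<And>x. x = (\<Sum>b\<in>B. L b x *\<^sub>R real_vec b)"
    "\<And>b b'. b \<in> B \<Longrightarrow> b' \<in> B \<Longrightarrow> L b (real_vec b') = of_bool (b = b')"
    "\<And>b v. L b (real_vec v) \<in> \<int>"
proof -
  obtain c where c: "\<And>v. v = (\<Sum>b\<in>B. c b v *s b)" "\<And>b u v. c b (u + v) = c b u + c b v"
    "\<And>b k v. c b (k *s v) = k * c b v"
    "\<And>b b'. b \<in> B \<Longrightarrow> b' \<in> B \<Longrightarrow> c b b' = of_bool (b = b')"
    by (rule lattice_basis_coordinates[OF assms]) (rule that; assumption)
  define L where "L b x = (\<Sum>i\<in>UNIV. x $ i * of_int (c b (axis i 1)))" for b and x :: "real ^ 'n"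
  have c0: "c b 0 = 0" for b using c(2)[of b 0 0] by simp
  have c_sum: "c b (\<Sum>i\<in>A. f i) = (\<Sum>i\<in>A. c b (f i))" for b A and f :: "'n \<Rightarrow> 'n lattice"
    by (induction A rule: infinite_finite_induct) (simp_all add: c(2) c0)
  have L: "L b (real_vec v) = of_int (c b v)" for b v
  proof -
    have "c b v = c b (\<Sum>i\<in>UNIV. v $ i *s axis i 1)" using lattice_expand[of v] by simp
    also have "\<dots> = (\<Sum>i\<in>UNIV. v $ i * c b (axis i 1))" by (simp add: c_sum c(3))
    finally show ?thesis by (simp add: L_def real_vec_def)
  qed
  have axis: "axis i 1 = (\<Sum>b\<in>B. of_int (c b (axis i 1)) *\<^sub>R real_vec b)" for i
  proof -
    have "axis i 1 = real_vec (axis i 1)" by (simp add: real_vec_def vec_eq_iff axis_def)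
    also have "\<dots> = real_vec (\<Sum>b\<in>B. c b (axis i 1) *s b)" using c(1)[of "axis i 1"] by simp
    finally show ?thesis by (simp add: real_vec_sum real_vec_smult)
  qed
  show ?thesis
  proof
    show "linear (L b)" for b
      by (rule linearI) (simp_all add: L_def algebra_simps sum.distrib sum_distrib_left)
    show "x = (\<Sum>b\<in>B. L b x *\<^sub>R real_vec b)" for x
    proof -
      have "x = (\<Sum>i\<in>UNIV. x $ i *\<^sub>R axis i 1)"
        by (simp add: vec_eq_iff axis_def if_distrib cong: if_cong)
      also have "\<dots> = (\<Sum>i\<in>UNIV. x $ i *\<^sub>R (\<Sum>b\<in>B. of_int (c b (axis i 1)) *\<^sub>R real_vec b))"
        by (subst axis) simp
      also have "\<dots> = (\<Sum>b\<in>B. L b x *\<^sub>R real_vec b)"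
        unfolding scaleR_sum_right L_def scaleR_sum_left by (subst sum.swap) simp
      finally show ?thesis .
    qed
    show "L b (real_vec b') = of_bool (b = b')" if "b \<in> B" "b' \<in> B" for b b'
      using c(4)[OF that] by (simp add: L)
    show "L b (real_vec v) \<in> \<int>" for b v by (simp add: L)
  qed
qed

lemma convex_cone_hull_basis:
  assumes "finite B" "S \<subseteq> B" and L: "\<And>b. linear (L b)" "\<And>x. x = (\<Sum>b\<in>B. L b x *\<^sub>R real_vec b)"
    "\<And>b b'. b \<in> B \<Longrightarrow> b' \<in> B \<Longrightarrow> L b (real_vec b') = of_bool (b = b')"
  shows "convex_cone hull (real_vec ` S) = {x. (\<forall>b\<in>S. 0 \<le> L b x) \<and> (\<forall>b\<in>B - S. L b x = 0)}"
    (is "_ = ?R")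
proof (intro equalityI subsetI)
  fix x assume x: "x \<in> convex_cone hull (real_vec ` S)"
  have "real_vec ` S \<subseteq> ?R" using assms(2) by (auto simp: L(3) subset_iff)
  moreover have "convex_cone ?R"
    unfolding convex_cone_iff
    by (auto simp: linear_add[OF L(1)] linear_scale[OF L(1)] linear_0[OF L(1)] intro!: exI[of _ 0])
  ultimately show "x \<in> ?R" using x hull_minimal[of "real_vec ` S" ?R convex_cone] by blast
next
  fix x assume x: "x \<in> ?R"
  let ?C = "convex_cone hull (real_vec ` S)"
  have C: "convex_cone ?C" by (rule convex_cone_convex_cone_hull)
  have fin: "finite S" using assms(1,2) finite_subset by blast
  have "x = (\<Sum>b\<in>B. L b x *\<^sub>R real_vec b)" by (rule L(2))
  also have "\<dots> = (\<Sum>b\<in>S. L b x *\<^sub>R real_vec b)"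
    using assms(1,2) x by (intro sum.mono_neutral_right) auto
  also have "\<dots> \<in> ?C"
  proof -
    have "(\<Sum>b\<in>T. L b x *\<^sub>R real_vec b) \<in> ?C" if "finite T" "T \<subseteq> S" for T
      using that
    proof (induction T)
      case empty then show ?case using convex_cone_contains_0[OF C] by simp
    next
      case (insert b T)
      then have "L b x *\<^sub>R real_vec b \<in> ?C"
        using x by (intro convex_cone_scaleR[OF C]) (auto intro: hull_inc)
      then show ?case using insert by (auto intro: convex_cone_add[OF C])
    qed
    then show ?thesis using fin by blast
  qed
  finally show "x \<in> ?C" .
qed

lemma smooth_cone_dual:
  assumes "smooth_fan \<Delta>" "\<sigma> \<in> \<Delta>"
  obtains B S L where "finite B" "S \<subseteq> B" "\<And>b. linear (L b)" "\<And>x. x = (\<Sum>b\<in>B. L b x *\<^sub>R real_vec b)"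
    "\<And>b b'. b \<in> B \<Longrightarrow> b' \<in> B \<Longrightarrow> L b (real_vec b') = of_bool (b = b')"
    "\<And>b v. L b (real_vec v) \<in> \<int>"
    "\<sigma> = {x. (\<forall>b\<in>S. 0 \<le> L b x) \<and> (\<forall>b\<in>B - S. L b x = 0)}"
proof -
  obtain B S where B: "lattice_basis B" "S \<subseteq> B" "\<sigma> = convex_cone hull (real_vec ` S)"
    using assms unfolding smooth_fan_def by blast
  have "finite B" using B(1) by (simp add: lattice_basis_def)
  obtain L where L: "\<And>b. linear (L b)" "\<And>x. x = (\<Sum>b\<in>B. L b x *\<^sub>R real_vec b)"
    "\<And>b b'. b \<in> B \<Longrightarrow> b' \<in> B \<Longrightarrow> L b (real_vec b') = of_bool (b = b')"
    "\<And>b v. L b (real_vec v) \<in> \<int>"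
    by (rule lattice_basis_dual[OF B(1)]) (rule that; assumption)
  show ?thesis
    using that[OF \<open>finite B\<close> B(2) L] convex_cone_hull_basis[OF \<open>finite B\<close> B(2) L(1-3)] B(3) by simp
qed

definition ray_of :: "'n::finite lattice \<Rightarrow> 'n cone" where
  "ray_of b = {t *\<^sub>R real_vec b | t. 0 \<le> t}"

text \<open>In the coordinates \<open>L\<close> the cone is an orthant, whose faces of dimension one
  are the coordinate half-lines. By integrality of \<open>L\<close>, the lattice points of such a
  half-line are the natural multiples of its basis vector.\<close>

lemma rays_of_smooth_cone:
  fixes \<Delta> :: "'n::finite cone set"
  assumes fan: "fan \<Delta>" and \<sigma>: "\<sigma> \<in> \<Delta>"
    and B: "finite B" "S \<subseteq> B" and L: "\<And>b. linear (L b)" "\<And>x. x = (\<Sum>b\<in>B. L b x *\<^sub>R real_vec b)"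
    "\<And>b b'. b \<in> B \<Longrightarrow> b' \<in> B \<Longrightarrow> L b (real_vec b') = of_bool (b = b')"
    "\<And>b v. L b (real_vec v) \<in> \<int>"
    and \<sigma>_eq: "\<sigma> = {x. (\<forall>b\<in>S. 0 \<le> L b x) \<and> (\<forall>b\<in>B - S. L b x = 0)}"
  shows "{\<rho>\<in>rays \<Delta>. \<rho> \<subseteq> \<sigma>} = ray_of ` S" "\<And>b. b \<in> S \<Longrightarrow> ray_gen (ray_of b) = b" "inj_on ray_of S"
proof -
  have L_lin: "L b (x + y) = L b x + L b y" "L b (t *\<^sub>R x) = t * L b x" for b x y t
    using linear_add[OF L(1)] linear_scale[OF L(1)] by auto
  have eqI: "x = y" if "\<And>b. b \<in> B \<Longrightarrow> L b x = L b y" for x y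
    using that L(2)[of x] L(2)[of y] by (metis (no_types, lifting) sum.cong)
  have ray_of_iff: "x \<in> ray_of b \<longleftrightarrow> 0 \<le> L b x \<and> (\<forall>b'\<in>B. b' \<noteq> b \<longrightarrow> L b' x = 0)"
    if b: "b \<in> B" for b x
  proof
    assume "x \<in> ray_of b"
    then show "0 \<le> L b x \<and> (\<forall>b'\<in>B. b' \<noteq> b \<longrightarrow> L b' x = 0)"
      using b by (auto simp: ray_of_def L_lin L(3))
  next
    assume *: "0 \<le> L b x \<and> (\<forall>b'\<in>B. b' \<noteq> b \<longrightarrow> L b' x = 0)"
    have "x = L b x *\<^sub>R real_vec b"
      by (rule eqI) (use * b in \<open>auto simp: L_lin L(3)\<close>)
    then show "x \<in> ray_of b" using * unfolding ray_of_def by blast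
  qed
  have nz: "real_vec b \<noteq> 0" if "b \<in> B" for b
    using L(3)[OF that that] linear_0[OF L(1)] by fastforce
  have ray_of_mem: "ray_of b \<in> rays \<Delta> \<and> ray_of b \<subseteq> \<sigma>" if b: "b \<in> S" for b
  proof -
    have bB: "b \<in> B" using b B by blast
    have sub: "ray_of b \<subseteq> \<sigma>"
      using b by (auto simp: \<sigma>_eq ray_of_iff[OF bB] dest: subsetD[OF B(2)])
         (metis B(2) order_refl subsetD)+
    have "ray_of b face_of \<sigma>"
      unfolding face_of_def
    proof (intro conjI ballI impI)
      show "convex (ray_of b)"
        unfolding convex_def ray_of_iff[OF bB] by (auto simp: ray_of_iff[OF bB] L_lin)
      fix a c x assume a: "a \<in> \<sigma>" and c: "c \<in> \<sigma>" and x: "x \<in> ray_of b" "x \<in> open_segment a c"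
      then obtain u where u: "0 < u" "u < 1" "x = (1 - u) *\<^sub>R a + u *\<^sub>R c"
        by (auto simp: in_segment)
      have ge: "0 \<le> L b' a" "0 \<le> L b' c" if "b' \<in> B" for b'
        using a c that unfolding \<sigma>_eq by (cases "b' \<in> S"; force)+
      have z: "L b' a = 0 \<and> L b' c = 0" if b': "b' \<in> B" "b' \<noteq> b" for b'
      proof -
        have "(1 - u) * L b' a + u * L b' c = 0"
          using x(1) b' by (auto simp: ray_of_iff[OF bB] u(3) L_lin)
        moreover have "0 \<le> (1 - u) * L b' a" "0 \<le> u * L b' c" using ge[OF b'(1)] u by auto
        ultimately have "(1 - u) * L b' a = 0" "u * L b' c = 0" by linarith+
        then show ?thesis using u by auto
      qed
      then show "a \<in> ray_of b" "c \<in> ray_of b" using ge[OF bB] by (auto simp: ray_of_iff[OF bB])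
    qed (use sub in blast)
    moreover have "real_vec b \<in> ray_of b" unfolding ray_of_def using zero_le_one by (metis (mono_tags, lifting) mem_Collect_eq scaleR_one)
    ultimately have "ray_of b \<in> \<Delta>" using fan \<sigma> unfolding fan_def by blast
    moreover have "dim (ray_of b) = 1"
    proof (rule dim_unique)
      show "{real_vec b} \<subseteq> ray_of b" using \<open>real_vec b \<in> ray_of b\<close> by blast
      show "ray_of b \<subseteq> span {real_vec b}" by (auto simp: ray_of_def intro: span_scale span_base)
      show "independent {real_vec b}" using nz[OF bB] by simp
    qed simp
    ultimately show ?thesis using sub by (simp add: rays_def)
  qed
  have "\<rho> \<in> ray_of ` S" if \<rho>: "\<rho> \<in> rays \<Delta>" "\<rho> \<subseteq> \<sigma>" for \<rho>
  proof -
    have "\<rho> \<in> \<Delta>" "dim \<rho> = 1" using \<rho>(1) by (auto simp: rays_def)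
    then have face: "\<rho> face_of \<sigma>"
      using fan \<sigma> \<rho>(2) unfolding fan_def by (metis inf.absorb_iff2)
    have "\<not> \<rho> \<subseteq> {0}"
    proof
      assume "\<rho> \<subseteq> {0}"
      then have "dim \<rho> \<le> dim {0 :: real ^ 'n}" by (rule dim_subset)
      then show False using \<open>dim \<rho> = 1\<close> by simp
    qed
    then obtain x where x: "x \<in> \<rho>" "x \<noteq> 0" by blast
    then obtain b where b: "b \<in> B" "L b x \<noteq> 0" using eqI[of x 0] linear_0[OF L(1)] by metis
    let ?y = "L b x *\<^sub>R real_vec b"
    have xs: "x \<in> \<sigma>" using x \<rho>(2) by blast
    have bS: "b \<in> S" using b xs by (auto simp: \<sigma>_eq)
    have pos: "0 < L b x" using b(2) bS xs by (auto simp: \<sigma>_eq order_less_le)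
    \<comment> \<open>The point \<open>x\<close> is the midpoint of \<open>2 ?y\<close> and
      \<open>2 (x - ?y)\<close>, both in the cone, so the face contains both ends. The open segment
      is empty if the ends coincide, but then \<open>2 ?y\<close> is \<open>x\<close>
      itself.\<close>
    have y: "2 *\<^sub>R ?y \<in> \<rho>"
    proof (cases "2 *\<^sub>R ?y = 2 *\<^sub>R (x - ?y)")
      case True
      then have "2 *\<^sub>R ?y = x" by (metis add_diff_cancel_left' diff_add_cancel scaleR_2 scaleR_cancel_left zero_neq_numeral)
      then show ?thesis using x by simp
    next
      case False
      have 1: "2 *\<^sub>R ?y \<in> \<sigma>" using xs bS B(2) pos by (auto simp: \<sigma>_eq L_lin L(3) subset_iff)
      have 2: "2 *\<^sub>R (x - ?y) \<in> \<sigma>"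
        using xs bS B(2) pos by (auto simp: \<sigma>_eq linear_diff[OF L(1)] L_lin L(3) subset_iff)
      have "x \<in> open_segment (2 *\<^sub>R ?y) (2 *\<^sub>R (x - ?y))"
        unfolding in_segment using False
        by (intro conjI exI[of _ "1/2"]) (auto simp: algebra_simps)
      then show ?thesis using face_ofD[OF face _ 1 2 x(1)] by blast
    qed
    have "\<rho> \<subseteq> span {2 *\<^sub>R ?y}"
    proof (rule card_ge_dim_independent)
      show "{2 *\<^sub>R ?y} \<subseteq> \<rho>" using y by blast
      show "independent {2 *\<^sub>R ?y}" using nz[OF b(1)] pos by simp
    qed (use \<open>dim \<rho> = 1\<close> in simp)
    then have "\<rho> \<subseteq> ray_of b"
      using \<rho>(2) b(1) bS unfolding ray_of_iff[OF b(1)] subset_iff span_singleton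
      by (auto simp: L_lin L(3) \<sigma>_eq ray_of_iff[OF b(1)])
    moreover have "ray_of b \<subseteq> \<rho>"
    proof
      fix z assume "z \<in> ray_of b"
      then obtain t where t: "0 \<le> t" "z = t *\<^sub>R real_vec b" by (auto simp: ray_of_def)
      have "rational_cone \<rho>" using fan \<open>\<rho> \<in> \<Delta>\<close> unfolding fan_def by blast
      then have "convex_cone \<rho>" unfolding rational_cone_def using convex_cone_convex_cone_hull by blast
      then have "(t / (2 * L b x)) *\<^sub>R (2 *\<^sub>R ?y) \<in> \<rho>"
        by (rule convex_cone_scaleR[OF _ _ y]) (use pos t(1) in simp)
      then show "z \<in> \<rho>" using pos t(2) by simp
    qed
    ultimately show ?thesis using bS by blast
  qed
  then show "{\<rho>\<in>rays \<Delta>. \<rho> \<subseteq> \<sigma>} = ray_of ` S" using ray_of_mem by blast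
  show gen: "ray_gen (ray_of b) = b" if "b \<in> S" for b
  proof -
    have bB: "b \<in> B" using that B by blast
    have mem: "real_vec v \<in> ray_of b \<longleftrightarrow> v \<in> range (\<lambda>k::nat. int k *s b)" for v
    proof
      assume "real_vec v \<in> ray_of b"
      then have *: "0 \<le> L b (real_vec v)" "\<And>b'. b' \<in> B \<Longrightarrow> b' \<noteq> b \<Longrightarrow> L b' (real_vec v) = 0"
        by (auto simp: ray_of_iff[OF bB])
      then obtain k where k: "L b (real_vec v) = of_nat k"
        using L(4)[of b v] by (metis Ints_cases nat_0_le of_int_0_le_iff of_int_of_nat_eq)
      have "real_vec v = real_vec (int k *s b)"
        by (rule eqI) (use * k bB in \<open>auto simp: real_vec_smult L_lin L(3)\<close>)
      then show "v \<in> range (\<lambda>k::nat. int k *s b)" by simp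
    qed (auto simp: ray_of_def real_vec_smult)
    show ?thesis unfolding ray_gen_def
    proof (rule the_equality)
      show "{v. real_vec v \<in> ray_of b} = range (\<lambda>k::nat. int k *s b)" using mem by blast
      fix u assume "{v. real_vec v \<in> ray_of b} = range (\<lambda>k::nat. int k *s u)"
      then have eq: "range (\<lambda>k::nat. int k *s u) = range (\<lambda>k::nat. int k *s b)" using mem by blast
      have "u \<in> range (\<lambda>k::nat. int k *s u)" "b \<in> range (\<lambda>k::nat. int k *s b)"
        by (rule range_eqI[of _ _ 1]; simp)+
      then have "u \<in> range (\<lambda>k::nat. int k *s b)" "b \<in> range (\<lambda>k::nat. int k *s u)"
        unfolding eq .
      \<comment> \<open>Two generators of one monoid are natural multiples of each other, and the
        coordinate \<open>L b\<close> shows that the two factors have product 1.\<close>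
      then obtain k l where k: "b = int k *s u" "u = int l *s b" by blast
      then have "real_vec b = (of_nat k * of_nat l) *\<^sub>R real_vec b"
        by (metis real_vec_smult scaleR_scaleR of_int_of_nat_eq)
      then have "L b (real_vec b) = of_nat k * of_nat l * L b (real_vec b)"
        by (metis L_lin(2))
      then have "real (k * l) = 1" using L(3)[OF bB bB] by simp
      then have "k * l = 1" using of_nat_eq_1_iff by blast
      then show "u = b" using k by simp
    qed
  qed
  show "inj_on ray_of S" by (rule inj_on_inverseI[of _ ray_gen]) (rule gen)
qed

section \<open>Laurent polynomials acting on functions on the lattice\<close>

definition shift_diff :: "'n::finite lattice \<Rightarrow> ('n lattice \<Rightarrow> int) \<Rightarrow> 'n lattice \<Rightarrow> int" where
  "shift_diff u f v = f v - f (v - u)"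

text \<open>For a multiplicative \<open>\<phi>\<close> this is the evaluation of an integral Laurent
  polynomial at \<open>\<phi>\<close>; with other \<open>\<phi>\<close> it also expresses
  convolutions.\<close>

definition lin_ext :: "('a \<Rightarrow> 'r::comm_ring_1) \<Rightarrow> ('a \<Rightarrow>\<^sub>0 int) \<Rightarrow> 'r" where
  "lin_ext \<phi> p = (\<Sum>k\<in>Poly_Mapping.keys p. of_int (Poly_Mapping.lookup p k) * \<phi> k)"

lemma lin_ext_superset:
  "finite A \<Longrightarrow> Poly_Mapping.keys p \<subseteq> A \<Longrightarrow>
    lin_ext \<phi> p = (\<Sum>k\<in>A. of_int (Poly_Mapping.lookup p k) * \<phi> k)"
  unfolding lin_ext_def by (rule sum.mono_neutral_left) (auto simp: in_keys_iff)

lemma lin_ext_diff: "lin_ext \<phi> (p - q) = lin_ext \<phi> p - lin_ext \<phi> q"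
proof -
  let ?A = "Poly_Mapping.keys p \<union> Poly_Mapping.keys q \<union> Poly_Mapping.keys (p - q)"
  have "lin_ext \<phi> r = (\<Sum>k\<in>?A. of_int (Poly_Mapping.lookup r k) * \<phi> k)" if "r \<in> {p, q, p - q}" for r
    by (rule lin_ext_superset) (use that in auto)
  then show ?thesis by (simp add: lookup_minus sum_subtractf algebra_simps)
qed

lemma lookup_single_mult:
  fixes p :: "'n::finite lattice \<Rightarrow>\<^sub>0 int"
  shows "Poly_Mapping.lookup (Poly_Mapping.single u 1 * p) v = Poly_Mapping.lookup p (v - u)"
proof -
  have eq: "v = u + q \<longleftrightarrow> q = v - u" for q by auto
  show ?thesis
    by (simp only: lookup_mult lookup_single when_mult mult_1_left Sum_any_when_equal Sum_any_when_equal' eq)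
qed

lemma lin_ext_single_mult:
  fixes p :: "'n::finite lattice \<Rightarrow>\<^sub>0 int"
  shows "lin_ext \<phi> (Poly_Mapping.single u 1 * p) = lin_ext (\<lambda>k. \<phi> (u + k)) p"
proof -
  have keys: "Poly_Mapping.keys (Poly_Mapping.single u 1 * p) = (+) u ` Poly_Mapping.keys p"
  proof (intro set_eqI iffI)
    fix v assume "v \<in> Poly_Mapping.keys (Poly_Mapping.single u 1 * p)"
    then show "v \<in> (+) u ` Poly_Mapping.keys p"
      by (intro image_eqI[of _ _ "v - u"]) (simp_all add: in_keys_iff lookup_single_mult)
  qed (auto simp: in_keys_iff lookup_single_mult)
  show ?thesis unfolding lin_ext_def keys
    by (subst sum.reindex) (simp_all add: lookup_single_mult)
qed

definition one_minus :: "'n::finite lattice \<Rightarrow> 'n lattice \<Rightarrow>\<^sub>0 int" where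
  "one_minus u = 1 - Poly_Mapping.single u 1"

lemma one_minus_mult: "one_minus u * p = p - Poly_Mapping.single u 1 * p"
  by (simp add: one_minus_def left_diff_distrib)

text \<open>The indicator function of a cone is in general not a Laurent polynomial, but the
  functions on the lattice form a module over the Laurent polynomials. An equation
  \<open>conv p f = g\<close> stands for the rational expression \<open>g / p\<close> of the
  generating function of \<open>f\<close>.\<close>

definition conv :: "('n::finite lattice \<Rightarrow>\<^sub>0 int) \<Rightarrow> ('n lattice \<Rightarrow> int) \<Rightarrow> 'n lattice \<Rightarrow> int" where
  "conv p f v = lin_ext (\<lambda>k. f (v - k)) p"

lemma conv_one_minus_mult: "conv (one_minus u * p) f = shift_diff u (conv p f)"
proof
  fix v
  show "conv (one_minus u * p) f v = shift_diff u (conv p f) v"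
    unfolding one_minus_mult
    by (simp add: conv_def shift_diff_def lin_ext_diff lin_ext_single_mult diff_diff_eq)
qed

lemma conv_shift_diff: "conv p (shift_diff u f) = shift_diff u (conv p f)"
proof
  fix v
  show "conv p (shift_diff u f) v = shift_diff u (conv p f) v"
    by (simp add: conv_def shift_diff_def lin_ext_def sum_subtractf algebra_simps)
qed

lemma conv_sum: "conv p (\<lambda>v. \<Sum>i\<in>A. a i * f i v) v = (\<Sum>i\<in>A. a i * conv p (f i) v)"
  unfolding conv_def lin_ext_def sum_distrib_left
  by (subst sum.swap) (intro sum.cong refl, simp add: algebra_simps)

lemma conv_1 [simp]: "conv 1 f = f"
  by (rule ext) (simp add: conv_def lin_ext_def)

lemma conv_delta: "conv p (\<lambda>v. of_bool (v = 0)) = Poly_Mapping.lookup p"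
proof
  fix v
  have "conv p (\<lambda>v. of_bool (v = 0)) v =
      (\<Sum>k\<in>insert v (Poly_Mapping.keys p). of_int (Poly_Mapping.lookup p k) * of_bool (v - k = 0))"
    unfolding conv_def by (rule lin_ext_superset) auto
  also have "\<dots> = (\<Sum>k\<in>insert v (Poly_Mapping.keys p). if k = v then Poly_Mapping.lookup p k else 0)"
    by (intro sum.cong) auto
  finally show "conv p (\<lambda>v. of_bool (v = 0)) v = Poly_Mapping.lookup p v" by simp
qed

lemma conv_prod_mult:
  "finite A \<Longrightarrow> conv ((\<Prod>i\<in>A. one_minus (u i)) * q) f = conv (\<Prod>i\<in>A. one_minus (u i)) (conv q f)"
  by (induction A rule: finite_induct) (simp_all add: conv_one_minus_mult mult.assoc)

lemma lin_ext_prod_one_minus: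
  fixes \<psi> :: "'n::finite lattice \<Rightarrow> 'r::comm_ring_1"
  assumes "\<psi> 0 = 1" "\<And>u v. \<psi> (u + v) = \<psi> u * \<psi> v" "finite A"
  shows "lin_ext \<psi> (\<Prod>i\<in>A. one_minus (u i)) = (\<Prod>i\<in>A. 1 - \<psi> (u i))"
  using assms(3)
proof (induction A rule: finite_induct)
  case empty
  then show ?case by (simp add: lin_ext_def assms(1))
next
  case (insert i A)
  have scale: "lin_ext (\<lambda>k. \<psi> (u i + k)) p = \<psi> (u i) * lin_ext \<psi> p" for p
    by (simp add: lin_ext_def assms(2) sum_distrib_left algebra_simps)
  then show ?case using insert
    by (simp add: one_minus_mult lin_ext_diff lin_ext_single_mult left_diff_distrib)
qed

lemma lin_ext_alternating_sum:
  "lin_ext \<phi> (\<Sum>i\<in>A. (-1) ^ n i * p i) = (\<Sum>i\<in>A. (-1) ^ n i * lin_ext \<phi> (p i))"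
proof (induction A rule: infinite_finite_induct)
  case (insert i A)
  have 0: "lin_ext \<phi> 0 = 0" by (simp add: lin_ext_def)
  have uminus: "lin_ext \<phi> (- q) = - lin_ext \<phi> q" for q
    using lin_ext_diff[of \<phi> 0 q] 0 by simp
  have add: "lin_ext \<phi> (q + r) = lin_ext \<phi> q + lin_ext \<phi> r" for q r
    using lin_ext_diff[of \<phi> q "- r"] uminus by simp
  show ?case using insert by (cases "even (n i)") (simp_all add: add uminus lin_ext_diff)
qed (simp_all add: lin_ext_def)

section \<open>Generating functions of the cones of a fan\<close>

lemma zero_mem_fan:
  assumes "fan \<Delta>" "\<sigma> \<in> \<Delta>"
  shows "0 \<in> \<sigma>"
  using assms unfolding fan_def strongly_convex_def by blast

text \<open>Two cones of a fan meet in a common face. It contains 0, so it is not the empty face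
  that \<open>fan\<close> excludes.\<close>

lemma Inter_mem_fan:
  assumes fan: "fan \<Delta>" and "finite S" "S \<noteq> {}" "S \<subseteq> \<Delta>"
  shows "\<Inter>S \<in> \<Delta>"
  using assms(2-4)
proof (induction S rule: finite_ne_induct)
  case (insert \<sigma> S)
  then have "\<sigma> \<in> \<Delta>" "\<Inter>S \<in> \<Delta>" by auto
  moreover from this have "0 \<in> \<sigma> \<inter> \<Inter>S" using zero_mem_fan[OF fan] by blast
  ultimately have "\<sigma> \<inter> \<Inter>S \<in> \<Delta>" using fan unfolding fan_def by (metis empty_iff)
  then show ?case by simp
qed simp

text \<open>The generating function of the lattice points of a smooth cone is the product of
  \<open>1 / (1 - x^u)\<close> over its ray generators; this is that formula cleared of
  denominators.\<close>

lemma conv_cone: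
  assumes fan: "fan \<Delta>" and smooth: "smooth_fan \<Delta>" and \<sigma>: "\<sigma> \<in> \<Delta>"
  shows "conv (\<Prod>\<rho>\<in>{\<rho>\<in>rays \<Delta>. \<rho> \<subseteq> \<sigma>}. one_minus (ray_gen \<rho>)) (\<lambda>v. of_bool (real_vec v \<in> \<sigma>)) =
    (\<lambda>v. of_bool (v = 0))"
proof -
  obtain B S L where B: "finite B" "S \<subseteq> B"
    and L: "\<And>b. linear (L b)" "\<And>x. x = (\<Sum>b\<in>B. L b x *\<^sub>R real_vec b)"
    "\<And>b b'. b \<in> B \<Longrightarrow> b' \<in> B \<Longrightarrow> L b (real_vec b') = of_bool (b = b')"
    "\<And>b v. L b (real_vec v) \<in> \<int>"
    and \<sigma>_eq: "\<sigma> = {x. (\<forall>b\<in>S. 0 \<le> L b x) \<and> (\<forall>b\<in>B - S. L b x = 0)}"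
    by (rule smooth_cone_dual[OF smooth \<sigma>]) (rule that; assumption)
  note R = rays_of_smooth_cone[OF fan \<sigma> B L \<sigma>_eq]
  have finS: "finite S" using B finite_subset by blast
  \<comment> \<open>Interpolates between the cone, for \<open>T = S\<close>, and the origin, for
    \<open>T = {}\<close>. Multiplication by \<open>1 - x^b\<close> removes \<open>b\<close> from
    \<open>T\<close>, because an integer that is at least 0 but not at least 1 is 0.\<close>
  define F where "F T v = (of_bool ((\<forall>b\<in>T. 0 \<le> L b (real_vec v)) \<and> (\<forall>b\<in>B - T. L b (real_vec v) = 0)) :: int)"
    for T v
  have step: "shift_diff b (F (insert b T)) = F T" if "b \<in> B" "b \<notin> T" "T \<subseteq> B" for b T
  proof
    fix v
    have *: "L b' (real_vec (v - b)) = L b' (real_vec v) - of_bool (b' = b)" if "b' \<in> B" for b'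
    proof -
      have "L b' (real_vec v) = L b' (real_vec (v - b) + real_vec b)"
        by (simp flip: real_vec_add)
      then show ?thesis using L(3)[OF that \<open>b \<in> B\<close>] by (simp add: linear_add[OF L(1)])
    qed
    obtain k where k: "L b (real_vec v) = of_int k" using L(4) Ints_cases by blast
    have 1: "F (insert b T) v = of_bool (0 \<le> k) * of_bool ((\<forall>b\<in>T. 0 \<le> L b (real_vec v)) \<and>
        (\<forall>b\<in>B - insert b T. L b (real_vec v) = 0))"
      using k by (auto simp: F_def)
    have 2: "F (insert b T) (v - b) = of_bool (1 \<le> k) * of_bool ((\<forall>b\<in>T. 0 \<le> L b (real_vec v)) \<and>
        (\<forall>b\<in>B - insert b T. L b (real_vec v) = 0))"
    proof -
      have "(\<forall>b'\<in>T. 0 \<le> L b' (real_vec (v - b))) \<longleftrightarrow> (\<forall>b'\<in>T. 0 \<le> L b' (real_vec v))"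
      proof (intro ball_cong refl)
        fix b' assume "b' \<in> T"
        then have "b' \<in> B" "b' \<noteq> b" using that by auto
        then show "0 \<le> L b' (real_vec (v - b)) \<longleftrightarrow> 0 \<le> L b' (real_vec v)" using *[of b'] by simp
      qed
      moreover have "(\<forall>b'\<in>B - insert b T. L b' (real_vec (v - b)) = 0) \<longleftrightarrow>
          (\<forall>b'\<in>B - insert b T. L b' (real_vec v) = 0)"
        using * by (intro ball_cong) auto
      moreover have "0 \<le> L b (real_vec (v - b)) \<longleftrightarrow> 1 \<le> k"
        using k *[OF that(1)] by simp
      ultimately show ?thesis by (simp add: F_def)
    qed
    have "B - T = insert b (B - insert b T)" using that by blast
    then have 3: "F T v = of_bool (k = 0) * of_bool ((\<forall>b\<in>T. 0 \<le> L b (real_vec v)) \<and>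
        (\<forall>b\<in>B - insert b T. L b (real_vec v) = 0))"
      using k by (simp add: F_def)
    show "shift_diff b (F (insert b T)) v = F T v"
      unfolding shift_diff_def 1 2 3 by auto
  qed
  have "conv (\<Prod>b\<in>T. one_minus b) (F T) = F {}" if "finite T" "T \<subseteq> B" for T
    using that
  proof (induction T rule: finite_induct)
    case (insert b T)
    have "conv (\<Prod>b\<in>insert b T. one_minus b) (F (insert b T)) =
        conv (\<Prod>b\<in>T. one_minus b) (shift_diff b (F (insert b T)))"
      using insert by (simp add: conv_one_minus_mult conv_shift_diff)
    then show ?case using insert step by simp
  qed simp
  then have "conv (\<Prod>b\<in>S. one_minus b) (F S) = F {}" using finS B(2) by blast
  moreover have "(\<Prod>\<rho>\<in>{\<rho>\<in>rays \<Delta>. \<rho> \<subseteq> \<sigma>}. one_minus (ray_gen \<rho>)) = (\<Prod>b\<in>S. one_minus b)"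
  proof -
    have "(\<Prod>\<rho>\<in>{\<rho>\<in>rays \<Delta>. \<rho> \<subseteq> \<sigma>}. one_minus (ray_gen \<rho>)) = (\<Prod>\<rho>\<in>ray_of ` S. one_minus (ray_gen \<rho>))"
      by (rule prod.cong[OF R(1) refl])
    also have "\<dots> = (\<Prod>b\<in>S. one_minus (ray_gen (ray_of b)))"
      by (rule prod.reindex[OF R(3), unfolded comp_def])
    finally show ?thesis by (simp add: R(2))
  qed
  moreover have "F S = (\<lambda>v. of_bool (real_vec v \<in> \<sigma>))" by (simp add: F_def \<sigma>_eq fun_eq_iff)
  moreover have "F {} = (\<lambda>v. of_bool (v = 0))"
  proof
    fix v
    have "v = 0" if "\<forall>b\<in>B. L b (real_vec v) = 0"
    proof -
      have "real_vec v = 0" using L(2)[of "real_vec v"] that by simp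
      then show ?thesis by (metis real_vec_0 real_vec_eq_iff)
    qed
    then show "F {} v = of_bool (v = 0)" by (auto simp: F_def linear_0[OF L(1)])
  qed
  ultimately show ?thesis by simp
qed

lemma finite_rays: "fan \<Delta> \<Longrightarrow> finite (rays \<Delta>)"
  by (simp add: fan_def rays_def)

lemma finite_maximal_cones: "fan \<Delta> \<Longrightarrow> finite (maximal_cones \<Delta>)"
  by (simp add: fan_def maximal_cones_def)

text \<open>At least one factor \<open>1 - x^u\<close> is required to annihilate a constant
  function. The index type is nonempty, so some cone contains a nonzero vector.\<close>

lemma rays_nonempty:
  assumes fan: "fan \<Delta>" and smooth: "smooth_fan \<Delta>" and complete: "complete_fan \<Delta>"
  shows "rays (\<Delta> :: 'n::finite cone set) \<noteq> {}"
proof -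
  let ?x = "axis undefined 1 :: real ^ 'n"
  have "?x \<noteq> 0" by (simp add: axis_eq_0_iff)
  obtain \<sigma> where \<sigma>: "\<sigma> \<in> \<Delta>" "?x \<in> \<sigma>" using complete by (auto simp: complete_fan_def)
  obtain B S L where B: "finite B" "S \<subseteq> B"
    and L: "\<And>b. linear (L b)" "\<And>x. x = (\<Sum>b\<in>B. L b x *\<^sub>R real_vec b)"
    "\<And>b b'. b \<in> B \<Longrightarrow> b' \<in> B \<Longrightarrow> L b (real_vec b') = of_bool (b = b')"
    "\<And>b v. L b (real_vec v) \<in> \<int>"
    and \<sigma>_eq: "\<sigma> = {x. (\<forall>b\<in>S. 0 \<le> L b x) \<and> (\<forall>b\<in>B - S. L b x = 0)}"
    by (rule smooth_cone_dual[OF smooth \<sigma>(1)]) (rule that; assumption)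
  have "S \<noteq> {}"
  proof
    assume "S = {}"
    then have "\<forall>b\<in>B. L b ?x = 0" using \<sigma>(2) by (simp add: \<sigma>_eq)
    then have "?x = 0" using L(2)[of ?x] by simp
    then show False using \<open>?x \<noteq> 0\<close> by simp
  qed
  then show ?thesis using rays_of_smooth_cone(1)[OF fan \<sigma>(1) B L \<sigma>_eq] by blast
qed

lemma maximal_cone_above:
  assumes "fan \<Delta>" "\<sigma> \<in> \<Delta>"
  obtains \<tau> where "\<tau> \<in> maximal_cones \<Delta>" "\<sigma> \<subseteq> \<tau>"
proof -
  have "finite \<Delta>" using assms(1) by (simp add: fan_def)
  from finite_has_maximal2[OF this assms(2)] obtain \<tau> where
    "\<tau> \<in> \<Delta>" "\<sigma> \<subseteq> \<tau>" "\<forall>\<tau>'\<in>\<Delta>. \<tau> \<subseteq> \<tau>' \<longrightarrow> \<tau> = \<tau>'" by blast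
  then show ?thesis using that[of \<tau>] unfolding maximal_cones_def by blast
qed

lemma alternating_sum_nonempty_subsets:
  assumes "finite A" "A \<noteq> {}"
  shows "(\<Sum>S\<in>Pow A - {{}}. (-1) ^ (card S - 1)) = (1 :: int)"
proof -
  \<comment> \<open>All factors of this product are 0, and expanding it gives the sum of
    \<open>(-1) ^ card S\<close> over all subsets, including the empty one.\<close>
  have "(\<Prod>a\<in>A. (-1) + (1 :: int)) = (\<Sum>S\<in>Pow A. (\<Prod>a\<in>S. -1) * (\<Prod>a\<in>A - S. 1))"
    by (rule prod_add[OF assms(1)])
  then have "(\<Sum>S\<in>Pow A. (-1) ^ card S) = (0 :: int)" using assms by (simp add: prod_constant card_gt_0_iff zero_power)
  then have "1 + (\<Sum>S\<in>Pow A - {{}}. (-1) ^ card S) = (0 :: int)"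
    using assms(1) by (subst (asm) sum.remove[of _ "{}"]) auto
  moreover have "(\<Sum>S\<in>Pow A - {{}}. (-1) ^ (card S - 1)) = (\<Sum>S\<in>Pow A - {{}}. - ((-1) ^ card S) :: int)"
  proof (intro sum.cong refl)
    fix S assume "S \<in> Pow A - {{}}"
    then have "card S \<noteq> 0" using assms(1) finite_subset[of S A] by auto
    then obtain k where "card S = Suc k" by (cases "card S") auto
    then show "(-1) ^ (card S - 1) = (- ((-1) ^ card S) :: int)" by simp
  qed
  ultimately show ?thesis by (simp add: sum_negf)
qed

text \<open>
  Convolution with the product of all \<open>1 - x\<^sup>u\<close>, \<open>u\<close> a ray generator, turns the indicator function of a
  cone into the Laurent polynomial \<open>\<Prod> (1 - x\<^sup>u)\<close> over the rays outside the cone, and annihilates the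
  constant function \<open>1\<close>, which is the alternating sum of the indicator functions.
\<close>

lemma fan_character_identity:
  fixes \<psi> :: "'n::finite lattice \<Rightarrow> 'r::comm_ring_1"
  assumes fan: "fan \<Delta>" and smooth: "smooth_fan \<Delta>" and complete: "complete_fan \<Delta>"
    and \<psi>: "\<psi> 0 = 1" "\<And>u v. \<psi> (u + v) = \<psi> u * \<psi> v"
  shows "(\<Sum>S\<in>Pow (maximal_cones \<Delta>) - {{}}. (-1) ^ (card S - 1) *
    (\<Prod>\<rho>\<in>{\<rho>\<in>rays \<Delta>. \<not> \<rho> \<subseteq> \<Inter>S}. 1 - \<psi> (ray_gen \<rho>))) = 0"
proof -
  let ?M = "maximal_cones \<Delta>"
  let ?P = "\<lambda>A. \<Prod>\<rho>\<in>A. one_minus (ray_gen \<rho>)"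
  have finR: "finite (rays \<Delta>)" and finM: "finite ?M"
    using fan by (auto intro: finite_rays finite_maximal_cones)
  \<comment> \<open>The identity is proved between Laurent polynomials, coefficient by coefficient.
    Substituting \<open>\<psi>\<close> only at the end avoids any inversion in the ring of its
    values.\<close>
  have "(\<Sum>S\<in>Pow ?M - {{}}. (-1) ^ (card S - 1) * ?P {\<rho>\<in>rays \<Delta>. \<not> \<rho> \<subseteq> \<Inter>S}) = 0" (is "?p = 0")
  proof (rule poly_mapping_eqI)
    fix v
    have lookup_sign: "Poly_Mapping.lookup ((-1) ^ k * p) v = (-1) ^ k * Poly_Mapping.lookup p v"
      for k and p :: "'n lattice \<Rightarrow>\<^sub>0 int"
      by (cases "even k") auto
    have "Poly_Mapping.lookup ?p v =
        (\<Sum>S\<in>Pow ?M - {{}}. (-1) ^ (card S - 1) * conv (?P (rays \<Delta>)) (\<lambda>v. of_bool (real_vec v \<in> \<Inter>S)) v)"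
      unfolding lookup_sum lookup_sign
    proof (intro sum.cong refl arg_cong[of _ _ "(*) _"])
      fix S assume S: "S \<in> Pow ?M - {{}}"
      let ?A = "{\<rho>\<in>rays \<Delta>. \<not> \<rho> \<subseteq> \<Inter>S}" and ?B = "{\<rho>\<in>rays \<Delta>. \<rho> \<subseteq> \<Inter>S}"
      have "\<Inter>S \<in> \<Delta>"
        using S finM by (intro Inter_mem_fan[OF fan]) (auto simp: maximal_cones_def intro: finite_subset)
      note * = conv_cone[OF fan smooth this]
      have "rays \<Delta> = ?A \<union> ?B" by blast
      then have "?P (rays \<Delta>) = ?P (?A \<union> ?B)" by simp
      also have "\<dots> = ?P ?A * ?P ?B" using finR by (intro prod.union_disjoint) auto
      finally have eq: "?P (rays \<Delta>) = ?P ?A * ?P ?B" .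
      have "finite ?A" using finR by simp
      have "conv (?P (rays \<Delta>)) (\<lambda>v. of_bool (real_vec v \<in> \<Inter>S)) =
          conv (?P ?A) (conv (?P ?B) (\<lambda>v. of_bool (real_vec v \<in> \<Inter>S)))"
        unfolding eq by (rule conv_prod_mult[OF \<open>finite ?A\<close>])
      also have "\<dots> = Poly_Mapping.lookup (?P ?A)"
        unfolding * by (rule conv_delta)
      finally have "conv (?P (rays \<Delta>)) (\<lambda>v. of_bool (real_vec v \<in> \<Inter>S)) = Poly_Mapping.lookup (?P ?A)" .
      then show "Poly_Mapping.lookup (?P ?A) v = conv (?P (rays \<Delta>)) (\<lambda>v. of_bool (real_vec v \<in> \<Inter>S)) v"
        by simp
    qed
    also have "\<dots> = conv (?P (rays \<Delta>)) (\<lambda>v. \<Sum>S\<in>Pow ?M - {{}}. (-1) ^ (card S - 1) * of_bool (real_vec v \<in> \<Inter>S)) v"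
      by (rule conv_sum[symmetric])
    also have "(\<lambda>v. \<Sum>S\<in>Pow ?M - {{}}. (-1) ^ (card S - 1) * of_bool (real_vec v \<in> \<Inter>S)) = (\<lambda>v. 1 :: int)"
    proof
      fix v
      \<comment> \<open>The sets \<open>S\<close> that contribute at \<open>v\<close> are the
        nonempty subsets of \<open>?N\<close>. Completeness of the fan makes \<open>?N\<close>
        nonempty, so their alternating sum is 1.\<close>
      let ?N = "{\<sigma>\<in>?M. real_vec v \<in> \<sigma>}"
      obtain \<sigma> where "\<sigma> \<in> \<Delta>" "real_vec v \<in> \<sigma>" using complete by (auto simp: complete_fan_def)
      then have "?N \<noteq> {}" using maximal_cone_above[OF fan] by (metis (mono_tags, lifting) empty_Collect_eq subsetD)
      have "(\<Sum>S\<in>Pow ?M - {{}}. (-1) ^ (card S - 1) * of_bool (real_vec v \<in> \<Inter>S)) =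
          (\<Sum>S\<in>Pow ?N - {{}}. (-1) ^ (card S - 1) :: int)"
        using finM by (intro sum.mono_neutral_cong_right) auto
      also have "\<dots> = 1" using finM \<open>?N \<noteq> {}\<close> by (intro alternating_sum_nonempty_subsets) auto
      finally show "(\<Sum>S\<in>Pow ?M - {{}}. (-1) ^ (card S - 1) * of_bool (real_vec v \<in> \<Inter>S)) = (1 :: int)" .
    qed
    also have "conv (?P (rays \<Delta>)) (\<lambda>v. 1) v = 0"
    proof -
      obtain \<rho> where \<rho>: "\<rho> \<in> rays \<Delta>" using rays_nonempty[OF fan smooth complete] by blast
      have "?P (rays \<Delta>) = one_minus (ray_gen \<rho>) * ?P (rays \<Delta> - {\<rho>})"
        using finR \<rho> by (rule prod.remove)
      then have "conv (?P (rays \<Delta>)) (\<lambda>v. 1) = conv (?P (rays \<Delta> - {\<rho>})) (shift_diff (ray_gen \<rho>) (\<lambda>v. 1))"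
        by (simp only: conv_one_minus_mult conv_shift_diff)
      then show ?thesis by (simp add: shift_diff_def conv_def lin_ext_def)
    qed
    finally show "Poly_Mapping.lookup ?p v = Poly_Mapping.lookup 0 v" by simp
  qed
  then have "lin_ext \<psi> ?p = 0" by (simp add: lin_ext_def)
  then show ?thesis using finR by (simp add: lin_ext_alternating_sum lin_ext_prod_one_minus[OF \<psi>])
qed


section \<open>Units of the ring of Laurent polynomials, and linear equivalence\<close>

lemma pairing_diff: "pairing (m - m') u = pairing m u - pairing m' u"
  by (simp add: pairing_def left_diff_distrib sum_subtractf)

lemma pairing_add: "pairing (m + m') u = pairing m u + pairing m' u"
  by (simp add: pairing_def distrib_right sum.distrib)

lemma pairing_add_right: "pairing m (u + v) = pairing m u + pairing m v"
  by (simp add: pairing_def distrib_left sum.distrib)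

text \<open>The functionals are taken on the moment curve \<open>(1, K, K\<^sup>2, \<dots>)\<close>, with \<open>K\<close> avoiding finitely many roots.\<close>

lemma separating_functional:
  fixes A :: "'n::finite lattice set"
  assumes "finite A"
  obtains u where "inj_on (\<lambda>m. pairing m u) A"
proof -
  obtain r :: "'n \<Rightarrow> nat" where r: "inj r"
    using finite_imp_inj_to_nat_seg[of "UNIV :: 'n set"] by auto
  define p :: "'n lattice \<Rightarrow> int poly" where "p m = (\<Sum>i\<in>UNIV. monom (m $ i) (r i))" for m
  have coeff_p: "coeff (p m) (r i) = m $ i" for m i
    using r by (simp add: p_def coeff_sum inj_eq)
  have nz: "p m \<noteq> 0" if "m \<noteq> 0" for m
    using that coeff_p by (metis coeff_0 vec_eq_iff zero_index)
  define D where "D = (\<lambda>(m, m'). m - m') ` (A \<times> A) - {0}"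
  have "finite D" using assms by (simp add: D_def)
  then have "finite (\<Union>m\<in>D. {x. poly (p m) x = 0})"
    using nz by (auto simp: D_def intro!: poly_roots_finite)
  then obtain K where K: "K \<notin> (\<Union>m\<in>D. {x. poly (p m) x = 0})"
    using infinite_UNIV_int by (metis ex_new_if_finite)
  define u :: "'n lattice" where "u = (\<chi> i. K ^ r i)"
  have u: "pairing m u = poly (p m) K" for m
    by (simp add: pairing_def u_def p_def poly_sum poly_monom)
  show ?thesis
  proof (rule that, rule inj_onI, rule ccontr)
    fix m m' assume m: "m \<in> A" "m' \<in> A" "pairing m u = pairing m' u" "m \<noteq> m'"
    then have "m - m' \<in> D" by (auto simp: D_def)
    moreover have "poly (p (m - m')) K = 0" using m(3) by (simp add: pairing_diff flip: u)
    ultimately show False using K by blast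
  qed
qed

lemma lookup_mult_unique:
  fixes f g :: "'n::finite laurent"
  assumes "\<And>a b. a \<in> Poly_Mapping.keys f \<Longrightarrow> b \<in> Poly_Mapping.keys g \<Longrightarrow> a + b = m + m' \<Longrightarrow> a = m \<and> b = m'"
  shows "Poly_Mapping.lookup (f * g) (m + m') = Poly_Mapping.lookup f m * Poly_Mapping.lookup g m'"
proof -
  have inner: "(\<Sum>q. Poly_Mapping.lookup g q when m + m' = l + q) = Poly_Mapping.lookup g (m + m' - l)" for l
  proof -
    have "m + m' = l + q \<longleftrightarrow> q = m + m' - l" for q by (auto simp: algebra_simps)
    then show ?thesis by simp
  qed
  have "Poly_Mapping.lookup (f * g) (m + m') =
      (\<Sum>l. Poly_Mapping.lookup f l * Poly_Mapping.lookup g (m + m' - l))"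
    by (simp add: lookup_mult inner)
  also have "\<dots> = (\<Sum>l. (Poly_Mapping.lookup f m * Poly_Mapping.lookup g m') when l = m)"
  proof (rule Sum_any.cong)
    fix l
    show "Poly_Mapping.lookup f l * Poly_Mapping.lookup g (m + m' - l) =
        (Poly_Mapping.lookup f m * Poly_Mapping.lookup g m' when l = m)"
      using assms[of l "m + m' - l"] by (cases "l = m") (auto simp: in_keys_iff)
  qed
  finally show ?thesis by simp
qed

text \<open>
  For a functional separating the exponents, the lowest and the highest terms of \<open>f\<close> and \<open>g\<close> multiply
  without cancellation, so that \<open>f * g = 1\<close> forces them to agree.
\<close>

lemma laurent_unit_monomial:
  fixes f :: "'n::finite laurent"
  assumes "f dvd 1"
  obtains m where "Poly_Mapping.keys f = {m}"
proof -
  obtain g where fg: "f * g = 1" using assms by (auto simp: dvd_def)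
  let ?F = "Poly_Mapping.keys f" and ?G = "Poly_Mapping.keys g"
  have ne: "?F \<noteq> {}" "?G \<noteq> {}" using fg by auto
  obtain u where u: "inj_on (\<lambda>m. pairing m u) (?F \<union> ?G)"
    using separating_functional[of "?F \<union> ?G"] by auto
  have extremal: "m + m' = 0" if m: "m \<in> ?F" "m' \<in> ?G" and
    le: "(\<forall>a\<in>?F. \<forall>b\<in>?G. pairing m u \<le> pairing a u \<and> pairing m' u \<le> pairing b u) \<or>
      (\<forall>a\<in>?F. \<forall>b\<in>?G. pairing a u \<le> pairing m u \<and> pairing b u \<le> pairing m' u)" for m m'
  proof (rule ccontr)
    assume "m + m' \<noteq> 0"
    have "Poly_Mapping.lookup (f * g) (m + m') = Poly_Mapping.lookup f m * Poly_Mapping.lookup g m'"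
    proof (rule lookup_mult_unique)
      fix a b assume ab: "a \<in> ?F" "b \<in> ?G" "a + b = m + m'"
      then have "pairing a u + pairing b u = pairing m u + pairing m' u" by (metis pairing_add)
      then have "pairing a u = pairing m u" "pairing b u = pairing m' u"
        using le ab by (metis add_le_cancel_left add_le_cancel_right order_antisym)+
      then show "a = m \<and> b = m'" using u ab m by (auto dest: inj_onD)
    qed
    moreover have "Poly_Mapping.lookup (1 :: 'n laurent) (m + m') = 0"
      using \<open>m + m' \<noteq> 0\<close> by (simp add: lookup_one)
    ultimately show False using m fg by (simp add: in_keys_iff)
  qed
  let ?p = "\<lambda>m. pairing m u"
  have ex_min: "\<exists>m\<in>A. \<forall>a\<in>A. h m \<le> h a" if "finite A" "A \<noteq> {}" for A and h :: "'n lattice \<Rightarrow> int"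
    using arg_min_if_finite(1)[OF that] arg_min_least[OF that] by blast
  obtain m where m: "m \<in> ?F" "\<forall>a\<in>?F. ?p m \<le> ?p a" using ex_min[OF _ ne(1), of ?p] by auto
  obtain m' where m': "m' \<in> ?G" "\<forall>a\<in>?G. ?p m' \<le> ?p a" using ex_min[OF _ ne(2), of ?p] by auto
  obtain n where n: "n \<in> ?F" "\<forall>a\<in>?F. ?p a \<le> ?p n" using ex_min[OF _ ne(1), of "\<lambda>m. - ?p m"] by auto
  obtain n' where n': "n' \<in> ?G" "\<forall>a\<in>?G. ?p a \<le> ?p n'" using ex_min[OF _ ne(2), of "\<lambda>m. - ?p m"] by auto
  have "m + m' = 0" by (rule extremal[OF m(1) m'(1)]) (use m(2) m'(2) in blast)
  moreover have "n + n' = 0" by (rule extremal[OF n(1) n'(1)]) (use n(2) n'(2) in blast)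
  ultimately have "m + m' = n + n'" by simp
  then have "?p m + ?p m' = ?p n + ?p n'" by (metis pairing_add)
  then have "?p m = ?p n" using bspec[OF m(2) n(1)] bspec[OF m'(2) n'(1)] by linarith
  have "?F = {m}"
  proof (intro equalityI subsetI)
    fix a assume a: "a \<in> ?F"
    then have "?p a = ?p m" using bspec[OF m(2) a] bspec[OF n(2) a] \<open>?p m = ?p n\<close> by linarith
    then show "a \<in> {m}" using u a m(1) by (auto dest: inj_onD)
  qed (use m in auto)
  then show ?thesis by (rule that)
qed

text \<open>A unit has a single exponent, so its orders along all boundary divisors are the values
  of one linear function at the ray generators.\<close>

lemma linearly_equivalent_character:
  assumes "linearly_equivalent \<Delta> D E"
  obtains m where "\<forall>\<rho>\<in>rays \<Delta>. pairing m (ray_gen \<rho>) = Poly_Mapping.lookup (D - E) \<rho>"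
proof -
  obtain f where f: "f dvd 1" "\<forall>\<rho>\<in>rays \<Delta>. ord_along \<rho> f = Poly_Mapping.lookup (D - E) \<rho>"
    using assms unfolding linearly_equivalent_def by blast
  obtain m where m: "Poly_Mapping.keys f = {m}" using laurent_unit_monomial[OF f(1)] .
  show ?thesis using f(2) by (intro that[of m]) (simp add: ord_along_def m)
qed


section \<open>Kronecker's expansion in formal power series\<close>

text \<open>
  The coefficients of the \<open>q\<close>-binomial series: \<open>\<Sum>\<^sub>n a\<^sub>n L\<^sup>n = \<Prod>\<^sub>m (1 - c q\<^sup>m L) / (1 - q\<^bsup>m+1\<^esup> L)\<close>.
\<close>

definition qbinom_coeff :: "complex fps \<Rightarrow> nat \<Rightarrow> complex fps" where
  "qbinom_coeff c n = (\<Prod>j<n. (fps_X - c * fps_X ^ j) * inverse (1 - fps_X ^ Suc j))"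

lemma qbinom_coeff_0 [simp]: "qbinom_coeff c 0 = 1"
  by (simp add: qbinom_coeff_def)

lemma qbinom_coeff_Suc:
  "(1 - fps_X ^ Suc n) * qbinom_coeff c (Suc n) = (fps_X - c * fps_X ^ n) * qbinom_coeff c n"
proof -
  have "(1 - fps_X ^ Suc n :: complex fps) * inverse (1 - fps_X ^ Suc n) = 1"
    by (rule inverse_mult_eq_1') simp
  then show ?thesis
    by (simp add: qbinom_coeff_def mult.assoc mult.left_commute)
qed

text \<open>All factors with \<open>j \<ge> 1\<close> are divisible by \<open>q\<close>, but the
  factor \<open>q - c\<close> for \<open>j = 0\<close> need not be; hence the shift by one, and the
  bounds \<open>n \<le> Suc k\<close> for coefficients of \<open>q^k\<close> below. With
  \<open>c * fps_X\<close> for \<open>c\<close>, the first factor is divisible too, as used in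
  \<open>qbinom_coeff_X_dvd\<close>.\<close>

lemma qbinom_coeff_dvd: "fps_X ^ n dvd qbinom_coeff c (Suc n)"
proof (induction n)
  case (Suc n)
  have "qbinom_coeff c (Suc (Suc n)) =
      fps_X * ((1 - c * fps_X ^ n) * inverse (1 - fps_X ^ Suc (Suc n)) * qbinom_coeff c (Suc n))"
    by (simp add: qbinom_coeff_def algebra_simps)
  then show ?case using Suc by (simp add: dvd_mult)
qed simp

lemma qbinom_coeff_X_dvd: "fps_X ^ n dvd qbinom_coeff (c * fps_X) n"
proof (induction n)
  case (Suc n)
  have "qbinom_coeff (c * fps_X) (Suc n) =
      fps_X * ((1 - c * fps_X ^ n) * inverse (1 - fps_X ^ Suc n) * qbinom_coeff (c * fps_X) n)"
    by (simp add: qbinom_coeff_def algebra_simps)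
  then show ?case using Suc by (simp add: dvd_mult)
qed simp

lemma fps_nth_eq_0_if_X_power_dvd: "fps_X ^ n dvd f \<Longrightarrow> k < n \<Longrightarrow> fps_nth f k = 0"
  for f :: "'a::comm_ring_1 fps"
  by (auto simp: dvd_def fps_X_power_mult_nth)

lemma qbinom_coeff_nth_eq_0: "Suc k < n \<Longrightarrow> fps_nth (qbinom_coeff c n) k = 0"
  using fps_nth_eq_0_if_X_power_dvd[OF qbinom_coeff_dvd[of "n - 1" c], of k] by simp

text \<open>The coefficients of the q-binomial series divided by \<open>1 - L\<close>. They are 0 at
  negative indices so that their recurrence can be stated for all integers.\<close>

definition qbinom_partial :: "complex \<Rightarrow> int \<Rightarrow> complex fps" where
  "qbinom_partial b j = (if 0 \<le> j then \<Sum>n\<le>nat j. qbinom_coeff (fps_const b) n else 0)"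

text \<open>Dividing the product by \<open>1 - L\<close> turns it into the product of
  \<open>(1 - b q^m L) / (1 - q^m L)\<close>, which is again a q-binomial series; its consecutive
  coefficients have ratio \<open>(1 - b q^n) / (1 - q^(n+1))\<close>.\<close>

lemma qbinom_partial_nat_Suc:
  "(1 - fps_X ^ Suc n) * (\<Sum>i\<le>Suc n. qbinom_coeff (fps_const b) i) =
    (1 - fps_const b * fps_X ^ n) * (\<Sum>i\<le>n. qbinom_coeff (fps_const b) i)"
proof -
  let ?u = "qbinom_coeff (fps_const b)"
  have "(1 - fps_X ^ Suc n) * ?u (Suc n) = (fps_X ^ Suc n - fps_const b * fps_X ^ n) * (\<Sum>i\<le>n. ?u i)"
  proof (induction n)
    case 0
    show ?case using qbinom_coeff_Suc[of 0 "fps_const b"] by simp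
  next
    case (Suc n)
    have "(fps_X ^ Suc (Suc n) - fps_const b * fps_X ^ Suc n) * (\<Sum>i\<le>Suc n. ?u i) =
        fps_X * ((fps_X ^ Suc n - fps_const b * fps_X ^ n) * (\<Sum>i\<le>n. ?u i)) +
        (fps_X ^ Suc (Suc n) - fps_const b * fps_X ^ Suc n) * ?u (Suc n)"
      by (simp add: algebra_simps)
    also have "\<dots> = (fps_X - fps_const b * fps_X ^ Suc n) * ?u (Suc n)"
      unfolding Suc[symmetric] by (simp add: algebra_simps)
    also have "\<dots> = (1 - fps_X ^ Suc (Suc n)) * ?u (Suc (Suc n))"
      by (rule qbinom_coeff_Suc[symmetric])
    finally show ?case ..
  qed
  then show ?thesis by (simp add: algebra_simps)
qed

section \<open>Lower bounds for the order of a formal Laurent series\<close>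

definition fls_ord_ge :: "complex fls \<Rightarrow> int \<Rightarrow> bool" where
  "fls_ord_ge f n \<longleftrightarrow> (\<forall>k<n. fls_nth f k = 0)"

lemma fls_ord_ge_mult:
  assumes "fls_ord_ge f m" "fls_ord_ge g n"
  shows "fls_ord_ge (f * g) (m + n)"
proof (cases "f = 0 \<or> g = 0")
  case False
  then have "m \<le> fls_subdegree f" "n \<le> fls_subdegree g"
    using assms by (auto simp: fls_ord_ge_def intro: fls_subdegree_geI)
  then show ?thesis
    using False unfolding fls_ord_ge_def by (auto intro!: fls_eq0_below_subdegree)
qed (auto simp: fls_ord_ge_def)

lemma fls_ord_ge_diff: "fls_ord_ge f n \<Longrightarrow> fls_ord_ge g n \<Longrightarrow> fls_ord_ge (f - g) n"
  by (simp add: fls_ord_ge_def)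

lemma fls_ord_ge_mono: "fls_ord_ge f n \<Longrightarrow> m \<le> n \<Longrightarrow> fls_ord_ge f m"
  by (simp add: fls_ord_ge_def)

lemma fls_ord_ge_fps: "fls_ord_ge (fps_to_fls f) 0"
  by (simp add: fls_ord_ge_def)

lemma fls_ord_ge_X: "fls_ord_ge (fls_X powi n) n"
  by (simp add: fls_ord_ge_def)

lemma fls_ord_ge_const: "fls_ord_ge (fls_const c) 0"
  by (simp add: fls_ord_ge_def)

text \<open>The limit arguments end here: a difference is shown to vanish by giving it arbitrarily
  large order. The predicate holds for the zero series with every \<open>n\<close>, whereas
  \<open>fls_subdegree\<close> assigns it a fixed value.\<close>

lemma fls_eq_0_if_ord_ge: "(\<And>n. fls_ord_ge f n) \<Longrightarrow> f = 0"
  by (rule fls_eqI) (metis fls_ord_ge_def fls_zero_nth zless_add1_eq)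

text \<open>
  With \<open>\<Theta>(x) = \<Prod>\<^sub>m (1 - b q\<^sup>m/x) (1 - b\<^sup>-\<^sup>1 q\<^bsup>m+1\<^esup> x) / ((1 - q\<^bsup>m+1\<^esup>/x) (1 - q\<^bsup>m+1\<^esup> x))\<close>,
  \<open>theta_tail b N\<close> is the sum of the coefficients of \<open>x\<^sup>d\<close>, \<open>d \<ge> -N\<close>, in \<open>\<Theta>\<close>, i.e. the coefficient of
  \<open>x\<^bsup>-N\<^esup>\<close> in \<open>\<Theta>(x) / (1 - 1/x)\<close>, and \<open>theta_total b = \<Theta>(1)\<close>.
\<close>

definition theta_coeff :: "complex \<Rightarrow> nat \<Rightarrow> nat \<Rightarrow> complex fps" where
  "theta_coeff b n m = qbinom_coeff (fps_const b) n * qbinom_coeff (fps_const (inverse b) * fps_X) m"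

definition theta_tail :: "complex \<Rightarrow> int \<Rightarrow> complex fps" where
  "theta_tail b N = Abs_fps (\<lambda>k. \<Sum>n\<le>Suc k. \<Sum>m\<le>Suc k.
     fps_nth (theta_coeff b n m) k * of_bool (0 \<le> N + (int m - int n)))"

definition theta_total :: "complex \<Rightarrow> complex fps" where
  "theta_total b = Abs_fps (\<lambda>k. \<Sum>n\<le>Suc k. \<Sum>m\<le>Suc k. fps_nth (theta_coeff b n m) k)"

lemma theta_coeff_nth_eq_0:
  assumes "Suc k < n \<or> k < m"
  shows "fps_nth (theta_coeff b n m) k = 0"
  using assms
proof
  assume "Suc k < n"
  then have "fps_nth (qbinom_coeff (fps_const b) n) i = 0" if "i \<le> k" for i
    using that by (intro qbinom_coeff_nth_eq_0) auto
  then show ?thesis by (simp add: theta_coeff_def fps_mult_nth)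
next
  assume "k < m"
  then show ?thesis
    using fps_nth_eq_0_if_X_power_dvd[of m "theta_coeff b n m"] qbinom_coeff_X_dvd
    by (simp add: theta_coeff_def dvd_mult)
qed

text \<open>For fixed \<open>m\<close> the cut-off on \<open>n\<close> turns q-binomial coefficients
  into their partial sums. Any truncation \<open>K > k\<close> is correct for the coefficient of
  \<open>q^k\<close>, which provides finite sums that can be telescoped.\<close>

lemma theta_tail_nth:
  assumes "k < K"
  shows "fps_nth (theta_tail b N) k =
    fps_nth (\<Sum>m<K. qbinom_partial b (int m + N) * qbinom_coeff (fps_const (inverse b) * fps_X) m) k"
proof -
  let ?c = "\<lambda>n m. fps_nth (theta_coeff b n m) k"
  have inner: "(\<Sum>n\<le>Suc k. ?c n m * of_bool (0 \<le> N + (int m - int n))) =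
      fps_nth (qbinom_partial b (int m + N) * qbinom_coeff (fps_const (inverse b) * fps_X) m) k" for m
  proof (cases "0 \<le> int m + N")
    case True
    let ?A = "{..nat (int m + N)}"
    have "(\<Sum>n\<le>Suc k. ?c n m * of_bool (0 \<le> N + (int m - int n))) = (\<Sum>n\<in>{..Suc k} \<inter> ?A. ?c n m)"
      using True by (intro sum.mono_neutral_cong_right) auto
    also have "\<dots> = (\<Sum>n\<in>?A. ?c n m)"
      by (intro sum.mono_neutral_left) (auto simp: not_le intro!: theta_coeff_nth_eq_0)
    finally show ?thesis using True
      by (simp add: qbinom_partial_def sum_distrib_right fps_sum_nth theta_coeff_def)
  next
    case False
    then show ?thesis by (auto simp: qbinom_partial_def intro!: sum.neutral)
  qed
  have "fps_nth (theta_tail b N) k = (\<Sum>m\<le>Suc k. \<Sum>n\<le>Suc k. ?c n m * of_bool (0 \<le> N + (int m - int n)))"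
    unfolding theta_tail_def fps_nth_Abs_fps by (rule sum.swap)
  also have "\<dots> = (\<Sum>m\<le>k. \<Sum>n\<le>Suc k. ?c n m * of_bool (0 \<le> N + (int m - int n)))"
    by (intro sum.mono_neutral_right) (auto simp: theta_coeff_nth_eq_0 not_le intro!: sum.neutral)
  also have "\<dots> = (\<Sum>m<K. \<Sum>n\<le>Suc k. ?c n m * of_bool (0 \<le> N + (int m - int n)))"
    using assms by (intro sum.mono_neutral_left) (auto simp: theta_coeff_nth_eq_0 not_le intro!: sum.neutral)
  finally show ?thesis unfolding inner fps_sum_nth .
qed

text \<open>Only \<open>n \<le> k + 1\<close> occurs, and \<open>k + 1 \<le> N\<close>, so the
  cut-off is void: the tails converge to the total as \<open>N\<close> grows.\<close>

lemma theta_total_nth: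
  assumes "int k < N"
  shows "fps_nth (theta_tail b N) k = fps_nth (theta_total b) k"
  unfolding theta_tail_def theta_total_def fps_nth_Abs_fps
  by (intro sum.cong refl) (use assms in auto)

text \<open>
  Kronecker's partial fraction expansion of \<open>\<Theta>(x) / (1 - 1/x)\<close>. The left-hand side does not depend on
  \<open>N\<close>, as its difference between \<open>N + 1\<close> and \<open>N\<close> telescopes with the terms \<open>S N m\<close> below; its limit as
  \<open>N\<close> tends to infinity is the right-hand side.
\<close>

lemma theta_tail_times:
  assumes b: "b \<noteq> 0"
  shows "(1 - fls_const b * fls_X powi N) * fps_to_fls (theta_tail b N) = fps_to_fls (theta_total b)"
proof -
  define Q :: "complex fls" where "Q = fls_X"
  have Q: "Q \<noteq> 0" by (simp add: Q_def)
  have Q_add: "Q powi (i + j) = Q powi i * Q powi j" for i j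
    using Q by (simp add: power_int_add)
  define c c' where "c = fls_const b" and "c' = fls_const (inverse b)"
  have cc: "c * c' = 1" using b by (simp add: c_def c'_def fls_const_mult_const)
  define U where "U j = fps_to_fls (qbinom_partial b j)" for j
  define V where "V m = fps_to_fls (qbinom_coeff (fps_const (inverse b) * fps_X) m)" for m
  \<comment> \<open>At \<open>j = -1\<close> both sides are 0, the left one by the factor
    \<open>1 - Q powi 0\<close> and the right one because \<open>U (-1) = 0\<close>.\<close>
  have U: "(1 - Q powi (j + 1)) * U (j + 1) = (1 - c * Q powi j) * U j" for j
  proof -
    consider "j < -1" | "j = -1" | "0 \<le> j" by linarith
    then show ?thesis
    proof cases
      case 3
      then obtain n where n: "j = int n" using nonneg_int_cases by blast
      have "nat (j + 1) = Suc n" using n by simp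
      have "fps_to_fls ((1 - fps_X ^ Suc n) * (\<Sum>i\<le>Suc n. qbinom_coeff (fps_const b) i)) =
          fps_to_fls ((1 - fps_const b * fps_X ^ n) * (\<Sum>i\<le>n. qbinom_coeff (fps_const b) i))"
        by (rule arg_cong[OF qbinom_partial_nat_Suc])
      then have "(1 - Q ^ Suc n) * U (int (Suc n)) = (1 - c * Q ^ n) * U (int n)"
        by (simp only: fls_times_fps_to_fls fps_to_fls_minus fps_one_to_fls fps_to_fls_power
            fps_X_to_fls fps_const_to_fls Q_def c_def U_def qbinom_partial_def of_nat_0_le_iff if_True nat_int)
      moreover have "j + 1 = int (Suc n)" using n by simp
      ultimately show ?thesis unfolding \<open>j + 1 = int (Suc n)\<close> unfolding n power_int_of_nat by simp
    qed (auto simp: U_def qbinom_partial_def)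
  qed
  have V: "(1 - Q powi (int m + 1)) * V (Suc m) = (Q - c' * Q powi (int m + 1)) * V m" for m
  proof -
    have "fps_to_fls ((1 - fps_X ^ Suc m) * qbinom_coeff (fps_const (inverse b) * fps_X) (Suc m)) =
        fps_to_fls ((fps_X - fps_const (inverse b) * fps_X * fps_X ^ m) * qbinom_coeff (fps_const (inverse b) * fps_X) m)"
      by (rule arg_cong[OF qbinom_coeff_Suc])
    then have "(1 - Q ^ Suc m) * V (Suc m) = (Q - c' * Q * Q ^ m) * V m"
      by (simp only: fls_times_fps_to_fls fps_to_fls_minus fps_one_to_fls fps_to_fls_power
            fps_X_to_fls fps_const_to_fls Q_def c'_def V_def)
    moreover have "Q powi (int m + 1) = Q * Q ^ m" using Q by (simp add: Q_add power_int_of_nat)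
    ultimately show ?thesis by (simp add: mult.assoc)
  qed
  define S where "S N m = c * Q powi N * (1 - Q powi int m) * U (int m + N) * V m" for N m
  have step: "(1 - c * Q powi (N + 1)) * (U (int m + (N + 1)) * V m) - (1 - c * Q powi N) * (U (int m + N) * V m) =
      S N m - S N (Suc m)" for N m
  proof -
    let ?n = "int m + N"
    have U': "(1 - Q powi (?n + 1)) * U (?n + 1) = (1 - c * Q powi ?n) * U ?n" by (rule U)
    have p: "Q powi ?n = Q powi N * Q powi int m" "Q powi (?n + 1) = Q powi N * Q powi int m * Q"
      "Q powi (N + 1) = Q powi N * Q" "Q powi (int m + 1) = Q powi int m * Q"
      by (simp_all add: Q_add algebra_simps)
    define x y where "x = Q powi N" and "y = Q powi int m"
    define u u' w w' where "u = U ?n" and "u' = U (?n + 1)" and "w = V m" and "w' = V (Suc m)"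
    have 1: "(1 - x * y * Q) * u' = (1 - c * (x * y)) * u" using U' unfolding p u_def u'_def x_def y_def .
    have 2: "(1 - y * Q) * w' = (Q - c' * (y * Q)) * w" using V[of m] unfolding p w_def w'_def y_def .
    have "(1 - c * (x * Q)) * (u' * w) - (1 - c * x) * (u * w) =
        ((1 - x * y * Q) * u') * w + (x * y * Q - c * (x * Q)) * (u' * w) - (1 - c * x) * (u * w)"
      by (simp add: algebra_simps)
    also have "\<dots> = (1 - c * (x * y)) * u * w - (1 - c * x) * (u * w) + (x * y * Q - c * (x * Q)) * (u' * w)"
      unfolding 1 by (simp add: algebra_simps)
    \<comment> \<open>Inserting \<open>c * c' = 1\<close> produces the factor
      \<open>Q - c' * (y * Q)\<close> of the recurrence of \<open>V\<close>.\<close>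
    also have "x * y * Q - c * (x * Q) = (c * c') * (x * y * Q) - c * (x * Q)" by (simp add: cc)
    also have "(1 - c * (x * y)) * u * w - (1 - c * x) * (u * w) + ((c * c') * (x * y * Q) - c * (x * Q)) * (u' * w) =
        c * x * (1 - y) * u * w - c * x * u' * ((Q - c' * (y * Q)) * w)"
      by (simp add: algebra_simps)
    also have "\<dots> = c * x * (1 - y) * u * w - c * x * (1 - y * Q) * u' * w'"
      unfolding 2[symmetric] by (simp add: algebra_simps)
    finally have "(1 - c * (x * Q)) * (u' * w) - (1 - c * x) * (u * w) =
        c * x * (1 - y) * u * w - c * x * (1 - y * Q) * u' * w'" .
    moreover have "int m + (N + 1) = ?n + 1" "int (Suc m) + N = ?n + 1" "int (Suc m) = int m + 1"
      by simp_all
    ultimately show ?thesis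
      unfolding S_def u_def u'_def w_def w'_def x_def y_def by (simp only: p)
  qed
  define H where "H K N = (\<Sum>m<K. U (int m + N) * V m)" for K N
  \<comment> \<open>The term \<open>S N 0\<close> vanishes by its factor
    \<open>1 - Q powi 0\<close>, so only the upper boundary term remains.\<close>
  have telescope: "(1 - c * Q powi (N + 1)) * H K (N + 1) - (1 - c * Q powi N) * H K N = - S N K" for N K
  proof (induction K)
    case 0
    show ?case by (simp add: H_def S_def)
  next
    case (Suc K)
    have "(1 - c * Q powi (N + 1)) * H (Suc K) (N + 1) - (1 - c * Q powi N) * H (Suc K) N =
      ((1 - c * Q powi (N + 1)) * H K (N + 1) - (1 - c * Q powi N) * H K N) +
      ((1 - c * Q powi (N + 1)) * (U (int K + (N + 1)) * V K) - (1 - c * Q powi N) * (U (int K + N) * V K))"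
      by (simp add: H_def algebra_simps)
    then show ?case unfolding Suc step by simp
  qed
  define h where "h N = fps_to_fls (theta_tail b N)" for N
  have h_H: "fls_ord_ge (h N - H K N) (int K)" for N K
    unfolding fls_ord_ge_def
  proof (intro allI impI)
    fix k assume k: "k < int K"
    have H: "H K N = fps_to_fls (\<Sum>m<K. qbinom_partial b (int m + N) * qbinom_coeff (fps_const (inverse b) * fps_X) m)"
    proof -
      have "fps_to_fls (\<Sum>m<K. f m) = (\<Sum>m<K. fps_to_fls (f m))" for f :: "nat \<Rightarrow> complex fps"
        by (induction K) simp_all
      then show ?thesis by (simp add: H_def U_def V_def fls_times_fps_to_fls)
    qed
    show "fls_nth (h N - H K N) k = 0"
      using theta_tail_nth[of "nat k" K b N] k by (simp add: H h_def)
  qed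
  have ord1: "fls_ord_ge (1 - c * Q powi N) (- \<bar>N\<bar>)" for N
  proof (intro fls_ord_ge_diff)
    have "fls_ord_ge (c * Q powi N) (0 + N)"
      unfolding c_def Q_def by (intro fls_ord_ge_mult fls_ord_ge_const fls_ord_ge_X)
    then show "fls_ord_ge (c * Q powi N) (- \<bar>N\<bar>)" by (rule fls_ord_ge_mono) auto
  qed (simp add: fls_ord_ge_def)
  have const: "(1 - c * Q powi (N + 1)) * h (N + 1) = (1 - c * Q powi N) * h N" for N
  proof -
    have "(1 - c * Q powi (N + 1)) * h (N + 1) - (1 - c * Q powi N) * h N = 0" (is "?d = 0")
    proof (rule fls_eq_0_if_ord_ge)
      fix n
      \<comment> \<open>A factor \<open>1 - c * Q powi N\<close> can lower the order by the absolute
        value of \<open>N\<close>, and \<open>S N K\<close> has order at least \<open>N + K\<close>.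
        This \<open>K\<close> brings all three terms of the difference to order at least
        \<open>n\<close>.\<close>
      define K where "K = nat (\<bar>n\<bar> + \<bar>N\<bar> + 1)"
      have K: "n \<le> - \<bar>N + 1\<bar> + int K" "n \<le> - \<bar>N\<bar> + int K" "n \<le> N + int K" by (auto simp: K_def)
      have "?d = (1 - c * Q powi (N + 1)) * (h (N + 1) - H K (N + 1)) - (1 - c * Q powi N) * (h N - H K N) - S N K"
        using telescope[of N K] by (simp add: algebra_simps)
      moreover have "fls_ord_ge (S N K) n"
      proof -
        have "fls_ord_ge (V K) (int K)"
          using fps_nth_eq_0_if_X_power_dvd[OF qbinom_coeff_X_dvd] by (auto simp: fls_ord_ge_def V_def)
        moreover have "fls_ord_ge (1 - Q powi int K) 0"
          by (auto simp: fls_ord_ge_def Q_def)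
        ultimately have "fls_ord_ge (S N K) (0 + N + 0 + 0 + int K)"
          unfolding S_def c_def U_def Q_def
          by (intro fls_ord_ge_mult fls_ord_ge_const fls_ord_ge_X fls_ord_ge_fps) auto
        then show ?thesis by (rule fls_ord_ge_mono) (use K in simp)
      qed
      ultimately show "fls_ord_ge ?d n"
        using fls_ord_ge_mono[OF fls_ord_ge_mult[OF ord1 h_H] K(1)]
          fls_ord_ge_mono[OF fls_ord_ge_mult[OF ord1 h_H] K(2)]
        by (simp add: fls_ord_ge_diff)
    qed
    then show ?thesis by simp
  qed
  have const': "(1 - c * Q powi N) * h N = (1 - c * Q powi 0) * h 0" for N
  proof (induction N rule: int_induct[where k = 0])
    case (step1 i) then show ?case using const[of i] by simp
  next
    case (step2 i) then show ?case using const[of "i - 1"] by simp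
  qed simp
  have "(1 - c * Q powi N) * h N = fps_to_fls (theta_total b)"
  proof (rule fls_eqI)
    fix k :: int
    \<comment> \<open>Large enough that the term with \<open>Q powi M\<close> does not reach degree
      \<open>k\<close>, and that \<open>theta_tail b M\<close> agrees there with
      \<open>theta_total b\<close>.\<close>
    define M where "M = \<bar>k\<bar> + 1"
    have "(1 - c * Q powi N) * h N = (1 - c * Q powi M) * h M"
      using const'[of N] const'[of M] by simp
    also have "\<dots> = h M - (c * Q powi M) * h M" by (simp add: algebra_simps)
    finally have eq: "(1 - c * Q powi N) * h N = h M - (c * Q powi M) * h M" .
    have "fls_ord_ge ((c * Q powi M) * h M) (0 + M + 0)"
      unfolding c_def Q_def h_def by (intro fls_ord_ge_mult fls_ord_ge_const fls_ord_ge_X fls_ord_ge_fps)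
    then have "fls_nth ((c * Q powi M) * h M) k = 0" by (auto simp: fls_ord_ge_def M_def)
    then have "fls_nth ((1 - c * Q powi N) * h N) k = fls_nth (h M) k" unfolding eq by simp
    also have "\<dots> = fls_nth (fps_to_fls (theta_total b)) k"
      using theta_total_nth[of "nat k" M b] by (auto simp: h_def M_def)
    finally show "fls_nth ((1 - c * Q powi N) * h N) k = fls_nth (fps_to_fls (theta_total b)) k" .
  qed
  then show ?thesis by (simp only: h_def c_def Q_def)
qed


section \<open>The elliptic bundle as a formal series\<close>

text \<open>\<open>prodinf\<close> is a definite description, so the value has to be shown unique.
  \<open>has_prod\<close> admits a second alternative with a vanishing factor; it would make the
  stabilized coefficients vanish, against \<open>p \<noteq> 0\<close>. This works over coefficient
  rings with zero divisors.\<close>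

lemma prodinf_fps_eqI:
  fixes f :: "nat \<Rightarrow> 'a::comm_ring_1 fps"
  assumes nth: "\<And>k M. k < M \<Longrightarrow> fps_nth (\<Prod>i<M. f i) k = fps_nth p k" and p: "p \<noteq> 0"
  shows "prodinf f = p"
  unfolding prodinf_def
proof (rule the_equality)
  have lim: "(\<lambda>n. \<Prod>i\<le>n. f i) \<longlonglongrightarrow> p"
  proof (rule tendsto_fpsI)
    fix k
    have "fps_nth (\<Prod>i\<le>n. f i) k = fps_nth p k" if "k \<le> n" for n
      using nth[of k "Suc n"] that by (simp add: lessThan_Suc_atMost)
    then show "eventually (\<lambda>n. fps_nth (\<Prod>i\<le>n. f i) k = fps_nth p k) sequentially"
      by (auto simp: eventually_sequentially)
  qed
  then show "f has_prod p" using p by (simp add: has_prod_def raw_has_prod_def)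
  fix r assume "f has_prod r"
  then consider "raw_has_prod f 0 r" | i where "f i = 0" unfolding has_prod_def by blast
  then show "r = p"
  proof cases
    case 1
    then have "(\<lambda>n. \<Prod>i\<le>n. f i) \<longlonglongrightarrow> r" by (simp add: raw_has_prod_def)
    then show ?thesis using lim LIMSEQ_unique by blast
  next
    case 2
    have "fps_nth p k = 0" for k
    proof -
      have "(\<Prod>j<Suc (max i k). f j) = 0" using 2 by (intro prod_zero) auto
      then show ?thesis using nth[of k "Suc (max i k)"] by simp
    qed
    then show ?thesis using p by (simp add: fps_eq_iff)
  qed
qed

lemma fps_mult_nth_eq_left:
  fixes f g :: "'a::comm_ring_1 fps"
  assumes "\<And>i. i \<le> k \<Longrightarrow> fps_nth g i = fps_nth 1 i"
  shows "fps_nth (f * g) k = fps_nth f k"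
proof -
  have "fps_nth (f * g) k = fps_nth (f * 1) k"
    unfolding fps_mult_nth by (intro sum.cong refl) (use assms in auto)
  then show ?thesis by simp
qed

text \<open>The geometric series. The ring of bundles is not a field, but the constant term here is
  1, so the inverse \<open>G\<close> exists; the partial sums differ from it by
  \<open>G * ?s ^ n\<close>, which is divisible by \<open>q^n\<close>.\<close>

lemma sym_total_inverse:
  "(1 - fps_X ^ Suc m * fps_const L) * sym_total (fps_X ^ Suc m) L = 1"
proof -
  let ?s = "fps_X ^ Suc m * fps_const L :: 'a vbundle fps"
  define G where "G = fps_right_inverse (1 - ?s) 1"
  have G: "(1 - ?s) * G = 1"
    unfolding G_def by (rule fps_right_inverse) simp
  have partial: "(\<Sum>k<n. (fps_X ^ Suc m) ^ k * fps_const (L ^ k)) = G - G * ?s ^ n" for n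
  proof -
    have "(1 - ?s) * (\<Sum>k<n. ?s ^ k) = 1 - ?s ^ n" by (rule one_diff_power_eq[symmetric])
    then have "G * ((1 - ?s) * (\<Sum>k<n. ?s ^ k)) = G * (1 - ?s ^ n)" by simp
    then have "((1 - ?s) * G) * (\<Sum>k<n. ?s ^ k) = G - G * ?s ^ n" by (simp only: algebra_simps mult_1_left mult_1_right)
    then show ?thesis using G by (simp add: power_mult_distrib fps_const_power)
  qed
  have "(\<lambda>k. (fps_X ^ Suc m) ^ k * fps_const (L ^ k)) sums G"
    unfolding sums_def
  proof (rule tendsto_fpsI)
    fix k
    have "fps_nth (\<Sum>k<n. (fps_X ^ Suc m) ^ k * fps_const (L ^ k)) k = fps_nth G k" if "k < n" for n
    proof -
      have "fps_X dvd ?s" by (simp add: mult.assoc)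
      then have "fps_X ^ n dvd G * ?s ^ n" by (rule dvd_mult[OF dvd_power_same])
      then show ?thesis using that
        unfolding partial by (simp add: fps_nth_eq_0_if_X_power_dvd)
    qed
    then show "eventually (\<lambda>n. fps_nth (\<Sum>k<n. (fps_X ^ Suc m) ^ k * fps_const (L ^ k)) k = fps_nth G k) sequentially"
      by (auto simp: eventually_sequentially intro!: exI[of _ "Suc k"])
  qed
  then have "sym_total (fps_X ^ Suc m) L = G" unfolding sym_total_def by (rule sums_unique[symmetric])
  then show ?thesis using G by simp
qed

section \<open>The q-binomial theorem with a line bundle as variable\<close>

definition scalar_fps :: "complex fps \<Rightarrow> 'n::finite vbundle fps" where
  "scalar_fps f = Abs_fps (\<lambda>k. scalar (fps_nth f k))"

lemma scalar_sum: "scalar (\<Sum>i\<in>A. f i) = (\<Sum>i\<in>A. scalar (f i))"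
  by (induction A rule: infinite_finite_induct) (simp_all add: single_add)

lemma scalar_mult: "scalar (a * b) = (scalar a * scalar b :: 'n::finite vbundle)"
  by (simp add: mult_single)

text \<open>The series of all \<open>a n * L^n\<close>. It is meant for coefficients
  \<open>a n\<close> divisible by \<open>q^(n-1)\<close>, such as the q-binomial ones, for which no
  term beyond \<open>n = k + 1\<close> contributes to \<open>q^k\<close>.\<close>

definition bundle_series :: "(nat \<Rightarrow> complex fps) \<Rightarrow> 'n::finite vbundle \<Rightarrow> 'n vbundle fps" where
  "bundle_series a L = Abs_fps (\<lambda>k. \<Sum>n\<le>Suc k. scalar (fps_nth (a n) k) * L ^ n)"

lemma scalar_fps_mult_bundle_series_nth:
  assumes "\<And>n k. Suc k < n \<Longrightarrow> fps_nth (a n) k = 0"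
  shows "fps_nth (scalar_fps f * fps_const L * bundle_series a L) k =
    (\<Sum>n\<le>Suc k. scalar (fps_nth (f * a n) k) * L ^ Suc n)"
proof -
  have "fps_nth (bundle_series a L) i = (\<Sum>n\<le>Suc k. scalar (fps_nth (a n) i) * L ^ n)" if "i \<le> k" for i
    unfolding bundle_series_def fps_nth_Abs_fps
    by (rule sum.mono_neutral_left) (use that assms in auto)
  then have "fps_nth (scalar_fps f * bundle_series a L) k =
      (\<Sum>i=0..k. \<Sum>n\<le>Suc k. scalar (fps_nth f i) * (scalar (fps_nth (a n) (k - i)) * L ^ n))"
    by (simp add: fps_mult_nth scalar_fps_def sum_distrib_left del: sum.atMost_Suc)
  also have "\<dots> = (\<Sum>n\<le>Suc k. \<Sum>i=0..k. scalar (fps_nth f i) * (scalar (fps_nth (a n) (k - i)) * L ^ n))"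
    by (rule sum.swap)
  also have "\<dots> = (\<Sum>n\<le>Suc k. scalar (fps_nth (f * a n) k) * L ^ n)"
    by (simp add: fps_mult_nth scalar_sum scalar_mult sum_distrib_right mult.assoc del: sum.atMost_Suc)
  finally have "L * fps_nth (scalar_fps f * bundle_series a L) k =
      (\<Sum>n\<le>Suc k. scalar (fps_nth (f * a n) k) * L ^ Suc n)"
    by (simp add: sum_distrib_left algebra_simps del: sum.atMost_Suc)
  moreover have "scalar_fps f * fps_const L * bundle_series a L =
      fps_const L * (scalar_fps f * bundle_series a L)"
    by (simp add: mult_ac)
  ultimately show ?thesis by (simp only: fps_mult_left_const_nth)
qed

lemma fps_X_power_eq_scalar_fps: "fps_X ^ j = scalar_fps (fps_X ^ j)"
  by (rule fps_ext) (simp add: scalar_fps_def fps_X_power_nth)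

lemma scalar_fps_mult_X: "scalar_fps f * fps_X ^ j = scalar_fps (f * fps_X ^ j)"
  by (rule fps_ext) (auto simp: scalar_fps_def fps_X_power_mult_right_nth)

text \<open>\<open>A j\<close> is the q-binomial series at \<open>q^j L\<close>. This is its
  q-difference equation, which on the product side moves one factor of the numerator and one of the
  denominator.\<close>

lemma bundle_series_qbinom_step:
  fixes L :: "'n::finite vbundle" and c :: "complex fps"
  defines "A \<equiv> \<lambda>j. bundle_series (\<lambda>n. fps_X ^ (j * n) * qbinom_coeff c n) L"
  shows "(1 - fps_X ^ Suc j * fps_const L) * A j = (1 - scalar_fps c * fps_X ^ j * fps_const L) * A (Suc j)"
proof (rule fps_ext)
  fix k
  let ?p = "\<lambda>j n. fps_X ^ (j * n) * qbinom_coeff c n :: complex fps"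
  have dvd: "fps_X ^ (n - 1) dvd ?p j n" for j n
    using qbinom_coeff_dvd[of "n - 1" c] by (cases n) (auto intro: dvd_mult)
  have supp: "fps_nth (?p j n) k = 0" if "Suc k < n" for j n k
    using fps_nth_eq_0_if_X_power_dvd[OF dvd] that by simp
  \<comment> \<open>Multiplication by \<open>L\<close> raises indices by one, so the last term
    leaves the truncation range. Facts \<open>z1\<close> and \<open>z2\<close> show that it has no
    coefficient at \<open>q^k\<close> for the two multipliers that occur.\<close>
  have shift: "fps_nth (scalar_fps f * fps_const L * A j) k = (\<Sum>n\<le>k. scalar (fps_nth (f * ?p j n) k) * L ^ Suc n)"
    if "fps_nth (f * ?p j (Suc k)) k = 0" for f j
  proof -
    have "fps_nth (scalar_fps f * fps_const L * A j) k =
        (\<Sum>n\<le>Suc k. scalar (fps_nth (f * ?p j n) k) * L ^ Suc n)"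
      unfolding A_def by (rule scalar_fps_mult_bundle_series_nth) (rule supp)
    then show ?thesis using that by simp
  qed
  have A_nth: "fps_nth (A j) k = scalar (fps_nth 1 k) + (\<Sum>n\<le>k. scalar (fps_nth (?p j (Suc n)) k) * L ^ Suc n)" for j
    unfolding A_def bundle_series_def fps_nth_Abs_fps sum.atMost_Suc_shift by simp
  have "fps_X ^ (k + 1) dvd fps_X ^ Suc j * ?p j (Suc k)"
    by (metis dvd dvd_power_le mult_dvd_mono power_add add.commute diff_Suc_1 le_numeral_extra(4) power_one_right dvd_triv_left power_Suc mult.commute)
  then have z1: "fps_nth (fps_X ^ Suc j * ?p j (Suc k)) k = 0"
    by (rule fps_nth_eq_0_if_X_power_dvd) simp
  have "fps_X ^ (k + 1) dvd ?p (Suc j) (Suc k)"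
    by (intro dvd_mult2 le_imp_power_dvd) simp
  then have "fps_X ^ (k + 1) dvd c * fps_X ^ j * ?p (Suc j) (Suc k)" by (rule dvd_mult)
  then have z2: "fps_nth (c * fps_X ^ j * ?p (Suc j) (Suc k)) k = 0"
    by (rule fps_nth_eq_0_if_X_power_dvd) simp
  have rec: "?p j (Suc n) - fps_X ^ Suc j * ?p j n = ?p (Suc j) (Suc n) - c * fps_X ^ j * ?p (Suc j) n" for n
  proof -
    have "?p j (Suc n) - ?p (Suc j) (Suc n) = fps_X ^ (j * Suc n) * ((1 - fps_X ^ Suc n) * qbinom_coeff c (Suc n))"
      by (simp add: algebra_simps power_add)
    also have "\<dots> = fps_X ^ Suc j * ?p j n - c * fps_X ^ j * ?p (Suc j) n"
      unfolding qbinom_coeff_Suc by (simp add: algebra_simps power_add)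
    finally show ?thesis by (simp add: algebra_simps)
  qed
  have rec': "fps_nth (?p j (Suc n)) k - fps_nth (fps_X ^ Suc j * ?p j n) k =
      fps_nth (?p (Suc j) (Suc n)) k - fps_nth (c * fps_X ^ j * ?p (Suc j) n) k" for n
    using arg_cong[OF rec, of "\<lambda>f. fps_nth f k" n] by (simp only: fps_sub_nth)
  have expand: "fps_nth (A j) k - (\<Sum>n\<le>k. scalar (fps_nth (f * ?p j n) k) * L ^ Suc n) =
      scalar (fps_nth 1 k) + (\<Sum>n\<le>k. scalar (fps_nth (?p j (Suc n)) k - fps_nth (f * ?p j n) k) * L ^ Suc n)" for j f
    unfolding A_nth by (simp only: single_diff left_diff_distrib sum_subtractf add_diff_eq)
  have "fps_nth ((1 - fps_X ^ Suc j * fps_const L) * A j) k =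
      fps_nth (A j) k - (\<Sum>n\<le>k. scalar (fps_nth (fps_X ^ Suc j * ?p j n) k) * L ^ Suc n)"
    unfolding left_diff_distrib fps_sub_nth mult_1_left fps_X_power_eq_scalar_fps shift[OF z1] ..
  also have "\<dots> = fps_nth (A (Suc j)) k - (\<Sum>n\<le>k. scalar (fps_nth (c * fps_X ^ j * ?p (Suc j) n) k) * L ^ Suc n)"
    unfolding expand rec' ..
  also have "\<dots> = fps_nth ((1 - scalar_fps c * fps_X ^ j * fps_const L) * A (Suc j)) k"
    unfolding left_diff_distrib fps_sub_nth mult_1_left scalar_fps_mult_X shift[OF z2] ..
  finally show "fps_nth ((1 - fps_X ^ Suc j * fps_const L) * A j) k =
    fps_nth ((1 - scalar_fps c * fps_X ^ j * fps_const L) * A (Suc j)) k" .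
qed

text \<open>The remainder \<open>A M\<close> agrees with 1 below \<open>q^M\<close>, by
  \<open>bundle_series_qbinom_nth\<close>, so each coefficient of the infinite product is already
  that of a finite one.\<close>

lemma bundle_series_qbinom_prod:
  fixes L :: "'n::finite vbundle" and c :: "complex fps"
  defines "A \<equiv> \<lambda>j. bundle_series (\<lambda>n. fps_X ^ (j * n) * qbinom_coeff c n) L"
  shows "A 0 = (\<Prod>m<M. (1 - scalar_fps c * fps_X ^ m * fps_const L) * sym_total (fps_X ^ Suc m) L) * A M"
proof (induction M)
  case (Suc M)
  have "A M = ((1 - fps_X ^ Suc M * fps_const L) * sym_total (fps_X ^ Suc M) L) * A M"
    unfolding sym_total_inverse by simp
  also have "\<dots> = sym_total (fps_X ^ Suc M) L * ((1 - fps_X ^ Suc M * fps_const L) * A M)"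
    by (simp only: mult_ac)
  also have "\<dots> = sym_total (fps_X ^ Suc M) L * ((1 - scalar_fps c * fps_X ^ M * fps_const L) * A (Suc M))"
    unfolding A_def bundle_series_qbinom_step ..
  finally have "A M = (1 - scalar_fps c * fps_X ^ M * fps_const L) * sym_total (fps_X ^ Suc M) L * A (Suc M)"
    by (simp only: mult_ac)
  then show ?case using Suc by (simp only: prod.lessThan_Suc mult.assoc)
qed simp

lemma bundle_series_qbinom_nth:
  assumes "k < M"
  shows "fps_nth (bundle_series (\<lambda>n. fps_X ^ (M * n) * qbinom_coeff c n) L) k = fps_nth 1 k"
proof -
  have "fps_nth (fps_X ^ (M * Suc n) * qbinom_coeff c (Suc n)) k = 0" for n
    using assms by (simp add: fps_X_power_mult_nth)
  then show ?thesis
    unfolding bundle_series_def fps_nth_Abs_fps sum.atMost_Suc_shift by simp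
qed

text \<open>The theta quotient in Kronecker's expansion, with \<open>x^d\<close> replaced by the
  line bundle of \<open>d\<close> times the divisor of \<open>\<rho>\<close>.\<close>

definition ray_factor :: "'n::finite cone \<Rightarrow> complex \<Rightarrow> 'n vbundle fps" where
  "ray_factor \<rho> b = Abs_fps (\<lambda>k. \<Sum>n\<le>Suc k. \<Sum>m\<le>Suc k.
     Poly_Mapping.single (Poly_Mapping.single \<rho> (int m - int n)) (fps_nth (theta_coeff b n m) k))"

lemma line_bundle_power:
  "line_bundle (prime_div \<rho>) ^ n = Poly_Mapping.single (Poly_Mapping.single \<rho> (int n)) 1"
  "line_bundle (- prime_div \<rho>) ^ n = Poly_Mapping.single (Poly_Mapping.single \<rho> (- int n)) 1"
  by (induction n) (simp_all add: line_bundle_def mult_single single_add single_diff single_uminus flip: single_one)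

lemma ray_factor_eq:
  "bundle_series (qbinom_coeff (fps_const b)) (line_bundle (- prime_div \<rho>)) *
    bundle_series (qbinom_coeff (fps_const (inverse b) * fps_X)) (line_bundle (prime_div \<rho>)) = ray_factor \<rho> b"
proof (rule fps_ext)
  fix k
  let ?u = "qbinom_coeff (fps_const b)" and ?v = "qbinom_coeff (fps_const (inverse b) * fps_X)"
  let ?L = "line_bundle (- prime_div \<rho>)" and ?L' = "line_bundle (prime_div \<rho>)"
  have nth: "fps_nth (bundle_series (qbinom_coeff c) L) i = (\<Sum>n\<le>Suc k. scalar (fps_nth (qbinom_coeff c n) i) * L ^ n)"
    if "i \<le> k" for i c and L :: "'a vbundle"
    unfolding bundle_series_def fps_nth_Abs_fps
    by (rule sum.mono_neutral_left) (use that in \<open>auto simp: qbinom_coeff_nth_eq_0\<close>)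
  have mono: "scalar x * ?L ^ n * (scalar y * ?L' ^ m) =
      Poly_Mapping.single (Poly_Mapping.single \<rho> (int m - int n)) (x * y)" for x y n m
    unfolding line_bundle_power mult_single
    by (simp add: single_add[symmetric])
  have sum_swap3: "(\<Sum>i=0..k. \<Sum>n\<le>Suc k. \<Sum>m\<le>Suc k. f i n m) = (\<Sum>n\<le>Suc k. \<Sum>m\<le>Suc k. \<Sum>i=0..k. f i n m)"
    for f :: "nat \<Rightarrow> nat \<Rightarrow> nat \<Rightarrow> 'a vbundle"
  proof -
    have "(\<Sum>i=0..k. \<Sum>n\<le>Suc k. \<Sum>m\<le>Suc k. f i n m) = (\<Sum>n\<le>Suc k. \<Sum>i=0..k. \<Sum>m\<le>Suc k. f i n m)"
      by (rule sum.swap)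
    also have "\<dots> = (\<Sum>n\<le>Suc k. \<Sum>m\<le>Suc k. \<Sum>i=0..k. f i n m)"
      by (rule sum.cong[OF refl], rule sum.swap)
    finally show ?thesis .
  qed
  have "fps_nth (bundle_series ?u ?L * bundle_series ?v ?L') k =
      (\<Sum>i=0..k. \<Sum>n\<le>Suc k. \<Sum>m\<le>Suc k. Poly_Mapping.single (Poly_Mapping.single \<rho> (int m - int n))
        (fps_nth (?u n) i * fps_nth (?v m) (k - i)))"
    unfolding fps_mult_nth
  proof (intro sum.cong refl)
    fix i assume "i \<in> {0..k}"
    then show "fps_nth (bundle_series ?u ?L) i * fps_nth (bundle_series ?v ?L') (k - i) =
      (\<Sum>n\<le>Suc k. \<Sum>m\<le>Suc k. Poly_Mapping.single (Poly_Mapping.single \<rho> (int m - int n))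
        (fps_nth (?u n) i * fps_nth (?v m) (k - i)))"
      by (subst (1 2) nth) (simp_all only: sum_product mono, auto)
  qed
  also have "\<dots> = (\<Sum>n\<le>Suc k. \<Sum>m\<le>Suc k. \<Sum>i=0..k. Poly_Mapping.single (Poly_Mapping.single \<rho> (int m - int n))
        (fps_nth (?u n) i * fps_nth (?v m) (k - i)))"
    by (rule sum_swap3)
  also have "\<dots> = fps_nth (ray_factor \<rho> b) k"
  proof -
    have single_sum: "(\<Sum>i\<in>A. Poly_Mapping.single D (f i)) = Poly_Mapping.single D (\<Sum>i\<in>A. f i)"
      for A and f :: "nat \<Rightarrow> complex" and D :: "'a tdiv"
      by (induction A rule: infinite_finite_induct) (simp_all add: single_add)
    show ?thesis by (simp only: single_sum ray_factor_def theta_coeff_def fps_mult_nth fps_nth_Abs_fps)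
  qed
  finally show "fps_nth (bundle_series ?u ?L * bundle_series ?v ?L') k = fps_nth (ray_factor \<rho> b) k" .
qed

text \<open>Supplies the hypothesis \<open>p \<noteq> 0\<close> of \<open>prodinf_fps_eqI\<close>:
  in the constant term in \<open>q\<close>, the trivial bundle has coefficient 1.\<close>

lemma ray_factor_nonzero: "ray_factor (\<rho> :: 'n::finite cone) b \<noteq> 0"
proof
  assume 0: "ray_factor \<rho> b = 0"
  have z: "fps_nth (theta_coeff b n (Suc 0)) 0 = 0" for n by (rule theta_coeff_nth_eq_0) simp
  have "fps_nth (ray_factor \<rho> b) 0 = Poly_Mapping.single 0 (fps_nth (theta_coeff b 0 0) 0) +
      Poly_Mapping.single (Poly_Mapping.single \<rho> (- 1)) (fps_nth (theta_coeff b (Suc 0) 0) 0)"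
    by (simp add: ray_factor_def z)
  moreover have "Poly_Mapping.single \<rho> (- 1 :: int) \<noteq> 0"
    by (metis lookup_single_eq lookup_zero zero_neq_neg_one)
  moreover have "fps_nth (theta_coeff b 0 0) 0 = 1" by (simp add: theta_coeff_def)
  ultimately have "Poly_Mapping.lookup (fps_nth (ray_factor \<rho> b) 0) 0 = 1"
    by (simp add: lookup_add lookup_single when_def)
  then show False using 0 by simp
qed

text \<open>The powers of \<open>O(-D)\<close> form a q-binomial product with \<open>c = b\<close>,
  those of \<open>O(D)\<close> one with \<open>c = q / b\<close>. Multiplying by the two remainders
  does not change coefficients below \<open>q^M\<close>.\<close>

lemma prodinf_ray_factor:
  fixes \<rho> :: "'n::finite cone"
  assumes "b \<noteq> 0"
  shows "prodinf (\<lambda>m. ext_total (fps_const (scalar (- b)) * fps_X ^ m) (line_bundle (- prime_div \<rho>))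
            * ext_total (fps_const (scalar (- inverse b)) * fps_X ^ Suc m) (line_bundle (prime_div \<rho>))
            * sym_total (fps_X ^ Suc m) (line_bundle (- prime_div \<rho>))
            * sym_total (fps_X ^ Suc m) (line_bundle (prime_div \<rho>))) = ray_factor \<rho> b"
    (is "prodinf ?f = _")
proof (rule prodinf_fps_eqI)
  let ?L = "line_bundle (- prime_div \<rho>)" and ?L' = "line_bundle (prime_div \<rho>)"
  define c c' :: "complex fps" where "c = fps_const b" and "c' = fps_const (inverse b) * fps_X"
  define A where "A c L M = bundle_series (\<lambda>n. fps_X ^ (M * n) * qbinom_coeff c n) L" for c and L :: "'n vbundle" and M
  have scalar_const: "scalar_fps (fps_const x) = (fps_const (scalar x) :: 'n vbundle fps)" for x
    by (rule fps_ext) (simp add: scalar_fps_def)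
  have neg: "fps_const (scalar (- x)) = - (fps_const (scalar x) :: 'n vbundle fps)" for x
    by (simp add: single_uminus fps_const_neg)
  have f: "?f m = ((1 - scalar_fps c * fps_X ^ m * fps_const ?L) * sym_total (fps_X ^ Suc m) ?L) *
      ((1 - scalar_fps c' * fps_X ^ m * fps_const ?L') * sym_total (fps_X ^ Suc m) ?L')" for m
  proof -
    have "scalar_fps (fps_const (inverse b)) * fps_X ^ 1 =
        (scalar_fps (fps_const (inverse b) * fps_X ^ 1) :: 'n vbundle fps)"
      by (rule scalar_fps_mult_X)
    then have c': "scalar_fps c' = fps_const (scalar (inverse b)) * (fps_X :: 'n vbundle fps)"
      by (simp only: c'_def scalar_const power_one_right)
    have 1: "ext_total (fps_const (scalar (- b)) * fps_X ^ m) ?L = 1 - scalar_fps c * fps_X ^ m * fps_const ?L"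
      by (simp only: ext_total_def neg c_def scalar_const mult_minus_left add_uminus_conv_diff)
    have 2: "ext_total (fps_const (scalar (- inverse b)) * fps_X ^ Suc m) ?L' = 1 - scalar_fps c' * fps_X ^ m * fps_const ?L'"
      by (simp only: ext_total_def neg c' mult_minus_left add_uminus_conv_diff power_Suc mult.assoc)
    show ?thesis unfolding 1 2 by (simp only: mult_ac)
  qed
  have prod: "ray_factor \<rho> b = (\<Prod>m<M. ?f m) * (A c ?L M * A c' ?L' M)" for M
  proof -
    have "ray_factor \<rho> b = A c ?L 0 * A c' ?L' 0"
      unfolding A_def c_def c'_def by (simp add: ray_factor_eq)
    also have "A c ?L 0 = (\<Prod>m<M. (1 - scalar_fps c * fps_X ^ m * fps_const ?L) * sym_total (fps_X ^ Suc m) ?L) * A c ?L M"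
      unfolding A_def by (rule bundle_series_qbinom_prod)
    also have "A c' ?L' 0 = (\<Prod>m<M. (1 - scalar_fps c' * fps_X ^ m * fps_const ?L') * sym_total (fps_X ^ Suc m) ?L') * A c' ?L' M"
      unfolding A_def by (rule bundle_series_qbinom_prod)
    finally show ?thesis unfolding f prod.distrib by (simp only: mult_ac)
  qed
  fix k M :: nat assume "k < M"
  have "fps_nth (A c ?L M * A c' ?L' M) i = fps_nth 1 i" if "i \<le> k" for i
  proof -
    have "fps_nth (A c ?L M * A c' ?L' M) i = fps_nth (A c ?L M) i"
      unfolding A_def using \<open>k < M\<close> that by (intro fps_mult_nth_eq_left bundle_series_qbinom_nth) auto
    then show ?thesis unfolding A_def using \<open>k < M\<close> that by (simp add: bundle_series_qbinom_nth)
  qed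
  then have "fps_nth ((\<Prod>m<M. ?f m) * (A c ?L M * A c' ?L' M)) k = fps_nth (\<Prod>m<M. ?f m) k"
    by (rule fps_mult_nth_eq_left)
  then show "fps_nth (\<Prod>m<M. ?f m) k = fps_nth (ray_factor \<rho> b) k"
    using prod[of M] by simp
qed (rule ray_factor_nonzero)

lemma ELL_eq:
  fixes \<Delta> :: "'n::finite cone set"
  shows "ELL \<Delta> \<delta> z \<tau> = (\<Prod>\<rho>\<in>rays \<Delta>. fps_const (scalar (theta_prime_0 \<tau>)) *
    ray_factor \<rho> (exp (2 * of_real pi * \<i> * z) powi (1 - \<delta> \<rho>)))"
proof -
  define y where "y = exp (2 * of_real pi * \<i> * z)"
  have inv: "y powi (\<delta> \<rho> - 1) = inverse (y powi (1 - \<delta> \<rho>))" for \<rho>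
    by (simp flip: power_int_minus)
  have nz: "y powi (1 - \<delta> \<rho>) \<noteq> 0" for \<rho> by (simp add: y_def)
  have exponent: "- \<delta> \<rho> + 1 = 1 - \<delta> \<rho>" for \<rho> by simp
  show ?thesis
    unfolding ELL_def Let_def y_def[symmetric] inv exponent prodinf_ray_factor[OF nz] ..
qed

section \<open>Linear functionals on bundles and their separation by rays\<close>

definition weighted_sum :: "('n::finite tdiv \<Rightarrow> complex) \<Rightarrow> 'n vbundle \<Rightarrow> complex" where
  "weighted_sum g E = (\<Sum>D\<in>Poly_Mapping.keys E. Poly_Mapping.lookup E D * g D)"

lemma weighted_sum_superset:
  "finite A \<Longrightarrow> Poly_Mapping.keys E \<subseteq> A \<Longrightarrow> weighted_sum g E = (\<Sum>D\<in>A. Poly_Mapping.lookup E D * g D)"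
  unfolding weighted_sum_def by (rule sum.mono_neutral_left) (auto simp: in_keys_iff)

lemma weighted_sum_add: "weighted_sum g (E + F) = weighted_sum g E + weighted_sum g F"
proof -
  let ?A = "Poly_Mapping.keys E \<union> Poly_Mapping.keys F \<union> Poly_Mapping.keys (E + F)"
  have "weighted_sum g G = (\<Sum>D\<in>?A. Poly_Mapping.lookup G D * g D)" if "G \<in> {E, F, E + F}" for G
    by (rule weighted_sum_superset) (use that in auto)
  then show ?thesis by (simp add: lookup_add sum.distrib algebra_simps)
qed

lemma weighted_sum_sum: "weighted_sum g (\<Sum>i\<in>A. E i) = (\<Sum>i\<in>A. weighted_sum g (E i))"
  by (induction A rule: infinite_finite_induct) (simp_all add: weighted_sum_add, simp_all add: weighted_sum_def)

lemma weighted_sum_single [simp]: "weighted_sum g (Poly_Mapping.single D a) = a * g D"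
  by (simp add: weighted_sum_def)

lemma vbundle_expand: "E = (\<Sum>D\<in>Poly_Mapping.keys E. Poly_Mapping.single D (Poly_Mapping.lookup E D))"
  by (rule poly_mapping_eqI) (auto simp: lookup_sum lookup_single when_def in_keys_iff)

text \<open>The product rule for \<open>g\<close> is demanded only on divisors that occur, so it may
  depend on the factors involving disjoint sets of rays.\<close>

lemma weighted_sum_mult:
  assumes "\<And>D D'. D \<in> Poly_Mapping.keys E \<Longrightarrow> D' \<in> Poly_Mapping.keys F \<Longrightarrow> g (D + D') = g1 D * g2 D'"
  shows "weighted_sum g (E * F) = weighted_sum g1 E * weighted_sum g2 F"
proof -
  have "E * F = (\<Sum>D\<in>Poly_Mapping.keys E. \<Sum>D'\<in>Poly_Mapping.keys F.
      Poly_Mapping.single (D + D') (Poly_Mapping.lookup E D * Poly_Mapping.lookup F D'))"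
    by (subst (1) vbundle_expand[of E], subst (1) vbundle_expand[of F]) (simp add: sum_product mult_single)
  then show ?thesis
    by (simp add: weighted_sum_sum weighted_sum_def[of g1] weighted_sum_def[of g2] sum_product assms mult_ac)
qed

definition weighted_sum_fps :: "('n::finite tdiv \<Rightarrow> complex) \<Rightarrow> 'n vbundle fps \<Rightarrow> complex fps" where
  "weighted_sum_fps g f = Abs_fps (\<lambda>k. weighted_sum g (fps_nth f k))"

lemma weighted_sum_fps_mult:
  assumes "\<And>i j D D'. D \<in> Poly_Mapping.keys (fps_nth e i) \<Longrightarrow> D' \<in> Poly_Mapping.keys (fps_nth f j) \<Longrightarrow>
    g (D + D') = g1 D * g2 D'"
  shows "weighted_sum_fps g (e * f) = weighted_sum_fps g1 e * weighted_sum_fps g2 f"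
proof (rule fps_ext)
  fix k
  have "weighted_sum g (fps_nth e i * fps_nth f (k - i)) =
      weighted_sum g1 (fps_nth e i) * weighted_sum g2 (fps_nth f (k - i))" for i
    by (rule weighted_sum_mult) (rule assms)
  then show "fps_nth (weighted_sum_fps g (e * f)) k = fps_nth (weighted_sum_fps g1 e * weighted_sum_fps g2 f) k"
    by (simp add: weighted_sum_fps_def fps_mult_nth weighted_sum_sum)
qed

text \<open>Records which boundary divisors may occur. Series over disjoint sets of rays use
  different coordinates of the divisor, which is how the product rule for functionals is
  verified.\<close>

definition supported_on :: "'n::finite cone set \<Rightarrow> 'n vbundle fps \<Rightarrow> bool" where
  "supported_on R f \<longleftrightarrow> (\<forall>k. \<forall>D\<in>Poly_Mapping.keys (fps_nth f k). Poly_Mapping.keys D \<subseteq> R)"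

lemma keys_sum_subset: "Poly_Mapping.keys (\<Sum>i\<in>A. f i) \<subseteq> (\<Union>i\<in>A. Poly_Mapping.keys (f i))"
proof
  fix x assume "x \<in> Poly_Mapping.keys (\<Sum>i\<in>A. f i)"
  then have "(\<Sum>i\<in>A. Poly_Mapping.lookup (f i) x) \<noteq> 0" by (simp add: in_keys_iff lookup_sum)
  then obtain i where "i \<in> A" "Poly_Mapping.lookup (f i) x \<noteq> 0" by (meson sum.neutral)
  then show "x \<in> (\<Union>i\<in>A. Poly_Mapping.keys (f i))" by (auto simp: in_keys_iff)
qed

lemma supported_on_mult:
  assumes "supported_on R e" "supported_on R f"
  shows "supported_on R (e * f)"
  unfolding supported_on_def
proof (intro allI ballI)
  fix k D assume "D \<in> Poly_Mapping.keys (fps_nth (e * f) k)"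
  then have "D \<in> (\<Union>i\<in>{0..k}. Poly_Mapping.keys (fps_nth e i * fps_nth f (k - i)))"
    unfolding fps_mult_nth by (rule subsetD[OF keys_sum_subset])
  then obtain i where "D \<in> Poly_Mapping.keys (fps_nth e i * fps_nth f (k - i))" by blast
  then obtain D1 D2 where "D = D1 + D2" "D1 \<in> Poly_Mapping.keys (fps_nth e i)" "D2 \<in> Poly_Mapping.keys (fps_nth f (k - i))"
    using keys_mult by blast
  then show "Poly_Mapping.keys D \<subseteq> R"
    using assms keys_add[of D1 D2] unfolding supported_on_def by blast
qed

lemma supported_on_mono: "supported_on R f \<Longrightarrow> R \<subseteq> R' \<Longrightarrow> supported_on R' f"
  unfolding supported_on_def by blast

lemma supported_on_ray_factor: "supported_on {\<rho>} (ray_factor \<rho> b)"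
  unfolding supported_on_def
proof (intro allI ballI)
  fix k D assume "D \<in> Poly_Mapping.keys (fps_nth (ray_factor \<rho> b) k)"
  then have "D \<in> (\<Union>n\<in>{..Suc k}. Poly_Mapping.keys (\<Sum>m\<le>Suc k.
     Poly_Mapping.single (Poly_Mapping.single \<rho> (int m - int n)) (fps_nth (theta_coeff b n m) k)))"
    unfolding ray_factor_def fps_nth_Abs_fps by (rule subsetD[OF keys_sum_subset])
  then obtain n where "D \<in> Poly_Mapping.keys (\<Sum>m\<le>Suc k.
     Poly_Mapping.single (Poly_Mapping.single \<rho> (int m - int n)) (fps_nth (theta_coeff b n m) k))"
    by (rule UN_E)
  then have "D \<in> (\<Union>m\<in>{..Suc k}. Poly_Mapping.keys
     (Poly_Mapping.single (Poly_Mapping.single \<rho> (int m - int n)) (fps_nth (theta_coeff b n m) k)))"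
    by (rule subsetD[OF keys_sum_subset])
  then obtain m where "D \<in> Poly_Mapping.keys
     (Poly_Mapping.single (Poly_Mapping.single \<rho> (int m - int n)) (fps_nth (theta_coeff b n m) k))"
    by (rule UN_E)
  then show "Poly_Mapping.keys D \<subseteq> {\<rho>}" by (auto split: if_splits)
qed

lemma weighted_sum_fps_scalar:
  fixes f :: "'n::finite vbundle fps"
  shows
  "weighted_sum_fps g (fps_const (scalar a) * f) = fps_const a * weighted_sum_fps g f"
proof -
  have "weighted_sum_fps g (fps_const (scalar a) * f) = weighted_sum_fps (\<lambda>_. 1) (fps_const (scalar a :: 'n vbundle)) * weighted_sum_fps g f"
  proof (rule weighted_sum_fps_mult)
    fix i j D D' assume "D \<in> Poly_Mapping.keys (fps_nth (fps_const (scalar a :: 'n vbundle)) i)"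
    then have "D = 0" by (auto split: if_splits)
    then show "g (D + D') = 1 * g D'" by simp
  qed
  moreover have "weighted_sum_fps (\<lambda>_. 1) (fps_const (scalar a :: 'n vbundle)) = fps_const a"
    by (rule fps_ext) (simp add: weighted_sum_fps_def, simp add: weighted_sum_def)
  ultimately show ?thesis by simp
qed

text \<open>The support is part of the induction claim because splitting off a ray requires that the
  remaining product does not involve it.\<close>

lemma weighted_sum_fps_prod_ray_factor:
  assumes "finite R"
  shows "weighted_sum_fps (\<lambda>D. \<Prod>\<rho>\<in>R. of_bool (J \<rho> (Poly_Mapping.lookup D \<rho>)))
      (\<Prod>\<rho>\<in>R. fps_const (scalar a) * ray_factor \<rho> (b \<rho>)) =
    (\<Prod>\<rho>\<in>R. fps_const a * weighted_sum_fps (\<lambda>D. of_bool (J \<rho> (Poly_Mapping.lookup D \<rho>))) (ray_factor \<rho> (b \<rho>)))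
    \<and> supported_on R (\<Prod>\<rho>\<in>R. fps_const (scalar a) * ray_factor \<rho> (b \<rho>))"
  using assms
proof (induction R rule: finite_induct)
  case empty
  have "weighted_sum_fps (\<lambda>D. 1) (1 :: 'a vbundle fps) = 1"
    by (rule fps_ext) (simp add: weighted_sum_fps_def, simp add: weighted_sum_def)
  then show ?case by (auto simp: supported_on_def)
next
  case (insert \<rho> R)
  let ?P = "\<Prod>\<rho>\<in>R. fps_const (scalar a) * ray_factor \<rho> (b \<rho>)"
  let ?f = "fps_const (scalar a) * ray_factor \<rho> (b \<rho>)"
  have "supported_on {} (fps_const (scalar a))" by (auto simp: supported_on_def)
  then have f: "supported_on {\<rho>} ?f"
    by (intro supported_on_mult supported_on_ray_factor) (rule supported_on_mono, auto)
  have P: "supported_on R ?P" using insert by blast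
  have "weighted_sum_fps (\<lambda>D. \<Prod>\<rho>\<in>insert \<rho> R. of_bool (J \<rho> (Poly_Mapping.lookup D \<rho>))) (?f * ?P) =
      weighted_sum_fps (\<lambda>D. of_bool (J \<rho> (Poly_Mapping.lookup D \<rho>))) ?f *
      weighted_sum_fps (\<lambda>D. \<Prod>\<rho>\<in>R. of_bool (J \<rho> (Poly_Mapping.lookup D \<rho>))) ?P"
  proof (rule weighted_sum_fps_mult)
    fix i j D D' assume "D \<in> Poly_Mapping.keys (fps_nth ?f i)" "D' \<in> Poly_Mapping.keys (fps_nth ?P j)"
    then have "Poly_Mapping.keys D \<subseteq> {\<rho>}" "Poly_Mapping.keys D' \<subseteq> R"
      using f P by (auto simp: supported_on_def)
    then have "Poly_Mapping.lookup (D + D') \<rho> = Poly_Mapping.lookup D \<rho>"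
      "\<And>\<rho>'. \<rho>' \<in> R \<Longrightarrow> Poly_Mapping.lookup (D + D') \<rho>' = Poly_Mapping.lookup D' \<rho>'"
      using insert.hyps(2) by (auto simp: lookup_add in_keys_iff subset_iff)
    then show "(\<Prod>\<rho>\<in>insert \<rho> R. of_bool (J \<rho> (Poly_Mapping.lookup (D + D') \<rho>))) =
        of_bool (J \<rho> (Poly_Mapping.lookup D \<rho>)) * (\<Prod>\<rho>\<in>R. of_bool (J \<rho> (Poly_Mapping.lookup D' \<rho>)) :: complex)"
      using insert.hyps by simp
  qed
  moreover have "supported_on (insert \<rho> R) (?f * ?P)"
    by (rule supported_on_mult[OF supported_on_mono[OF f] supported_on_mono[OF P]]) auto
  ultimately show ?case using insert by (simp add: weighted_sum_fps_scalar)
qed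

text \<open>An inequality on the coefficient of \<open>\<rho>\<close> cuts off the theta quotient;
  the absence of a condition amounts to setting \<open>x = 1\<close>.\<close>

lemma weighted_sum_fps_ray_factor:
  "weighted_sum_fps (\<lambda>D. of_bool (0 \<le> N + Poly_Mapping.lookup D \<rho>)) (ray_factor \<rho> b) = theta_tail b N"
  "weighted_sum_fps (\<lambda>D. 1) (ray_factor \<rho> b) = theta_total b"
  by (rule fps_ext, simp only: weighted_sum_fps_def ray_factor_def theta_tail_def theta_total_def
      fps_nth_Abs_fps weighted_sum_sum weighted_sum_single lookup_single_eq mult_1_right)+


section \<open>Vanishing of the index\<close>

lemma equivariant_index_ELL:
  fixes \<Delta> :: "'n::finite cone set"
  assumes fan: "fan \<Delta>"
  shows "equivariant_index \<Delta> (fps_nth (ELL \<Delta> \<delta> z \<tau>) k) w =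
    fps_nth (fps_const (theta_prime_0 \<tau>) ^ card (rays \<Delta>) *
      (\<Sum>S\<in>Pow (maximal_cones \<Delta>) - {{}}. (-1) ^ (card S - 1) * (\<Prod>\<rho>\<in>rays \<Delta>.
        let b = exp (2 * of_real pi * \<i> * z) powi (1 - \<delta> \<rho>)
        in if \<rho> \<subseteq> \<Inter>S then theta_tail b (pairing (- w) (ray_gen \<rho>)) else theta_total b))) k"
proof -
  let ?M = "maximal_cones \<Delta>"
  have finM: "finite ?M" and finR: "finite (rays \<Delta>)"
    using fan by (auto intro: finite_maximal_cones finite_rays)
  define b where "b \<rho> = exp (2 * of_real pi * \<i> * z) powi (1 - \<delta> \<rho>)" for \<rho>
  define N where "N \<rho> = pairing (- w) (ray_gen \<rho>)" for \<rho>
  let ?a = "theta_prime_0 \<tau>"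
  define E where "E = ELL \<Delta> \<delta> z \<tau>"
  \<comment> \<open>Void for rays outside \<open>\<Inter>S\<close>, so that admissibility becomes a
    product over all rays.\<close>
  define J where "J S \<rho> d \<longleftrightarrow> (\<rho> \<subseteq> \<Inter>S \<longrightarrow> 0 \<le> N \<rho> + d)" for S \<rho> and d :: int
  have E: "E = (\<Prod>\<rho>\<in>rays \<Delta>. fps_const (scalar ?a) * ray_factor \<rho> (b \<rho>))"
    unfolding E_def ELL_eq b_def ..
  have adm: "of_bool (admissible \<Delta> D (- w) S) = (\<Prod>\<rho>\<in>rays \<Delta>. of_bool (J S \<rho> (Poly_Mapping.lookup D \<rho>)) :: complex)"
    for D S
  proof (cases "admissible \<Delta> D (- w) S")
    case True
    then show ?thesis by (auto simp: admissible_def J_def N_def intro!: prod.neutral[symmetric])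
  next
    case False
    then show ?thesis using finR by (auto simp: admissible_def J_def N_def intro!: prod_zero[symmetric])
  qed
  have "equivariant_index \<Delta> (fps_nth E k) w = (\<Sum>S\<in>Pow ?M - {{}}. (-1) ^ (card S - 1) *
      weighted_sum (\<lambda>D. of_bool (admissible \<Delta> D (- w) S)) (fps_nth E k))"
    unfolding equivariant_index_def weighted_sum_def euler_char_eq[OF finM] of_int_sum sum_distrib_left
    by (subst sum.swap) (intro sum.cong refl, simp)
  also have "\<dots> = (\<Sum>S\<in>Pow ?M - {{}}. (-1) ^ (card S - 1) *
      fps_nth (\<Prod>\<rho>\<in>rays \<Delta>. fps_const ?a * (if \<rho> \<subseteq> \<Inter>S then theta_tail (b \<rho>) (N \<rho>) else theta_total (b \<rho>))) k)"
  proof (intro sum.cong refl arg_cong[of _ _ "(*) _"])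
    fix S
    have factor: "weighted_sum_fps (\<lambda>D. of_bool (J S \<rho> (Poly_Mapping.lookup D \<rho>))) (ray_factor \<rho> (b \<rho>)) =
        (if \<rho> \<subseteq> \<Inter>S then theta_tail (b \<rho>) (N \<rho>) else theta_total (b \<rho>))" for \<rho>
      by (cases "\<rho> \<subseteq> \<Inter>S") (simp_all add: J_def weighted_sum_fps_ray_factor)
    have "weighted_sum (\<lambda>D. of_bool (admissible \<Delta> D (- w) S)) (fps_nth E k) =
        fps_nth (weighted_sum_fps (\<lambda>D. \<Prod>\<rho>\<in>rays \<Delta>. of_bool (J S \<rho> (Poly_Mapping.lookup D \<rho>))) E) k"
      by (simp add: weighted_sum_fps_def adm)
    also have "weighted_sum_fps (\<lambda>D. \<Prod>\<rho>\<in>rays \<Delta>. of_bool (J S \<rho> (Poly_Mapping.lookup D \<rho>))) E =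
        (\<Prod>\<rho>\<in>rays \<Delta>. fps_const ?a * weighted_sum_fps (\<lambda>D. of_bool (J S \<rho> (Poly_Mapping.lookup D \<rho>))) (ray_factor \<rho> (b \<rho>)))"
      unfolding E using weighted_sum_fps_prod_ray_factor[OF finR] by blast
    finally show "weighted_sum (\<lambda>D. of_bool (admissible \<Delta> D (- w) S)) (fps_nth E k) =
      fps_nth (\<Prod>\<rho>\<in>rays \<Delta>. fps_const ?a * (if \<rho> \<subseteq> \<Inter>S then theta_tail (b \<rho>) (N \<rho>) else theta_total (b \<rho>))) k"
      unfolding factor .
  qed
  also have "\<dots> = fps_nth (\<Sum>S\<in>Pow ?M - {{}}. (-1) ^ (card S - 1) *
      (\<Prod>\<rho>\<in>rays \<Delta>. fps_const ?a * (if \<rho> \<subseteq> \<Inter>S then theta_tail (b \<rho>) (N \<rho>) else theta_total (b \<rho>)))) k"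
  proof -
    have "fps_nth ((-1) ^ n * f) k = (-1) ^ n * fps_nth f k" for n and f :: "complex fps"
      by (cases "even n") auto
    then show ?thesis by (simp only: fps_sum_nth)
  qed
  also have "(\<Sum>S\<in>Pow ?M - {{}}. (-1) ^ (card S - 1) *
      (\<Prod>\<rho>\<in>rays \<Delta>. fps_const ?a * (if \<rho> \<subseteq> \<Inter>S then theta_tail (b \<rho>) (N \<rho>) else theta_total (b \<rho>)))) =
      fps_const ?a ^ card (rays \<Delta>) * (\<Sum>S\<in>Pow ?M - {{}}. (-1) ^ (card S - 1) *
      (\<Prod>\<rho>\<in>rays \<Delta>. if \<rho> \<subseteq> \<Inter>S then theta_tail (b \<rho>) (N \<rho>) else theta_total (b \<rho>)))"
    unfolding prod.distrib prod_constant sum_distrib_left by (simp only: mult_ac)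
  finally show ?thesis unfolding E_def b_def N_def Let_def .
qed

text \<open>The values of \<open>m'\<close> at ray generators may be negative and the denominators
  have to be inverted, so the computation takes place in the field of formal Laurent series.\<close>

lemma theta_fan_identity:
  fixes \<Delta> :: "'n::finite cone set"
  assumes fan: "fan \<Delta>" and smooth: "smooth_fan \<Delta>" and complete: "complete_fan \<Delta>"
    and y: "y \<noteq> 0" and m: "\<And>\<rho>. \<rho> \<in> rays \<Delta> \<Longrightarrow> y powi (- pairing m (ray_gen \<rho>)) \<noteq> 1"
  shows "(\<Sum>S\<in>Pow (maximal_cones \<Delta>) - {{}}. (-1) ^ (card S - 1) * (\<Prod>\<rho>\<in>rays \<Delta>.
        let b = y powi (- pairing m (ray_gen \<rho>))
        in if \<rho> \<subseteq> \<Inter>S then theta_tail b (pairing m' (ray_gen \<rho>)) else theta_total b)) = 0"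
proof -
  have finR: "finite (rays \<Delta>)" using fan by (rule finite_rays)
  define b where "b \<rho> = y powi (- pairing m (ray_gen \<rho>))" for \<rho>
  define N where "N \<rho> = pairing m' (ray_gen \<rho>)" for \<rho>
  define \<psi> where "\<psi> u = fls_const (y powi (- pairing m u)) * fls_X powi (pairing m' u)" for u
  have \<psi>_0: "\<psi> 0 = 1" by (simp add: \<psi>_def pairing_def)
  have \<psi>_add: "\<psi> (u + v) = \<psi> u * \<psi> v" for u v
  proof -
    have "y powi (- pairing m (u + v)) = y powi (- pairing m u) * y powi (- pairing m v)"
      using y by (simp add: pairing_add_right power_int_add[symmetric])
    moreover have "(fls_X :: complex fls) powi (pairing m' (u + v)) = fls_X powi pairing m' u * fls_X powi pairing m' v"
      by (subst power_int_add[symmetric]) (auto simp: pairing_add_right)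
    ultimately show ?thesis unfolding \<psi>_def by (simp only: fls_const_mult_const[symmetric] mult_ac)
  qed
  have \<psi>_ne: "1 - \<psi> (ray_gen \<rho>) \<noteq> 0" if "\<rho> \<in> rays \<Delta>" for \<rho>
  proof
    assume "1 - \<psi> (ray_gen \<rho>) = 0"
    \<comment> \<open>At this degree the equation says \<open>b \<rho> = 0\<close> if
      \<open>N \<rho> \<noteq> 0\<close>, and \<open>b \<rho> = 1\<close> if
      \<open>N \<rho> = 0\<close>; both are excluded.\<close>
    then have "fls_nth (\<psi> (ray_gen \<rho>)) (N \<rho>) = fls_nth 1 (N \<rho>)" by simp
    then have "b \<rho> = fls_nth (1 :: complex fls) (N \<rho>)"
      by (simp add: \<psi>_def b_def N_def)
    moreover have "b \<rho> \<noteq> 0" using y by (simp add: b_def)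
    moreover have "b \<rho> \<noteq> 1" using m[OF that] by (simp add: b_def)
    ultimately show False by (simp split: if_splits)
  qed
  define T where "T \<rho> = fps_to_fls (theta_total (b \<rho>))" for \<rho>
  have tail: "fps_to_fls (theta_tail (b \<rho>) (N \<rho>)) = T \<rho> / (1 - \<psi> (ray_gen \<rho>))" if "\<rho> \<in> rays \<Delta>" for \<rho>
  proof -
    have "(1 - \<psi> (ray_gen \<rho>)) * fps_to_fls (theta_tail (b \<rho>) (N \<rho>)) = T \<rho>"
      unfolding \<psi>_def T_def b_def N_def by (rule theta_tail_times) (use y in simp)
    then show ?thesis using \<psi>_ne[OF that] by (simp add: field_simps)
  qed
  have "fps_to_fls (\<Sum>S\<in>Pow (maximal_cones \<Delta>) - {{}}. (-1) ^ (card S - 1) * (\<Prod>\<rho>\<in>rays \<Delta>.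
        if \<rho> \<subseteq> \<Inter>S then theta_tail (b \<rho>) (N \<rho>) else theta_total (b \<rho>))) =
      (\<Sum>S\<in>Pow (maximal_cones \<Delta>) - {{}}. (-1) ^ (card S - 1) * (\<Prod>\<rho>\<in>rays \<Delta>.
        if \<rho> \<subseteq> \<Inter>S then T \<rho> / (1 - \<psi> (ray_gen \<rho>)) else T \<rho>))"
  proof -
    have fls_sum: "fps_to_fls (\<Sum>x\<in>A. f x) = (\<Sum>x\<in>A. fps_to_fls (f x))" for A and f :: "'n cone set \<Rightarrow> complex fps"
      by (induction A rule: infinite_finite_induct) simp_all
    have fls_prod: "fps_to_fls (\<Prod>x\<in>A. f x) = (\<Prod>x\<in>A. fps_to_fls (f x))" for A and f :: "'n cone \<Rightarrow> complex fps"
      by (induction A rule: infinite_finite_induct) (simp_all add: fls_times_fps_to_fls)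
    have "fps_to_fls ((-1) ^ n) = ((-1) ^ n :: complex fls)" for n
      by (simp add: fps_to_fls_power)
    then show ?thesis
      unfolding fls_sum fls_times_fps_to_fls fls_prod
      by (intro sum.cong refl arg_cong2[of _ _ _ _ "(*)"] prod.cong) (simp_all add: tail T_def)
  qed
  \<comment> \<open>The product of all quotients \<open>T \<rho> / (1 - \<psi> u)\<close> does not
    depend on \<open>S\<close>. Rays outside \<open>\<Inter>S\<close> lack the denominator and leave
    a factor \<open>1 - \<psi> u\<close>, which gives the sum of
    \<open>fan_character_identity\<close>.\<close>
  also have "\<dots> = (\<Sum>S\<in>Pow (maximal_cones \<Delta>) - {{}}. (\<Prod>\<rho>\<in>rays \<Delta>. T \<rho> / (1 - \<psi> (ray_gen \<rho>))) *
      ((-1) ^ (card S - 1) * (\<Prod>\<rho>\<in>{\<rho>\<in>rays \<Delta>. \<not> \<rho> \<subseteq> \<Inter>S}. 1 - \<psi> (ray_gen \<rho>))))"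
  proof (intro sum.cong refl)
    fix S
    have "(\<Prod>\<rho>\<in>rays \<Delta>. if \<rho> \<subseteq> \<Inter>S then T \<rho> / (1 - \<psi> (ray_gen \<rho>)) else T \<rho>) =
        (\<Prod>\<rho>\<in>rays \<Delta>. (T \<rho> / (1 - \<psi> (ray_gen \<rho>))) * (if \<not> \<rho> \<subseteq> \<Inter>S then 1 - \<psi> (ray_gen \<rho>) else 1))"
      by (intro prod.cong refl) (use \<psi>_ne in simp)
    also have "\<dots> = (\<Prod>\<rho>\<in>rays \<Delta>. T \<rho> / (1 - \<psi> (ray_gen \<rho>))) *
        (\<Prod>\<rho>\<in>{\<rho>\<in>rays \<Delta>. \<not> \<rho> \<subseteq> \<Inter>S}. 1 - \<psi> (ray_gen \<rho>))"
      unfolding prod.distrib by (subst prod.inter_filter[OF finR]) simp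
    finally show "(-1) ^ (card S - 1) * (\<Prod>\<rho>\<in>rays \<Delta>. if \<rho> \<subseteq> \<Inter>S then T \<rho> / (1 - \<psi> (ray_gen \<rho>)) else T \<rho>) =
        (\<Prod>\<rho>\<in>rays \<Delta>. T \<rho> / (1 - \<psi> (ray_gen \<rho>))) *
        ((-1) ^ (card S - 1) * (\<Prod>\<rho>\<in>{\<rho>\<in>rays \<Delta>. \<not> \<rho> \<subseteq> \<Inter>S}. 1 - \<psi> (ray_gen \<rho>)))"
      by (simp only: mult_ac)
  qed
  also have "\<dots> = (\<Prod>\<rho>\<in>rays \<Delta>. T \<rho> / (1 - \<psi> (ray_gen \<rho>))) *
      (\<Sum>S\<in>Pow (maximal_cones \<Delta>) - {{}}. (-1) ^ (card S - 1) *
        (\<Prod>\<rho>\<in>{\<rho>\<in>rays \<Delta>. \<not> \<rho> \<subseteq> \<Inter>S}. 1 - \<psi> (ray_gen \<rho>)))"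
    by (rule sum_distrib_left[symmetric])
  also have "\<dots> = 0"
    unfolding fan_character_identity[OF fan smooth complete \<psi>_0 \<psi>_add] by simp
  finally show ?thesis unfolding b_def N_def Let_def fps_to_fls_eq_0_iff .
qed

section \<open>Continuity in \<open>z\<close>\<close>

definition coeffwise_continuous :: "(complex \<Rightarrow> complex fps) \<Rightarrow> bool" where
  "coeffwise_continuous f \<longleftrightarrow> (\<forall>k. continuous_on UNIV (\<lambda>z. fps_nth (f z) k))"

lemma coeffwise_continuous_const: "coeffwise_continuous (\<lambda>z. c)"
  by (simp add: coeffwise_continuous_def)

lemma coeffwise_continuous_fps_const:
  "continuous_on UNIV g \<Longrightarrow> coeffwise_continuous (\<lambda>z. fps_const (g z))"
  unfolding coeffwise_continuous_def
proof
  fix k assume "continuous_on UNIV g"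
  then show "continuous_on UNIV (\<lambda>z. fps_nth (fps_const (g z)) k)" by (cases "k = 0") simp_all
qed

lemma coeffwise_continuous_diff:
  "coeffwise_continuous f \<Longrightarrow> coeffwise_continuous g \<Longrightarrow> coeffwise_continuous (\<lambda>z. f z - g z)"
  by (simp add: coeffwise_continuous_def continuous_on_diff)

lemma coeffwise_continuous_mult:
  "coeffwise_continuous f \<Longrightarrow> coeffwise_continuous g \<Longrightarrow> coeffwise_continuous (\<lambda>z. f z * g z)"
  by (simp add: coeffwise_continuous_def fps_mult_nth continuous_on_sum continuous_on_mult)

lemma coeffwise_continuous_sum:
  "(\<And>i. i \<in> A \<Longrightarrow> coeffwise_continuous (f i)) \<Longrightarrow> coeffwise_continuous (\<lambda>z. \<Sum>i\<in>A. f i z)"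
  by (simp add: coeffwise_continuous_def fps_sum_nth continuous_on_sum)

lemma coeffwise_continuous_prod:
  "(\<And>i. i \<in> A \<Longrightarrow> coeffwise_continuous (f i)) \<Longrightarrow> coeffwise_continuous (\<lambda>z. \<Prod>i\<in>A. f i z)"
  by (induction A rule: infinite_finite_induct) (simp_all add: coeffwise_continuous_mult coeffwise_continuous_const)

text \<open>Apart from \<open>g z\<close> itself, only series independent of \<open>z\<close> with
  constant term 1 are inverted, so all coefficients are Laurent polynomials in \<open>g z\<close>.
  They stay continuous where a denominator of Kronecker's expansion vanishes.\<close>

lemma coeffwise_continuous_theta:
  assumes g: "continuous_on UNIV g" "\<And>z. g z \<noteq> 0"
  shows "coeffwise_continuous (\<lambda>z. theta_tail (g z) N)" "coeffwise_continuous (\<lambda>z. theta_total (g z))"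
proof -
  have inv: "continuous_on UNIV (\<lambda>z. inverse (g z))"
    using g by (intro continuous_intros) auto
  have theta_coeff: "coeffwise_continuous (\<lambda>z. theta_coeff (g z) n m)" for n m
    unfolding theta_coeff_def qbinom_coeff_def
    by (intro coeffwise_continuous_mult coeffwise_continuous_prod coeffwise_continuous_diff
        coeffwise_continuous_const coeffwise_continuous_fps_const g(1) inv)
  then have cont: "continuous_on UNIV (\<lambda>z. fps_nth (theta_coeff (g z) n m) k)" for n m k
    by (simp add: coeffwise_continuous_def)
  show "coeffwise_continuous (\<lambda>z. theta_tail (g z) N)" "coeffwise_continuous (\<lambda>z. theta_total (g z))"
    unfolding coeffwise_continuous_def theta_tail_def theta_total_def fps_nth_Abs_fps
    by (intro allI continuous_on_sum continuous_on_mult continuous_on_const cont)+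
qed

theorem theorem5:
  fixes \<Delta> :: "(real ^ 'n::finite) set set"
    and \<delta> :: "(real ^ 'n) set \<Rightarrow> int"
  assumes "fan \<Delta>" and "smooth_fan \<Delta>" and "complete_fan \<Delta>"
    and "linearly_equivalent \<Delta>
           (canonical_div \<Delta> + (\<Sum>\<rho>\<in>rays \<Delta>. Poly_Mapping.single \<rho> (\<delta> \<rho>))) 0"
    and "\<forall>\<rho>\<in>rays \<Delta>. \<delta> \<rho> \<noteq> 1"
  shows "\<forall>z \<tau>. Im \<tau> > 0 \<longrightarrow>
           (\<forall>k w. equivariant_index \<Delta> (fps_nth (ELL \<Delta> \<delta> z \<tau>) k) w = 0)"
proof (intro allI impI)
  fix z \<tau> :: complex and k :: nat and w :: "'n lattice"
  have finR: "finite (rays \<Delta>)" using assms(1) by (rule finite_rays)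
  obtain m where "\<forall>\<rho>\<in>rays \<Delta>. pairing m (ray_gen \<rho>) =
      Poly_Mapping.lookup (canonical_div \<Delta> + (\<Sum>\<rho>\<in>rays \<Delta>. Poly_Mapping.single \<rho> (\<delta> \<rho>)) - 0) \<rho>"
    by (rule linearly_equivalent_character[OF assms(4)])
  then have m: "pairing m (ray_gen \<rho>) = \<delta> \<rho> - 1" if "\<rho> \<in> rays \<Delta>" for \<rho>
    using that finR by (simp add: canonical_div_def lookup_minus lookup_sum lookup_single when_def)
  define y where "y z = exp (2 * of_real pi * \<i> * z)" for z
  define F where "F z = (\<Sum>S\<in>Pow (maximal_cones \<Delta>) - {{}}. (-1) ^ (card S - 1) * (\<Prod>\<rho>\<in>rays \<Delta>.
        let b = y z powi (1 - \<delta> \<rho>)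
        in if \<rho> \<subseteq> \<Inter>S then theta_tail b (pairing (- w) (ray_gen \<rho>)) else theta_total b))" for z
  have y0: "y z \<noteq> 0" for z by (simp add: y_def)
  have generic: "F z = 0" if "Im z \<noteq> 0" for z
  proof -
    have exponent: "1 - \<delta> \<rho> = - pairing m (ray_gen \<rho>)" if "\<rho> \<in> rays \<Delta>" for \<rho> using m[OF that] by simp
    have norm_y: "cmod (y z) = exp (- (2 * pi * Im z))" by (simp add: y_def norm_exp_eq_Re)
    \<comment> \<open>Here \<open>\<delta> \<rho> \<noteq> 1\<close> enters: the modulus of
      \<open>y z\<close> is not 1, so no power of it with nonzero exponent is 1.\<close>
    have "y z powi (- pairing m (ray_gen \<rho>)) \<noteq> 1" if \<rho>: "\<rho> \<in> rays \<Delta>" for \<rho>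
    proof
      assume "y z powi (- pairing m (ray_gen \<rho>)) = 1"
      then have "cmod (y z powi (1 - \<delta> \<rho>)) = 1" using exponent[OF \<rho>] by simp
      then have "cmod (y z) powi (1 - \<delta> \<rho>) = 1" by (simp add: norm_power_int)
      then have "exp (of_int (1 - \<delta> \<rho>) * (- (2 * pi * Im z))) = 1"
        unfolding norm_y exp_power_int by (simp add: mult.commute)
      then have "of_int (1 - \<delta> \<rho>) * (- (2 * pi * Im z)) = 0" by (simp only: exp_eq_one_iff)
      then show False using assms(5) \<rho> that \<open>Im z \<noteq> 0\<close> by auto
    qed
    from theta_fan_identity[OF assms(1-3) y0 this]
    show ?thesis unfolding F_def by (simp add: exponent cong: prod.cong)
  qed
  have "coeffwise_continuous F"
  proof -
    have pw: "continuous_on UNIV (\<lambda>z. y z powi i)" for i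
      unfolding y_def exp_power_int by (intro continuous_intros)
    show ?thesis unfolding F_def Let_def
    proof (intro coeffwise_continuous_sum coeffwise_continuous_mult coeffwise_continuous_const coeffwise_continuous_prod)
      fix S \<rho>
      show "coeffwise_continuous (\<lambda>z. if \<rho> \<subseteq> \<Inter>S then theta_tail (y z powi (1 - \<delta> \<rho>)) (pairing (- w) (ray_gen \<rho>))
          else theta_total (y z powi (1 - \<delta> \<rho>)))"
        by (cases "\<rho> \<subseteq> \<Inter>S") (simp_all add: coeffwise_continuous_theta pw y0)
    qed
  qed
  then have cont: "isCont (\<lambda>z. fps_nth (F z) j) z" for j
    by (simp add: coeffwise_continuous_def continuous_on_eq_continuous_at)
  have "fps_nth (F z) j = 0" for j
  proof (rule LIMSEQ_unique)
    \<comment> \<open>A real \<open>z\<close> is approached from the upper half-plane; for any other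
      \<open>z\<close> the sequence is constant.\<close>
    define x where "x n = z + \<i> * of_real (if Im z = 0 then inverse (real (Suc n)) else 0)" for n
    have "(\<lambda>n. if Im z = 0 then inverse (real (Suc n)) else 0) \<longlonglongrightarrow> 0"
      using LIMSEQ_inverse_real_of_nat by (cases "Im z = 0") (simp_all del: of_nat_Suc)
    then have "x \<longlonglongrightarrow> z + \<i> * of_real 0"
      unfolding x_def by (intro tendsto_intros)
    then have "x \<longlonglongrightarrow> z" by simp
    then show "(\<lambda>n. fps_nth (F (x n)) j) \<longlonglongrightarrow> fps_nth (F z) j"
      by (rule isCont_tendsto_compose[OF cont])
    have "Im (x n) \<noteq> 0" for n by (auto simp: x_def)
    then show "(\<lambda>n. fps_nth (F (x n)) j) \<longlonglongrightarrow> 0" by (simp add: generic)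
  qed
  then have "F z = 0" by (simp add: fps_eq_iff)
  then show "equivariant_index \<Delta> (fps_nth (ELL \<Delta> \<delta> z \<tau>) k) w = 0"
    using equivariant_index_ELL[OF assms(1), of \<delta> z \<tau> k w] by (simp add: F_def y_def)
qed

end
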